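(* Let $I$ be a non-empty singular support. Then: (1) The transverse envelopes admit canonical transport along $L_I$. Under the identification of (the toric residual factor of) the envelopes with $Q_I$, this transport — the maps of $Q_I$ induced by $D_t$, $t\in\mathfrak g$ — depends only on the class $v\in V_I$ of $t$ and defines a holomorphic action $\tau_I:V_I\to\operatorname{Aut}(Q_I)$ of the additive group $V_I$, and, by restriction, a monodromy representation $\rho_I=\tau_I|_{\Gamma_I}:\Gamma_I\to\operatorname{Aut}(Q_I)$. (2) The suspension $(V_I\times Q_I)/\Gamma_I\to L_I$, where $\gamma\in\Gamma_I$ acts by $\gamma\cdot(v,x)=(v+\gamma,\rho_I(\gamma)^{-1}x)$, is a holomorphically trivial analytic bundle with fibre $Q_I$, carrying a canonical flat connection with monodromy $\rho_I$. (3) If the support weights $\Lambda_i$, $i\in I$, are linearly independent, then $L_I\simeq(\mathbb C^* )^I$ and this connection has the logarithmic form $$\nabla_I=d-\sum_{i\in I}\frac{dz_i}{z_i}\,\delta_i .$$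
   Context: Let $\mathfrak g=\mathbb C^k$ and let $\Lambda_1,\dots,\Lambda_n\in\mathfrak g^*$ span $\mathfrak g^*$; $\mathfrak g$ acts on $\mathbb C^n$ by $t\cdot z=(e^{\Lambda_j(t)}z_j)_j$. For $I\subset\{1,\dots,n\}$ put $J=I^c$, $r_I=\dim\operatorname{Span}\{\Lambda_i:i\in I\}$, $\mathfrak h_I=\bigcap_{i\in I}\ker\Lambda_i$. $I$ is a singular support if $r_I<k$. Put $S_I=\{\alpha\in\mathbb N^J:\sum_{j\in J}\alpha_j\Lambda_j|_{\mathfrak h_I}=0\}$ ($0\in\mathbb N$), $M_I=\operatorname{gp}(S_I)$, $Q_I=\operatorname{Spec}\mathbb C[S_I]$ (also its analytification), with monomial basis $X^\alpha$ of $\mathbb C[S_I]$ and quotient map $q_I:\mathbb C^J\to Q_I$, $q_I^*X^\alpha=w^\alpha$. The transverse analytic envelope at a point of support $I$ is $(\mathbb C^{|I|-r_I},0)\times Q_I$, whose toric residual factor is $Q_I$. Put $V_I=\mathfrak g/\mathfrak h_I$, $K_I=\{t\in\mathfrak g:\Lambda_i(t)\in2\pi\sqrt{-1}\,\mathbb Z\ \forall i\in I\}$, $\Gamma_I=K_I/\mathfrak h_I\subset V_I$, $L_I=V_I/\Gamma_I$; the orbit map identifies $L_I$ with every orbit of support $I$, and $\Gamma_I$ is the deck group of the universal cover $V_I\to L_I$. For $t\in\mathfrak g$ the action moves the standard transversal at $p$ to that at $t\cdot p$ and acts on the normal coordinates by $D_t(w)_j=e^{\Lambda_j(t)}w_j$,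 $j\in J$; the induced transport is the map $\tau$ of $Q_I$ with $q_I\circ D_t=\tau\circ q_I$. For $\alpha\in M_I$, the covector $\nu_\alpha=\sum_{j\in J}\alpha_j\Lambda_j$ vanishes on $\mathfrak h_I$ and so lies in $V_I^*$; $\omega_\alpha$ denotes the holomorphic 1-form on $L_I$ whose pullback to $V_I$ is $d\nu_\alpha$. The canonical connection is given, in the trivialisation $[v,x]\mapsto([v],\tau_I(v)x)$ of the suspension, on the algebra $\mathcal O_{L_I}\otimes_{\mathbb C}\mathbb C[S_I]$ by $\nabla_I(fX^\alpha)=df\,X^\alpha-f\,\omega_\alpha X^\alpha$; its horizontal curves in $L_I\times Q_I$ satisfy $dX^\alpha=X^\alpha\omega_\alpha$ for all $\alpha\in S_I$. When the support weights are independent, the coordinates on $L_I\simeq(\mathbb C^* )^I$ are $z_i=e^{\Lambda_i(v)}$, one writes uniquely $\nu_\alpha=\sum_{i\in I}c_i(\alpha)\Lambda_i$, and $\delta_i$ is the derivation of $\mathbb C[S_I]$ with $\delta_i(X^\alpha)=c_i(\alpha)X^\alpha$. *)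

theory Defs
  imports
    "HOL-Analysis.Analysis"
    "HOL-Library.Function_Algebras"
    "HOL-Library.Set_Algebras"
    "HOL-Library.Poly_Mapping"
    "HOL-Algebra.Group_Action"
begin

section \<open>Reduced complex spaces as spaces with a sheaf of functions\<close>

text \<open>
  All spaces below are reduced, so their structure sheaves are sheaves of complex-valued
  functions.  Membership in \<open>hol X U\<close> only constrains the values of a function on \<open>U\<close>.
\<close>

record 'a cspace =
  ctop :: "'a topology"
  hol :: "'a set \<Rightarrow> ('a \<Rightarrow> complex) set"

abbreviation points :: "'a cspace \<Rightarrow> 'a set" where
  "points X \<equiv> topspace (ctop X)"

text \<open>
  Complex differentiability at \<open>p\<close> of a function of the first \<open>m\<close> variables.  The number of
  variables has to vary inside definitions, hence points of \<open>\<complex>\<^sup>m\<close> are sequences of which only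
  the first \<open>m\<close> entries matter (the condition forces \<open>F z = F p\<close> if \<open>z\<close> and \<open>p\<close> agree there).
\<close>

definition cdifferentiable ::
    "nat \<Rightarrow> ((nat \<Rightarrow> complex) \<Rightarrow> complex) \<Rightarrow> (nat \<Rightarrow> complex) \<Rightarrow> bool" where
  "cdifferentiable m F p \<longleftrightarrow>
     (\<exists>d. \<forall>e>0. \<exists>r>0. \<forall>z. (\<forall>i<m. cmod (z i - p i) < r) \<longrightarrow>
        cmod (F z - F p - (\<Sum>i<m. d i * (z i - p i))) \<le> e * (\<Sum>i<m. cmod (z i - p i)))"

text \<open>
  The sheaf generated by families \<open>G U\<close> of functions: a section is locally a holomorphic
  function, defined on a polydisc, of finitely many generators.
\<close>

definition generated_space :: "'a topology \<Rightarrow> ('a set \<Rightarrow> ('a \<Rightarrow> complex) set) \<Rightarrow> 'a cspace" where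
  "generated_space T G =
     \<lparr>ctop = T,
      hol = (\<lambda>W. {f. openin T W \<and>
        (\<forall>x\<in>W. \<exists>U m g r F. openin T U \<and> x \<in> U \<and> U \<subseteq> W \<and> 0 < r \<and>
           (\<forall>i<m. g i \<in> G U) \<and>
           (\<forall>y\<in>U. \<forall>i<m. cmod (g i y - g i x) < r) \<and>
           (\<forall>z. (\<forall>i<m. cmod (z i - g i x) < r) \<longrightarrow> cdifferentiable m F z) \<and>
           (\<forall>y\<in>U. f y = F (\<lambda>i. g i y)))})\<rparr>"

definition weak_topology :: "'a set \<Rightarrow> ('a \<Rightarrow> complex) set \<Rightarrow> 'a topology" where
  "weak_topology X \<Phi> =
     topology_generated_by (insert X {{x \<in> X. \<phi> x \<in> U} | \<phi> U. \<phi> \<in> \<Phi> \<and> open U})"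

text \<open>The analytic space underlying a set of points with a family \<open>\<Phi>\<close> of regular functions.\<close>

definition coordinate_space :: "'a set \<Rightarrow> ('a \<Rightarrow> complex) set \<Rightarrow> 'a cspace" where
  "coordinate_space X \<Phi> = generated_space (weak_topology X \<Phi>) (\<lambda>_. \<Phi>)"

definition product_space :: "'a cspace \<Rightarrow> 'b cspace \<Rightarrow> ('a \<times> 'b) cspace" where
  "product_space X Y =
     generated_space (prod_topology (ctop X) (ctop Y))
       (\<lambda>W. {\<lambda>p. g (fst p) | g U. g \<in> hol X U \<and> fst ` W \<subseteq> U} \<union>
            {\<lambda>p. h (snd p) | h U. h \<in> hol Y U \<and> snd ` W \<subseteq> U})"

definition quotient_space :: "'a cspace \<Rightarrow> ('a \<Rightarrow> 'b) \<Rightarrow> 'b cspace" where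
  "quotient_space X p =
     (let T = topology (\<lambda>U. U \<subseteq> p ` points X \<and> openin (ctop X) {x \<in> points X. p x \<in> U})
      in \<lparr>ctop = T,
          hol = (\<lambda>U. {f. openin T U \<and> f \<circ> p \<in> hol X {x \<in> points X. p x \<in> U}})\<rparr>)"

definition holomorphic_map :: "'a cspace \<Rightarrow> 'b cspace \<Rightarrow> ('a \<Rightarrow> 'b) \<Rightarrow> bool" where
  "holomorphic_map X Y f \<longleftrightarrow>
     continuous_map (ctop X) (ctop Y) f \<and>
     (\<forall>U. openin (ctop Y) U \<longrightarrow>
        (\<forall>g\<in>hol Y U. g \<circ> f \<in> hol X {x \<in> points X. f x \<in> U}))"

definition biholomorphic_map :: "'a cspace \<Rightarrow> 'b cspace \<Rightarrow> ('a \<Rightarrow> 'b) \<Rightarrow> bool" where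
  "biholomorphic_map X Y f \<longleftrightarrow>
     holomorphic_map X Y f \<and>
     (\<exists>g. holomorphic_map Y X g \<and>
        (\<forall>x\<in>points X. g (f x) = x) \<and> (\<forall>y\<in>points Y. f (g y) = y))"

text \<open>\<open>\<Phi>\<close> is a global holomorphic trivialisation of \<open>\<pi> : E \<rightarrow> B\<close> with fibre \<open>F\<close>.\<close>

definition holomorphic_trivialisation ::
    "'e cspace \<Rightarrow> ('e \<Rightarrow> 'b) \<Rightarrow> 'b cspace \<Rightarrow> 'f cspace \<Rightarrow> ('e \<Rightarrow> 'b \<times> 'f) \<Rightarrow> bool" where
  "holomorphic_trivialisation E \<pi> B F \<Phi> \<longleftrightarrow>
     holomorphic_map E B \<pi> \<and>
     biholomorphic_map E (product_space B F) \<Phi> \<and>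
     (\<forall>e\<in>points E. fst (\<Phi> e) = \<pi> e)"


section \<open>Covectors and the linear diagonal action\<close>

global_interpretation covector: vector_space "\<lambda>(c::complex) (f::'a \<Rightarrow> complex) x. c * f x"
  by unfold_locales (simp_all add: fun_eq_iff algebra_simps)

definition covectors :: "(complex^'k \<Rightarrow> complex) set" where
  "covectors = {f. Vector_Spaces.linear (*s) (*) f}"

definition act :: "('n \<Rightarrow> complex^'k \<Rightarrow> complex) \<Rightarrow> complex^'k \<Rightarrow> complex^'n \<Rightarrow> complex^'n" where
  "act \<Lambda> t z = (\<chi> j. exp (\<Lambda> j t) * z $ j)"

definition support :: "complex^'n \<Rightarrow> 'n set" where
  "support z = {j. z $ j \<noteq> 0}"

text \<open>
  The point with normal coordinates \<open>w \<in> \<complex>\<^sup>J\<close>, where \<open>J = - I\<close>, on the transversal at a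
  point \<open>p\<close> of support \<open>I\<close>.
\<close>

definition normal_point :: "'n set \<Rightarrow> complex^'n \<Rightarrow> ('n \<Rightarrow> complex) \<Rightarrow> complex^'n" where
  "normal_point I p w = (\<chi> j. if j \<in> I then p $ j else w j)"

type_synonym 'n exponent = "'n \<Rightarrow>\<^sub>0 nat"
type_synonym 'n regular = "'n exponent \<Rightarrow>\<^sub>0 complex"

definition scal :: "complex \<Rightarrow> 'n regular \<Rightarrow> 'n regular" where
  "scal c p = Poly_Mapping.map ((*) c) p"

definition monomial :: "'n exponent \<Rightarrow> 'n regular" where
  "monomial \<alpha> = Poly_Mapping.single \<alpha> 1"


section \<open>Data attached to a support\<close>

context
  fixes \<Lambda> :: "'n::finite \<Rightarrow> complex^'k \<Rightarrow> complex" and I :: "'n set"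
begin

definition support_rank :: nat where
  "support_rank = covector.dim (\<Lambda> ` I)"

definition singular_support :: bool where
  "singular_support \<longleftrightarrow> support_rank < CARD('k)"

definition isotropy :: "(complex^'k) set" where
  "isotropy = {t. \<forall>i\<in>I. \<Lambda> i t = 0}"

definition period_group :: "(complex^'k) set" where
  "period_group = {t. \<forall>i\<in>I. \<exists>m::int. \<Lambda> i t = 2 * of_real pi * \<i> * of_int m}"

subsection \<open>The space \<open>V = \<gg> / \<hh>\<close>, its lattice and the leaf \<open>V / \<Gamma>\<close>\<close>

text \<open>Points of \<open>V\<close> are cosets; addition in \<open>V\<close> is elementwise addition of sets.\<close>

definition hcoset :: "complex^'k \<Rightarrow> (complex^'k) set" where
  "hcoset t = t +o isotropy"

definition V_set :: "(complex^'k) set set" where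
  "V_set = range hcoset"

definition Gamma :: "(complex^'k) set set" where
  "Gamma = hcoset ` period_group"

definition V_group :: "(complex^'k) set monoid" where
  "V_group = \<lparr>carrier = V_set, mult = (+), one = hcoset 0\<rparr>"

definition Gamma_group :: "(complex^'k) set monoid" where
  "Gamma_group = \<lparr>carrier = Gamma, mult = (+), one = hcoset 0\<rparr>"

definition leaf_point :: "complex^'k \<Rightarrow> (complex^'k) set set" where
  "leaf_point t = hcoset t +o Gamma"

definition V_space :: "(complex^'k) set cspace" where
  "V_space = quotient_space (coordinate_space UNIV (range (\<lambda>a t. t $ a))) hcoset"

definition L_space :: "(complex^'k) set set cspace" where
  "L_space = quotient_space V_space (\<lambda>v. v +o Gamma)"

subsection \<open>The toric residual factor\<close>

definition S_monoid :: "'n exponent set" where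
  "S_monoid = {\<alpha>. Poly_Mapping.keys \<alpha> \<subseteq> - I \<and>
     (\<forall>t\<in>isotropy. (\<Sum>j\<in>- I. of_nat (Poly_Mapping.lookup \<alpha> j) * \<Lambda> j t) = 0)}"

text \<open>The monoid algebra \<open>\<complex>[S]\<close> as a subalgebra of \<open>\<complex>[\<nat>\<^sup>n]\<close>.\<close>

definition S_algebra :: "'n regular set" where
  "S_algebra = {p. Poly_Mapping.keys p \<subseteq> S_monoid}"

text \<open>The closed points of \<open>Spec \<complex>[S]\<close>: algebra homomorphisms to \<open>\<complex>\<close>.\<close>

definition Q_set :: "('n regular \<Rightarrow> complex) set" where
  "Q_set = {x \<in> extensional S_algebra. x 1 = 1 \<and>
     (\<forall>p\<in>S_algebra. \<forall>q\<in>S_algebra. x (p + q) = x p + x q \<and> x (p * q) = x p * x q) \<and>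
     (\<forall>c. \<forall>p\<in>S_algebra. x (scal c p) = c * x p)}"

definition Q_space :: "('n regular \<Rightarrow> complex) cspace" where
  "Q_space = coordinate_space Q_set ((\<lambda>p x. x p) ` S_algebra)"

text \<open>
  Automorphisms of \<open>Q\<close> as an affine variety (the comorphism maps the algebra of regular
  functions onto itself) which are also automorphisms of its analytification.
\<close>

definition Q_aut :: "(('n regular \<Rightarrow> complex) \<Rightarrow> ('n regular \<Rightarrow> complex)) set" where
  "Q_aut = {f \<in> Bij Q_set.
     (\<lambda>p. \<lambda>x\<in>Q_set. f x p) ` S_algebra = (\<lambda>p. \<lambda>x\<in>Q_set. x p) ` S_algebra \<and>
     biholomorphic_map Q_space Q_space f}"

definition normal_coords :: "('n \<Rightarrow> complex) set" where
  "normal_coords = PiE (- I) (\<lambda>_. UNIV)"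

definition quotient_map_q :: "('n \<Rightarrow> complex) \<Rightarrow> ('n regular \<Rightarrow> complex)" where
  "quotient_map_q w = (\<lambda>p\<in>S_algebra. \<Sum>\<alpha>\<in>Poly_Mapping.keys p.
     Poly_Mapping.lookup p \<alpha> * (\<Prod>j\<in>- I. w j ^ Poly_Mapping.lookup \<alpha> j))"

definition normal_act :: "complex^'k \<Rightarrow> ('n \<Rightarrow> complex) \<Rightarrow> ('n \<Rightarrow> complex)" where
  "normal_act t w = (\<lambda>j\<in>- I. exp (\<Lambda> j t) * w j)"

subsection \<open>Transport and monodromy\<close>

definition induced_transport ::
    "complex^'k \<Rightarrow> (('n regular \<Rightarrow> complex) \<Rightarrow> ('n regular \<Rightarrow> complex)) \<Rightarrow> bool" where
  "induced_transport t \<sigma> \<longleftrightarrow>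
     \<sigma> \<in> Q_set \<rightarrow>\<^sub>E Q_set \<and>
     (\<forall>w\<in>normal_coords. quotient_map_q (normal_act t w) = \<sigma> (quotient_map_q w))"

definition tau :: "(complex^'k) set \<Rightarrow> ('n regular \<Rightarrow> complex) \<Rightarrow> ('n regular \<Rightarrow> complex)" where
  "tau v = (THE \<sigma>. \<exists>t\<in>v. induced_transport t \<sigma>)"

definition rho :: "(complex^'k) set \<Rightarrow> ('n regular \<Rightarrow> complex) \<Rightarrow> ('n regular \<Rightarrow> complex)" where
  "rho = restrict tau Gamma"

subsection \<open>The suspension\<close>

definition susp_act ::
    "(complex^'k) set \<Rightarrow> (complex^'k) set \<times> ('n regular \<Rightarrow> complex)
       \<Rightarrow> (complex^'k) set \<times> ('n regular \<Rightarrow> complex)" where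
  "susp_act \<gamma> = (\<lambda>(v, x)\<in>V_set \<times> Q_set. (v + \<gamma>, inv_into Q_set (rho \<gamma>) x))"

definition susp_class ::
    "(complex^'k) set \<times> ('n regular \<Rightarrow> complex)
       \<Rightarrow> ((complex^'k) set \<times> ('n regular \<Rightarrow> complex)) set" where
  "susp_class = orbit Gamma_group susp_act"

definition E_space :: "((complex^'k) set \<times> ('n regular \<Rightarrow> complex)) set cspace" where
  "E_space = quotient_space (product_space V_space Q_space) susp_class"

text \<open>In the next two definitions all points of a class \<open>e\<close> have the same image.\<close>

definition susp_proj ::
    "((complex^'k) set \<times> ('n regular \<Rightarrow> complex)) set \<Rightarrow> (complex^'k) set set" where
  "susp_proj e = the_elem ((\<lambda>(v, x). v +o Gamma) ` e)"

definition susp_triv ::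
    "((complex^'k) set \<times> ('n regular \<Rightarrow> complex)) set
       \<Rightarrow> (complex^'k) set set \<times> ('n regular \<Rightarrow> complex)" where
  "susp_triv e = the_elem ((\<lambda>(v, x). (v +o Gamma, tau v x)) ` e)"

subsection \<open>Differential forms and the canonical connection\<close>

text \<open>
  Translations identify every tangent space of the leaf with \<open>V = \<gg> / \<hh>\<close>.  A 1-form on the leaf
  is therefore given by its values \<open>\<eta> l \<xi>\<close> on the translation-invariant vector fields
  \<open>\<xi> \<in> \<gg>\<close>; each \<open>\<eta> l\<close> is linear and kills \<open>\<hh>\<close>.  In these terms the pullback of \<open>\<eta>\<close> to \<open>V\<close>
  has the value \<open>\<eta> (v +o Gamma) \<xi>\<close> at \<open>v\<close>.  The exterior derivative of a function is the
  derivative along the translation flow of \<open>\<xi>\<close>.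
\<close>

definition ext_d ::
    "((complex^'k) set set \<Rightarrow> complex) \<Rightarrow> (complex^'k) set set \<Rightarrow> complex^'k \<Rightarrow> complex" where
  "ext_d f l \<xi> = deriv (\<lambda>c. f (hcoset (c *s \<xi>) +o l)) 0"

definition nu :: "'n exponent \<Rightarrow> complex^'k \<Rightarrow> complex" where
  "nu \<alpha> t = (\<Sum>j\<in>- I. of_nat (Poly_Mapping.lookup \<alpha> j) * \<Lambda> j t)"

text \<open>The pullback of \<open>\<omega>\<^sub>\<alpha>\<close> is \<open>d \<nu>\<^sub>\<alpha>\<close>, whose value at every point is the linear form \<open>\<nu>\<^sub>\<alpha>\<close>.\<close>

definition omega :: "'n exponent \<Rightarrow> (complex^'k) set set \<Rightarrow> complex^'k \<Rightarrow> complex" where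
  "omega \<alpha> l \<xi> = nu \<alpha> \<xi>"

text \<open>
  Sections of \<open>\<O> \<otimes> \<complex>[S]\<close> over \<open>U\<close>: functions with values in \<open>\<complex>[S]\<close>, involving only finitely
  many monomials, with holomorphic coefficients.
\<close>

definition alg_sections :: "(complex^'k) set set set \<Rightarrow> ((complex^'k) set set \<Rightarrow> 'n regular) set" where
  "alg_sections U = {s. openin (ctop L_space) U \<and>
     (\<exists>A. finite A \<and> A \<subseteq> S_monoid \<and> (\<forall>l\<in>U. Poly_Mapping.keys (s l) \<subseteq> A)) \<and>
     (\<forall>\<alpha>. (\<lambda>l. Poly_Mapping.lookup (s l) \<alpha>) \<in> hol L_space U)}"

definition coeff_d ::
    "((complex^'k) set set \<Rightarrow> 'n regular) \<Rightarrow> (complex^'k) set set \<Rightarrow> complex^'k \<Rightarrow> 'n regular" where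
  "coeff_d s l \<xi> =
     Abs_poly_mapping (\<lambda>\<alpha>. ext_d (\<lambda>l'. Poly_Mapping.lookup (s l') \<alpha>) l \<xi>)"

definition nabla ::
    "((complex^'k) set set \<Rightarrow> 'n regular) \<Rightarrow> (complex^'k) set set \<Rightarrow> complex^'k \<Rightarrow> 'n regular" where
  "nabla s l \<xi> = coeff_d s l \<xi> - Poly_Mapping.mapp (\<lambda>\<alpha> a. a * omega \<alpha> l \<xi>) (s l)"

text \<open>
  Connections on the algebra \<open>\<O> \<otimes> \<complex>[S]\<close>: local, additive, with values in holomorphic
  1-forms, satisfying the Leibniz rule over \<open>\<O>\<close> and compatible with the product of \<open>\<complex>[S]\<close>.
\<close>

definition algebra_connection ::
    "(((complex^'k) set set \<Rightarrow> 'n regular) \<Rightarrow> (complex^'k) set set \<Rightarrow> complex^'k \<Rightarrow> 'n regular)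
       \<Rightarrow> bool" where
  "algebra_connection D \<longleftrightarrow>
     (\<forall>U. \<forall>s\<in>alg_sections U.
        (\<forall>\<xi>. (\<lambda>l. D s l \<xi>) \<in> alg_sections U) \<and>
        (\<forall>l\<in>U. (\<forall>a b \<xi> \<eta>. D s l (a *s \<xi> + b *s \<eta>) = scal a (D s l \<xi>) + scal b (D s l \<eta>)) \<and>
                (\<forall>\<xi>\<in>isotropy. D s l \<xi> = 0)) \<and>
        (\<forall>s'\<in>alg_sections U. \<forall>l\<in>U. \<forall>\<xi>.
           D (\<lambda>l. s l + s' l) l \<xi> = D s l \<xi> + D s' l \<xi> \<and>
           D (\<lambda>l. s l * s' l) l \<xi> = D s l \<xi> * s' l + s l * D s' l \<xi>) \<and>
        (\<forall>f\<in>hol L_space U. \<forall>l\<in>U. \<forall>\<xi>.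
           D (\<lambda>l. scal (f l) (s l)) l \<xi> = scal (ext_d f l \<xi>) (s l) + scal (f l) (D s l \<xi>)) \<and>
        (\<forall>s'\<in>alg_sections U. (\<forall>l\<in>U. s l = s' l) \<longrightarrow> (\<forall>l\<in>U. D s l = D s' l)))"

text \<open>
  Vanishing of the curvature, evaluated on translation-invariant vector fields; these commute,
  so the bracket term is absent.
\<close>

definition flat ::
    "(((complex^'k) set set \<Rightarrow> 'n regular) \<Rightarrow> (complex^'k) set set \<Rightarrow> complex^'k \<Rightarrow> 'n regular)
       \<Rightarrow> bool" where
  "flat D \<longleftrightarrow>
     (\<forall>U. \<forall>s\<in>alg_sections U. \<forall>l\<in>U. \<forall>\<xi> \<eta>.
        D (\<lambda>l'. D s l' \<eta>) l \<xi> - D (\<lambda>l'. D s l' \<xi>) l \<eta> = 0)"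

text \<open>
  A curve in the leaf is given by a lift \<open>u\<close> to \<open>\<gg>\<close>.  The curve \<open>(leaf_point \<circ> u, y)\<close> in
  \<open>L \<times> Q\<close> is horizontal if \<open>dX\<^sup>\<alpha> = X\<^sup>\<alpha> \<omega>\<^sub>\<alpha>\<close> along it.  The convention is that the coefficient
  \<open>f = X\<^sup>\<alpha>\<close> along the curve solves \<open>\<nabla>(f X\<^sup>\<alpha>) = 0\<close>.
\<close>

definition horizontal :: "(real \<Rightarrow> complex^'k) \<Rightarrow> (real \<Rightarrow> 'n regular \<Rightarrow> complex) \<Rightarrow> bool" where
  "horizontal u y \<longleftrightarrow>
     (\<forall>s\<in>{0..1}. y s \<in> Q_set \<and>
        (\<forall>\<alpha>\<in>S_monoid. ((\<lambda>s. y s (monomial \<alpha>)) has_vector_derivative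
           y s (monomial \<alpha>) * omega \<alpha> (leaf_point (u s)) (vector_derivative u (at s)))
           (at s within {0..1})))"

text \<open>
  Parallel transport along every curve exists and is unique; along a loop of the leaf,
  whose class in the deck group is the difference \<open>\<gamma>\<close> of the end points of a lift to \<open>V\<close>, it
  is \<open>R \<gamma>\<close>.
\<close>

definition has_monodromy ::
    "((complex^'k) set \<Rightarrow> ('n regular \<Rightarrow> complex) \<Rightarrow> ('n regular \<Rightarrow> complex)) \<Rightarrow> bool" where
  "has_monodromy R \<longleftrightarrow>
     (\<forall>u. u C1_differentiable_on {0..1} \<longrightarrow> (\<forall>x\<in>Q_set.
        \<exists>y. horizontal u y \<and> y 0 = x \<and>
          (\<forall>y'. horizontal u y' \<and> y' 0 = x \<longrightarrow> (\<forall>s\<in>{0..1}. y' s = y s)) \<and>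
          (leaf_point (u 1) = leaf_point (u 0) \<longrightarrow> y 1 = R (hcoset (u 1 - u 0)) x)))"

subsection \<open>Independent support weights\<close>

definition independent_weights :: bool where
  "independent_weights \<longleftrightarrow> inj_on \<Lambda> I \<and> covector.independent (\<Lambda> ` I)"

definition torus_space :: "('n \<Rightarrow> complex) cspace" where
  "torus_space = coordinate_space (PiE I (\<lambda>_. - {0})) ((\<lambda>i z. z i) ` I)"

text \<open>\<open>\<Union>l\<close> is the set of all \<open>t \<in> \<gg>\<close> representing \<open>l\<close>; \<open>exp \<circ> \<Lambda> i\<close> is constant on it.\<close>

definition z_coord :: "'n \<Rightarrow> (complex^'k) set set \<Rightarrow> complex" where
  "z_coord i l = the_elem ((\<lambda>t. exp (\<Lambda> i t)) ` \<Union>l)"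

definition z_coords :: "(complex^'k) set set \<Rightarrow> 'n \<Rightarrow> complex" where
  "z_coords l = (\<lambda>i\<in>I. z_coord i l)"

text \<open>\<open>c\<^sub>i(\<alpha>)\<close>, the coefficient of \<open>\<Lambda>\<^sub>i\<close> in the expansion of \<open>\<nu>\<^sub>\<alpha>\<close> in the basis \<open>\<Lambda> ` I\<close>.\<close>

definition c_coeff :: "'n \<Rightarrow> 'n exponent \<Rightarrow> complex" where
  "c_coeff i \<alpha> = covector.representation (\<Lambda> ` I) (nu \<alpha>) (\<Lambda> i)"

definition delta :: "'n \<Rightarrow> 'n regular \<Rightarrow> 'n regular" where
  "delta i p = Poly_Mapping.mapp (\<lambda>\<alpha> a. c_coeff i \<alpha> * a) p"

end

end

theory Submission
  imports Defs "HOL-Complex_Analysis.Complex_Analysis"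
begin

text \<open>
  A point of \<open>Q\<close> is a character \<open>x\<close> of the monoid \<open>S\<close>.  The exponents at which \<open>x\<close> does not vanish are
  those supported on a certain set of coordinates, they generate a subgroup of a lattice, and a
  \<open>\<complex>\<^sup>*\<close>-valued character of a subgroup of a lattice extends to the lattice; so \<open>x = q(w)\<close> for some
  \<open>w\<close>.  As \<open>q\<close> is surjective, the transport is forced to be \<open>X\<^sup>\<alpha> \<mapsto> exp (\<nu>\<^sub>\<alpha>(t)) X\<^sup>\<alpha>\<close>, and it depends
  only on the class of \<open>t\<close> because \<open>\<nu>\<^sub>\<alpha>\<close> vanishes on \<open>\<hh>\<close>.

  Since \<open>\<tau>\<close> is defined on all of \<open>V\<close>, the map \<open>(v, x) \<mapsto> ([v], \<tau>(v) x)\<close> is invariant under \<open>\<Gamma>\<close> and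
  trivialises the suspension; its inverse is holomorphic because \<open>V \<rightarrow> L\<close> has local sections.

  On translation-invariant fields \<open>\<xi>\<close> the connection acts on the coefficient of \<open>X\<^sup>\<alpha>\<close> as
  \<open>\<partial>\<^sub>\<xi> - \<nu>\<^sub>\<alpha>(\<xi>)\<close>.  Flatness thus amounts to the symmetry of mixed derivatives, and parallel transport
  to scalar linear differential equations solved by \<open>exp (\<nu>\<^sub>\<alpha>)\<close>.  For complex differentiable
  functions of several variables, both the differentiability of directional derivatives and the
  symmetry follow from Cauchy's estimate along complex lines.
\<close>

section \<open>Complex differentiability\<close>

text \<open>The sheaf of a space is given by an existential condition, a finite list of generators
  and a function \<open>F\<close> near each point, which is unwieldy under products, quotients and
  suspensions. The closure properties collected in \<open>function_sheaf\<close> replace it: they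
  hold for generated spaces, hence for coordinate spaces and products, and pass to quotients by
  pullback. Holomorphy of a map into a generated space is then tested on generators: on coordinates
  for affine space and the torus, on monomials for \<open>Q\<close>.

  Cosets have no canonical representative, and nothing is known about the continuity of a chosen
  one. For \<alpha> in \<open>S\<close>, however, \<open>nu\<close> takes the same value on a whole
  coset, so the transport is holomorphic on \<open>V\<close> although it is written with an
  arbitrary choice.

  The obstacle in the calculus is that differentiability is required point by point, with no
  continuity of the derivative built in. That continuity is obtained first, and compactness then
  turns it into Taylor bounds uniform along a disc, to which Cauchy's estimate can be applied
  again.\<close>

lemma cdifferentiable_const: "cdifferentiable m (\<lambda>z. c) p"
  unfolding cdifferentiable_def
  by (intro exI[of _ "\<lambda>_. 0"]) (auto intro!: exI[of _ 1] sum_nonneg mult_nonneg_nonneg)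

lemma cdifferentiable_proj:
  assumes "i < m" shows "cdifferentiable m (\<lambda>z. z i) p"
proof -
  have "(\<Sum>j<m. (if j = i then 1 else 0) * (z j - p j)) = z i - p i" for z
    using assms by (subst sum.cong[OF refl, of _ _ "\<lambda>j. if j = i then z j - p j else 0"]) auto
  then show ?thesis unfolding cdifferentiable_def
    by (intro exI[of _ "\<lambda>j. if j = i then 1 else 0"])
      (auto intro!: exI[of _ 1] sum_nonneg mult_nonneg_nonneg)
qed

text \<open>The linear part is bounded by the sum of the \<open>cmod (d i)\<close>, the error by the
  definition with \<open>e = 1\<close>.\<close>

lemma cdifferentiable_lipschitz:
  assumes "cdifferentiable m F p"
  shows "\<exists>K\<ge>0. \<exists>r>0. \<forall>z. (\<forall>i<m. cmod (z i - p i) < r) \<longrightarrow>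
           cmod (F z - F p) \<le> K * (\<Sum>i<m. cmod (z i - p i))"
proof -
  obtain d r where r: "r > 0" and d: "\<And>z. (\<forall>i<m. cmod (z i - p i) < r) \<Longrightarrow>
        cmod (F z - F p - (\<Sum>i<m. d i * (z i - p i))) \<le> 1 * (\<Sum>i<m. cmod (z i - p i))"
    using assms unfolding cdifferentiable_def by (meson zero_less_one)
  define K where "K = (\<Sum>i<m. cmod (d i))"
  have K: "K \<ge> 0" unfolding K_def by (simp add: sum_nonneg)
  have "cmod (F z - F p) \<le> (K + 1) * (\<Sum>i<m. cmod (z i - p i))"
    if z: "\<forall>i<m. cmod (z i - p i) < r" for z
  proof -
    let ?S = "\<Sum>i<m. cmod (z i - p i)"
    have "cmod (\<Sum>i<m. d i * (z i - p i)) \<le> (\<Sum>i<m. cmod (d i) * ?S)"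
      by (rule sum_norm_le) (auto simp: norm_mult intro!: mult_left_mono member_le_sum)
    also have "\<dots> = K * ?S" by (simp add: K_def sum_distrib_right)
    finally have "cmod (F z - F p) \<le> K * ?S + ?S"
      using d[OF z] norm_triangle_sub[of "F z - F p" "\<Sum>i<m. d i * (z i - p i)"] by simp
    then show ?thesis by (simp add: algebra_simps)
  qed
  then show ?thesis using K r by (intro exI[of _ "K + 1"]) auto
qed

text \<open>The Lipschitz estimate at distance 0: entries from index \<open>m\<close> on do not
  influence \<open>F\<close> where it is differentiable. This is what allows lists of coordinates to
  be extended or altered beyond \<open>m\<close>.\<close>

lemma cdifferentiable_cong:
  assumes "cdifferentiable m F p" "\<And>i. i < m \<Longrightarrow> z i = p i"
  shows "F z = F p"
proof -
  obtain K r where "r > 0"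
    "\<And>z. (\<forall>i<m. cmod (z i - p i) < r) \<Longrightarrow> cmod (F z - F p) \<le> K * (\<Sum>i<m. cmod (z i - p i))"
    using cdifferentiable_lipschitz[OF assms(1)] by blast
  from this(2)[of z] this(1) assms(2) show ?thesis by simp
qed

lemma cdifferentiable_continuous:
  assumes "cdifferentiable m F p" "e > 0"
  shows "\<exists>r>0. \<forall>z. (\<forall>i<m. cmod (z i - p i) < r) \<longrightarrow> cmod (F z - F p) < e"
proof -
  obtain K r where K: "K \<ge> 0" "r > 0" and le: "\<And>z. (\<forall>i<m. cmod (z i - p i) < r) \<Longrightarrow>
           cmod (F z - F p) \<le> K * (\<Sum>i<m. cmod (z i - p i))"
    using cdifferentiable_lipschitz[OF assms(1)] by blast
  \<comment> \<open>The summand 1 keeps the denominator positive when \<open>K\<close> or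
    \<open>m\<close> is 0 and makes the final inequality strict.\<close>
  define r' where "r' = min r (e / (K * real m + 1))"
  have pos: "K * real m + 1 > 0" using K by (simp add: add_nonneg_pos)
  have "cmod (F z - F p) < e" if z: "\<forall>i<m. cmod (z i - p i) < r'" for z
  proof -
    have "(\<Sum>i<m. cmod (z i - p i)) \<le> (\<Sum>i<m. r')"
      by (rule sum_mono) (use z in \<open>auto simp: less_imp_le\<close>)
    then have "K * (\<Sum>i<m. cmod (z i - p i)) \<le> K * (real m * r')"
      using K by (intro mult_left_mono) auto
    also have "\<dots> \<le> (K * real m) * (e / (K * real m + 1))"
      unfolding r'_def mult.assoc[symmetric] using K by (intro mult_left_mono) auto
    also have "\<dots> < e" using pos assms(2) by (simp add: field_simps)
    finally show ?thesis using le[of z] z by (fastforce simp: r'_def)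
  qed
  moreover have "r' > 0" using K pos assms(2) by (simp add: r'_def)
  ultimately show ?thesis by blast
qed

text \<open>Finitely many radii have a positive minimum, and monotonicity in the radius lets it
  serve all indices.\<close>

lemma finite_radius:
  fixes P :: "nat \<Rightarrow> real \<Rightarrow> bool"
  assumes "\<And>i. i < m \<Longrightarrow> \<exists>r>0. P i r" "\<And>i r r'. P i r \<Longrightarrow> 0 < r' \<Longrightarrow> r' \<le> r \<Longrightarrow> P i r'"
  shows "\<exists>r>0. \<forall>i<m. P i r"
  using assms(1)
proof (induction m)
  case (Suc m)
  obtain r where "r > 0" "\<forall>i<m. P i r" using Suc by auto
  moreover obtain r' where "r' > 0" "P m r'" using Suc by auto
  moreover have "P i (min r r')" if "i < Suc m" for i
  proof (cases "i = m")
    case True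
    then show ?thesis using calculation assms(2)[of m r' "min r r'"] by simp
  next
    case False
    then show ?thesis using calculation that assms(2)[of i r "min r r'"] by simp
  qed
  ultimately show ?case by (intro exI[of _ "min r r'"]) simp
qed (auto intro: exI[of _ 1])

text \<open>Chain rule. The error splits into the error of \<open>F\<close> at the inner increments
  and the image under \<open>d\<close> of the errors of the \<open>G i\<close>.\<close>

lemma cdifferentiable_compose:
  assumes F: "cdifferentiable m F (\<lambda>i. G i p)"
    and G: "\<And>i. i < m \<Longrightarrow> cdifferentiable n (G i) p"
  shows "cdifferentiable n (\<lambda>z. F (\<lambda>i. G i z)) p"
proof -
  define S where "S z = (\<Sum>j<n. cmod (z j - p j))" for z
  have S0: "S z \<ge> 0" for z unfolding S_def by (simp add: sum_nonneg)
  obtain d where d: "\<And>e. e > 0 \<Longrightarrow> \<exists>r>0. \<forall>z. (\<forall>i<m. cmod (z i - G i p) < r) \<longrightarrow>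
     cmod (F z - F (\<lambda>i. G i p) - (\<Sum>i<m. d i * (z i - G i p))) \<le> e * (\<Sum>i<m. cmod (z i - G i p))"
    using F unfolding cdifferentiable_def by blast
  have "\<forall>i. \<exists>D. i < m \<longrightarrow> (\<forall>e>0. \<exists>r>0. \<forall>z. (\<forall>j<n. cmod (z j - p j) < r) \<longrightarrow>
     cmod (G i z - G i p - (\<Sum>j<n. D j * (z j - p j))) \<le> e * S z)"
    using G unfolding cdifferentiable_def S_def by blast
  then obtain D where D: "\<And>i e. i < m \<Longrightarrow> e > 0 \<Longrightarrow> \<exists>r>0. \<forall>z. (\<forall>j<n. cmod (z j - p j) < r) \<longrightarrow>
     cmod (G i z - G i p - (\<Sum>j<n. D i j * (z j - p j))) \<le> e * S z"
    unfolding choice_iff by blast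
  have "\<forall>i. \<exists>K. i < m \<longrightarrow> K \<ge> 0 \<and> (\<exists>r>0. \<forall>z. (\<forall>j<n. cmod (z j - p j) < r) \<longrightarrow>
           cmod (G i z - G i p) \<le> K * S z)"
    using cdifferentiable_lipschitz[OF G] unfolding S_def by blast
  then obtain K where K0: "\<And>i. i < m \<Longrightarrow> K i \<ge> 0"
    and K: "\<And>i. i < m \<Longrightarrow> \<exists>r>0. \<forall>z. (\<forall>j<n. cmod (z j - p j) < r) \<longrightarrow>
           cmod (G i z - G i p) \<le> K i * S z"
    unfolding choice_iff by blast
  define C where "C = (\<Sum>i<m. K i)"
  define A where "A = (\<Sum>i<m. cmod (d i))"
  have C0: "C \<ge> 0" and A0: "A \<ge> 0" unfolding C_def A_def by (auto intro: sum_nonneg K0)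
  have "\<exists>r>0. \<forall>z. (\<forall>j<n. cmod (z j - p j) < r) \<longrightarrow>
     cmod (F (\<lambda>i. G i z) - F (\<lambda>i. G i p) - (\<Sum>j<n. (\<Sum>i<m. d i * D i j) * (z j - p j))) \<le> e * S z"
    if e: "e > 0" for e
  proof -
    \<comment> \<open>Each half of the error is kept below \<open>e / 2\<close>: \<open>C\<close>
      bounds the growth of the inner functions, \<open>A\<close> the size of the outer derivative.
      The summands 1 guard against \<open>C = 0\<close> and \<open>A = 0\<close>.\<close>
    define e1 where "e1 = e / (2 * (C + 1))"
    define e2 where "e2 = e / (2 * (A + 1))"
    have e12: "e1 > 0" "e2 > 0" using e C0 A0 by (auto simp: e1_def e2_def)
    obtain r1 where r1: "r1 > 0" and F1: "\<And>z. (\<forall>i<m. cmod (z i - G i p) < r1) \<Longrightarrow>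
     cmod (F z - F (\<lambda>i. G i p) - (\<Sum>i<m. d i * (z i - G i p))) \<le> e1 * (\<Sum>i<m. cmod (z i - G i p))"
      using d[OF e12(1)] by blast
    have "\<exists>r>0. \<forall>i<m. \<forall>z. (\<forall>j<n. cmod (z j - p j) < r) \<longrightarrow>
       cmod (G i z - G i p - (\<Sum>j<n. D i j * (z j - p j))) \<le> e2 * S z"
      by (rule finite_radius) (use D e12 in \<open>blast intro: less_le_trans\<close>)+
    then obtain r2 where r2: "r2 > 0" and G2: "\<And>i z. i < m \<Longrightarrow> (\<forall>j<n. cmod (z j - p j) < r2) \<Longrightarrow>
       cmod (G i z - G i p - (\<Sum>j<n. D i j * (z j - p j))) \<le> e2 * S z" by blast
    have "\<exists>r>0. \<forall>i<m. \<forall>z. (\<forall>j<n. cmod (z j - p j) < r) \<longrightarrow> cmod (G i z - G i p) \<le> K i * S z"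
      by (rule finite_radius) (use K in \<open>blast intro: less_le_trans\<close>)+
    then obtain r3 where r3: "r3 > 0" and G3: "\<And>i z. i < m \<Longrightarrow> (\<forall>j<n. cmod (z j - p j) < r3) \<Longrightarrow>
       cmod (G i z - G i p) \<le> K i * S z" by blast
    have "\<exists>r>0. \<forall>i<m. \<forall>z. (\<forall>j<n. cmod (z j - p j) < r) \<longrightarrow> cmod (G i z - G i p) < r1"
      by (rule finite_radius) (fact cdifferentiable_continuous[OF G r1], meson less_le_trans)
    then obtain r4 where r4: "r4 > 0" and G4: "\<And>i z. i < m \<Longrightarrow> (\<forall>j<n. cmod (z j - p j) < r4) \<Longrightarrow>
       cmod (G i z - G i p) < r1" by blast
    have "cmod (F (\<lambda>i. G i z) - F (\<lambda>i. G i p) - (\<Sum>j<n. (\<Sum>i<m. d i * D i j) * (z j - p j))) \<le> e * S z"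
      if z: "\<forall>j<n. cmod (z j - p j) < min (min r2 r3) r4" for z
    proof -
      have z': "\<forall>j<n. cmod (z j - p j) < r2" "\<forall>j<n. cmod (z j - p j) < r3" "\<forall>j<n. cmod (z j - p j) < r4"
        using z by auto
      let ?X = "F (\<lambda>i. G i z) - F (\<lambda>i. G i p) - (\<Sum>i<m. d i * (G i z - G i p))"
      let ?Y = "\<Sum>i<m. d i * (G i z - G i p - (\<Sum>j<n. D i j * (z j - p j)))"
      have "cmod ?X \<le> e1 * (\<Sum>i<m. cmod (G i z - G i p))"
        by (rule F1) (use G4 z' in blast)
      also have "\<dots> \<le> e1 * (\<Sum>i<m. K i * S z)"
        using e12 G3 z' by (intro mult_left_mono sum_mono) auto
      also have "\<dots> = e1 * C * S z"
        unfolding C_def sum_distrib_right[symmetric] by (simp only: mult.assoc)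
      also have "\<dots> = e / 2 * (C / (C + 1)) * S z"
        using C0 by (simp add: e1_def)
      also have "\<dots> \<le> e / 2 * 1 * S z"
        using e C0 S0 by (intro mult_right_mono mult_left_mono) auto
      finally have X: "cmod ?X \<le> e / 2 * S z" by simp
      have "cmod ?Y \<le> (\<Sum>i<m. cmod (d i) * (e2 * S z))"
        by (rule sum_norm_le) (use G2 z' in \<open>auto simp: norm_mult intro!: mult_left_mono\<close>)
      also have "\<dots> = A * e2 * S z"
        unfolding A_def sum_distrib_right[symmetric] by (simp only: mult.assoc)
      also have "\<dots> = e / 2 * (A / (A + 1)) * S z"
        using A0 by (simp add: e2_def)
      also have "\<dots> \<le> e / 2 * 1 * S z"
        using e A0 S0 by (intro mult_right_mono mult_left_mono) auto
      finally have Y: "cmod ?Y \<le> e / 2 * S z" by simp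
      have "(\<Sum>j<n. (\<Sum>i<m. d i * D i j) * (z j - p j)) = (\<Sum>i<m. d i * (\<Sum>j<n. D i j * (z j - p j)))"
        unfolding sum_distrib_left sum_distrib_right mult.assoc by (rule sum.swap)
      then have eq: "F (\<lambda>i. G i z) - F (\<lambda>i. G i p) - (\<Sum>j<n. (\<Sum>i<m. d i * D i j) * (z j - p j)) = ?X + ?Y"
        by (simp only: right_diff_distrib sum_subtractf) simp
      show ?thesis unfolding eq using X Y norm_triangle_ineq[of ?X ?Y] by linarith
    qed
    then show ?thesis using r2 r3 r4 by (intro exI[of _ "min (min r2 r3) r4"]) auto
  qed
  then show ?thesis unfolding cdifferentiable_def S_def
    by (intro exI[of _ "\<lambda>j. \<Sum>i<m. d i * D i j"]) simp
qed

lemma cdifferentiable_add: "cdifferentiable 2 (\<lambda>z. z 0 + z 1) p"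
  unfolding cdifferentiable_def
  by (intro exI[of _ "\<lambda>_. 1"])
    (auto simp: numeral_2_eq_2 intro!: exI[of _ 1])

text \<open>The remainder is exactly the product of the two increments, so the radius
  \<open>e\<close> already gives the bound with constant \<open>e\<close>.\<close>

lemma cdifferentiable_mult: "cdifferentiable 2 (\<lambda>z. z 0 * z 1) p"
proof -
  have "cmod (z 0 * z 1 - p 0 * p 1 - (\<Sum>i<2. (if i = 0 then p 1 else p 0) * (z i - p i)))
        \<le> e * (\<Sum>i<2. cmod (z i - p i))"
    if e: "e > 0" and z: "\<forall>i<2. cmod (z i - p i) < e" for e and z :: "nat \<Rightarrow> complex"
  proof -
    have "z 0 * z 1 - p 0 * p 1 - (\<Sum>i<2. (if i = 0 then p 1 else p 0) * (z i - p i))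
        = (z 0 - p 0) * (z 1 - p 1)"
      by (simp add: numeral_2_eq_2 algebra_simps)
    moreover have "cmod ((z 0 - p 0) * (z 1 - p 1)) \<le> e * cmod (z 1 - p 1)"
      using z[rule_format, of 0] unfolding norm_mult by (intro mult_right_mono) auto
    moreover have "e * cmod (z 1 - p 1) \<le> e * (\<Sum>i<2. cmod (z i - p i))"
      using e by (simp add: numeral_2_eq_2)
    ultimately show ?thesis by simp
  qed
  then show ?thesis unfolding cdifferentiable_def
    by (intro exI[of _ "\<lambda>i. if i = 0 then p 1 else p 0"]) blast
qed

lemma cdifferentiable_one_variable:
  assumes "f field_differentiable at (p 0)"
  shows "cdifferentiable 1 (\<lambda>z. f (z 0)) p"
proof -
  obtain D where "(f has_field_derivative D) (at (p 0))"
    using assms by (auto simp: field_differentiable_def)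
  then have "\<forall>e>0. \<exists>d>0. \<forall>y. norm (y - p 0) < d \<longrightarrow>
      norm (f y - f (p 0) - D * (y - p 0)) \<le> e * norm (y - p 0)"
    unfolding has_field_derivative_def has_derivative_at_alt by blast
  then show ?thesis unfolding cdifferentiable_def
    by (intro exI[of _ "\<lambda>_. D"]) fastforce
qed

section \<open>Sheaves of holomorphic functions\<close>

text \<open>In \<open>hol_local\<close> the set \<open>W'\<close> need not be contained in \<open>W\<close>, so that this one axiom covers
  restriction, gluing and the irrelevance of values outside \<open>W\<close>.\<close>

locale function_sheaf =
  fixes X :: "'a cspace"
  assumes hol_open: "f \<in> hol X W \<Longrightarrow> openin (ctop X) W"
    and hol_continuous: "f \<in> hol X W \<Longrightarrow> open B \<Longrightarrow> openin (ctop X) {x \<in> W. f x \<in> B}"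
    and hol_local: "openin (ctop X) W \<Longrightarrow>
      (\<And>x. x \<in> W \<Longrightarrow> \<exists>W' g. openin (ctop X) W' \<and> x \<in> W' \<and> g \<in> hol X W' \<and> (\<forall>y\<in>W' \<inter> W. f y = g y)) \<Longrightarrow>
      f \<in> hol X W"
    and hol_compose: "openin (ctop X) W \<Longrightarrow> (\<And>i. i < m \<Longrightarrow> g i \<in> hol X W) \<Longrightarrow>
      (\<And>x. x \<in> W \<Longrightarrow> \<exists>r>0. \<forall>z. (\<forall>i<m. cmod (z i - g i x) < r) \<longrightarrow> cdifferentiable m F z) \<Longrightarrow>
      (\<lambda>x. F (\<lambda>i. g i x)) \<in> hol X W"
begin

lemma hol_restrict:
  assumes "f \<in> hol X W" "openin (ctop X) W'" "W' \<subseteq> W"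
  shows "f \<in> hol X W'"
  by (rule hol_local[OF assms(2)]) (use assms hol_open in blast)

lemma hol_cong:
  assumes "f \<in> hol X W" "\<And>x. x \<in> W \<Longrightarrow> f x = g x"
  shows "g \<in> hol X W"
  by (rule hol_local[OF hol_open[OF assms(1)]]) (use assms hol_open[OF assms(1)] in fastforce)

lemma hol_const:
  assumes "openin (ctop X) W" shows "(\<lambda>x. c) \<in> hol X W"
  \<comment> \<open>A constant is a function of no variables; \<open>undefined\<close> fills the
    empty list of components.\<close>
  by (rule hol_compose[OF assms, of 0 undefined "\<lambda>_. c"]) (auto simp: cdifferentiable_const gt_ex)

lemma hol_add:
  assumes "f \<in> hol X W" "g \<in> hol X W" shows "(\<lambda>x. f x + g x) \<in> hol X W"
  using hol_compose[OF hol_open[OF assms(1)], of 2 "\<lambda>i. if i = 0 then f else g" "\<lambda>z. z 0 + z 1"] assms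
  by (simp add: cdifferentiable_add[simplified] gt_ex)

lemma hol_mult:
  assumes "f \<in> hol X W" "g \<in> hol X W" shows "(\<lambda>x. f x * g x) \<in> hol X W"
  using hol_compose[OF hol_open[OF assms(1)], of 2 "\<lambda>i. if i = 0 then f else g" "\<lambda>z. z 0 * z 1"] assms
  by (simp add: cdifferentiable_mult[simplified] gt_ex)

lemma hol_sum:
  assumes "openin (ctop X) W" "\<And>i. i \<in> A \<Longrightarrow> f i \<in> hol X W"
  shows "(\<lambda>x. \<Sum>i\<in>A. f i x) \<in> hol X W"
  using assms(2)
  by (induction A rule: infinite_finite_induct) (auto intro: hol_const hol_add assms(1))

lemma hol_comp_holomorphic:
  assumes f: "f \<in> hol X W" and h: "h holomorphic_on D" "open D" "\<And>x. x \<in> W \<Longrightarrow> f x \<in> D"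
  shows "(\<lambda>x. h (f x)) \<in> hol X W"
proof -
  have "\<exists>r>0. \<forall>z. (\<forall>i<1. cmod (z i - f x) < r) \<longrightarrow> cdifferentiable 1 (\<lambda>z. h (z 0)) z"
    if x: "x \<in> W" for x
  proof -
    obtain r where r: "r > 0" "ball (f x) r \<subseteq> D"
      using h(2,3) x by (meson open_contains_ball)
    have "cdifferentiable 1 (\<lambda>z. h (z 0)) z" if "cmod (z 0 - f x) < r" for z
    proof (rule cdifferentiable_one_variable)
      have "z 0 \<in> D" using that r by (auto simp: dist_norm norm_minus_commute)
      then show "h field_differentiable at (z 0)"
        using h(1,2) holomorphic_on_imp_differentiable_at by blast
    qed
    then show ?thesis using r by auto
  qed
  then show ?thesis
    using hol_compose[OF hol_open[OF f], of 1 "\<lambda>_. f" "\<lambda>z. h (z 0)"] f by simp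
qed

end

text \<open>Local sections and branches of logarithms exist only on open subsets. Carrying the
  subset \<open>W\<close> along avoids the formation of open subspaces.\<close>

definition holomorphic_map_on :: "'a cspace \<Rightarrow> 'a set \<Rightarrow> 'b cspace \<Rightarrow> ('a \<Rightarrow> 'b) \<Rightarrow> bool" where
  "holomorphic_map_on X W Y f \<longleftrightarrow> openin (ctop X) W \<and> f ` W \<subseteq> points Y \<and>
     (\<forall>U. openin (ctop Y) U \<longrightarrow> openin (ctop X) {x \<in> W. f x \<in> U} \<and>
        (\<forall>g\<in>hol Y U. g \<circ> f \<in> hol X {x \<in> W. f x \<in> U}))"

lemma holomorphic_map_iff: "holomorphic_map X Y f \<longleftrightarrow> holomorphic_map_on X (points X) Y f"
  unfolding holomorphic_map_def holomorphic_map_on_def continuous_map_def by auto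

lemma holomorphic_map_on_openD: "holomorphic_map_on X W Y f \<Longrightarrow> openin (ctop X) W"
  unfolding holomorphic_map_on_def by blast

lemma holomorphic_map_on_pointsD: "holomorphic_map_on X W Y f \<Longrightarrow> x \<in> W \<Longrightarrow> f x \<in> points Y"
  unfolding holomorphic_map_on_def by blast

lemma holomorphic_map_on_preimage:
  "holomorphic_map_on X W Y f \<Longrightarrow> openin (ctop Y) U \<Longrightarrow> openin (ctop X) {x \<in> W. f x \<in> U}"
  unfolding holomorphic_map_on_def by blast

lemma holomorphic_map_on_pullback:
  "holomorphic_map_on X W Y f \<Longrightarrow> openin (ctop Y) U \<Longrightarrow> g \<in> hol Y U \<Longrightarrow> (\<lambda>x. g (f x)) \<in> hol X {x \<in> W. f x \<in> U}"
  unfolding holomorphic_map_on_def comp_def by blast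

lemma holomorphic_map_on_compose:
  assumes f: "holomorphic_map_on X W Y f" and g: "holomorphic_map_on Y W' Z g" and sub: "f ` W \<subseteq> W'"
  shows "holomorphic_map_on X W Z (\<lambda>x. g (f x))"
proof -
  have eq: "{x \<in> W. g (f x) \<in> U} = {x \<in> W. f x \<in> {y \<in> W'. g y \<in> U}}" for U
    using sub by auto
  show ?thesis
    unfolding holomorphic_map_on_def eq
    using holomorphic_map_on_openD[OF f] holomorphic_map_on_pointsD[OF g] sub
      holomorphic_map_on_preimage[OF f holomorphic_map_on_preimage[OF g]]
      holomorphic_map_on_pullback[OF f holomorphic_map_on_preimage[OF g] holomorphic_map_on_pullback[OF g]]
    by (auto simp: comp_def)
qed

text \<open>Preimages and pullbacks are glued from those of the local models \<open>g\<close>. The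
  sets \<open>W'\<close> may stick out of \<open>W\<close>, so restriction and congruence become
  special cases.\<close>

lemma (in function_sheaf) holomorphic_map_on_local:
  assumes W: "openin (ctop X) W"
    and loc: "\<And>x. x \<in> W \<Longrightarrow> \<exists>W' g. x \<in> W' \<and> holomorphic_map_on X W' Y g \<and> (\<forall>y\<in>W' \<inter> W. f y = g y)"
  shows "holomorphic_map_on X W Y f"
proof -
  have op: "openin (ctop X) {x \<in> W. f x \<in> U}" if U: "openin (ctop Y) U" for U
  proof (subst openin_subopen, intro ballI)
    fix x assume x: "x \<in> {x \<in> W. f x \<in> U}"
    obtain W' g where g: "x \<in> W'" "holomorphic_map_on X W' Y g" "\<forall>y\<in>W' \<inter> W. f y = g y"
      using loc x by blast
    have "openin (ctop X) (W \<inter> {x \<in> W'. g x \<in> U})"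
      using holomorphic_map_on_preimage[OF g(2) U] W by blast
    then show "\<exists>T. openin (ctop X) T \<and> x \<in> T \<and> T \<subseteq> {x \<in> W. f x \<in> U}"
      using g x by (intro exI[of _ "W \<inter> {x \<in> W'. g x \<in> U}"]) auto
  qed
  have "(\<lambda>x. h (f x)) \<in> hol X {x \<in> W. f x \<in> U}" if U: "openin (ctop Y) U" and h: "h \<in> hol Y U" for U h
  proof (rule hol_local[OF op[OF U]])
    fix x assume x: "x \<in> {x \<in> W. f x \<in> U}"
    obtain W' g where g: "x \<in> W'" "holomorphic_map_on X W' Y g" "\<forall>y\<in>W' \<inter> W. f y = g y"
      using loc x by blast
    show "\<exists>V k. openin (ctop X) V \<and> x \<in> V \<and> k \<in> hol X V \<and> (\<forall>y\<in>V \<inter> {x \<in> W. f x \<in> U}. h (f y) = k y)"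
      using holomorphic_map_on_preimage[OF g(2) U] holomorphic_map_on_pullback[OF g(2) U h] g x
      by (intro exI[of _ "{x \<in> W'. g x \<in> U}"] exI[of _ "\<lambda>x. h (g x)"]) auto
  qed
  moreover have "f ` W \<subseteq> points Y"
    using loc holomorphic_map_on_pointsD by fastforce
  ultimately show ?thesis using W op unfolding holomorphic_map_on_def comp_def by blast
qed

lemma (in function_sheaf) holomorphic_map_on_restrict:
  assumes "holomorphic_map_on X W Y f" "openin (ctop X) W'" "W' \<subseteq> W"
  shows "holomorphic_map_on X W' Y f"
  by (rule holomorphic_map_on_local[OF assms(2)]) (use assms in blast)

lemma (in function_sheaf) holomorphic_map_on_cong:
  assumes "holomorphic_map_on X W Y f" "\<And>x. x \<in> W \<Longrightarrow> g x = f x"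
  shows "holomorphic_map_on X W Y g"
  by (rule holomorphic_map_on_local[OF holomorphic_map_on_openD[OF assms(1)]]) (use assms in blast)

section \<open>Generated spaces\<close>

text \<open>The half of the condition in \<open>generated_space\<close> that does not mention the
  section. Separated from \<open>F\<close>, one chart can be shared by several sections.\<close>

definition local_coordinates ::
    "'a topology \<Rightarrow> ('a set \<Rightarrow> ('a \<Rightarrow> complex) set) \<Rightarrow> 'a \<Rightarrow> 'a set \<Rightarrow> nat \<Rightarrow> (nat \<Rightarrow> 'a \<Rightarrow> complex) \<Rightarrow> real \<Rightarrow> bool" where
  "local_coordinates T G x U m g r \<longleftrightarrow> openin T U \<and> x \<in> U \<and> 0 < r \<and> (\<forall>i<m. g i \<in> G U) \<and>
     (\<forall>y\<in>U. \<forall>i<m. cmod (g i y - g i x) < r)"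

definition holomorphic_in ::
    "'a \<Rightarrow> 'a set \<Rightarrow> nat \<Rightarrow> (nat \<Rightarrow> 'a \<Rightarrow> complex) \<Rightarrow> real \<Rightarrow> ((nat \<Rightarrow> complex) \<Rightarrow> complex) \<Rightarrow> ('a \<Rightarrow> complex) \<Rightarrow> bool" where
  "holomorphic_in x U m g r F f \<longleftrightarrow>
     (\<forall>z. (\<forall>i<m. cmod (z i - g i x) < r) \<longrightarrow> cdifferentiable m F z) \<and> (\<forall>y\<in>U. f y = F (\<lambda>i. g i y))"

lemma generated_space_simps [simp]:
  "ctop (generated_space T G) = T"
  by (simp add: generated_space_def)

lemma hol_generated_space:
  "f \<in> hol (generated_space T G) W \<longleftrightarrow> openin T W \<and>
     (\<forall>x\<in>W. \<exists>U m g r F. U \<subseteq> W \<and> local_coordinates T G x U m g r \<and> holomorphic_in x U m g r F f)"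
  unfolding generated_space_def local_coordinates_def holomorphic_in_def cspace.simps mem_Collect_eq
  by (rule conj_cong[OF refl], rule ball_cong[OF refl], (rule ex_cong1)+) (rule iffI; elim conjE; intro conjI; assumption)

text \<open>The two properties of a generating family that make the generated space a function
  sheaf. The family may vary with the open set, as it does for products.\<close>

locale generators =
  fixes T :: "'a topology" and G :: "'a set \<Rightarrow> ('a \<Rightarrow> complex) set"
  assumes continuous: "openin T U \<Longrightarrow> g \<in> G U \<Longrightarrow> open B \<Longrightarrow> openin T {x \<in> U. g x \<in> B}"
    and mono: "openin T U \<Longrightarrow> openin T U' \<Longrightarrow> U' \<subseteq> U \<Longrightarrow> g \<in> G U \<Longrightarrow> g \<in> G U'"
begin

text \<open>The smaller chart is cut out by keeping the generators within \<open>r'\<close> of their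
  values at \<open>x\<close>; every section written in the old chart keeps its
  \<open>F\<close>.\<close>

lemma shrink:
  assumes c: "local_coordinates T G x U m g r" and r': "0 < r'" "r' \<le> r" and V: "openin T V" "x \<in> V"
  shows "\<exists>U'\<subseteq>U \<inter> V. local_coordinates T G x U' m g r' \<and>
     (\<forall>F f. holomorphic_in x U m g r F f \<longrightarrow> holomorphic_in x U' m g r' F f)"
proof -
  define U' where "U' = (\<Inter>i\<in>{..<m}. {y \<in> U. g i y \<in> ball (g i x) r'}) \<inter> (U \<inter> V)"
  have op: "openin T (U \<inter> V)" using c V by (auto simp: local_coordinates_def)
  have "openin T {y \<in> U. g i y \<in> ball (g i x) r'}" if "i < m" for i
    using c that by (intro continuous) (auto simp: local_coordinates_def)
  then have "openin T U'"
    unfolding U'_def using op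
    \<comment> \<open>For \<open>m = 0\<close> the intersection over the empty index set is the
      whole type, and openness comes from \<open>U \<inter> V\<close> alone.\<close>
    by (cases "m = 0") (auto intro!: openin_Int openin_INT2 simp del: openin_Int_Inter)
  moreover have sub: "U' \<subseteq> U \<inter> V" by (auto simp: U'_def)
  moreover have "cmod (g i y - g i x) < r'" if "y \<in> U'" "i < m" for i y
    using that by (auto simp: U'_def dist_norm norm_minus_commute)
  moreover have "x \<in> U'" using c r' V by (auto simp: U'_def local_coordinates_def)
  moreover have "g i \<in> G U'" if "i < m" for i
    using c that mono[of U U' "g i"] calculation by (auto simp: local_coordinates_def)
  moreover have "holomorphic_in x U' m g r' F f" if "holomorphic_in x U m g r F f" for F f
  proof -
    have "(\<forall>i<m. cmod (z i - g i x) < r') \<Longrightarrow> (\<forall>i<m. cmod (z i - g i x) < r)" for z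
      using r' by (meson less_le_trans)
    then show ?thesis using that sub unfolding holomorphic_in_def by blast
  qed
  ultimately show ?thesis using r' unfolding local_coordinates_def
    by (intro exI[of _ U']) auto
qed

text \<open>Sections near \<open>x\<close> come with unrelated charts. Concatenating the lists of
  generators and shrinking to a common radius yields a chart in which all of them are functions of
  the coordinates.\<close>

lemma joint_coordinates:
  fixes k :: nat
  assumes "\<And>i. i < k \<Longrightarrow> \<exists>U m g r F. local_coordinates T G x U m g r \<and> holomorphic_in x U m g r F (f i)"
    and "x \<in> topspace T"
  shows "\<exists>U m g r. local_coordinates T G x U m g r \<and> (\<forall>i<k. \<exists>F. holomorphic_in x U m g r F (f i))"
  using assms(1)
proof (induction k)
  case 0
  have "local_coordinates T G x (topspace T) 0 (\<lambda>_. undefined) 1"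
    using assms(2) by (auto simp: local_coordinates_def)
  then show ?case by blast
next
  case (Suc k)
  obtain U m g r where c: "local_coordinates T G x U m g r" and F: "\<And>i. i < k \<Longrightarrow> \<exists>F. holomorphic_in x U m g r F (f i)"
    using Suc by (metis less_SucI)
  obtain U' m' g' r' F' where c': "local_coordinates T G x U' m' g' r'" and F': "holomorphic_in x U' m' g' r' F' (f k)"
    using Suc.prems by blast
  define \<rho> where "\<rho> = min r r'"
  \<comment> \<open>The old coordinates come first, so the new section reads its variables with
    offset \<open>m\<close>.\<close>
  define h where "h i = (if i < m then g i else g' (i - m))" for i
  have \<rho>: "0 < \<rho>" "\<rho> \<le> r" "\<rho> \<le> r'" using c c' by (auto simp: \<rho>_def local_coordinates_def)
  have "openin T U'" "x \<in> U'" using c' by (auto simp: local_coordinates_def)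
  from shrink[OF c \<rho>(1,2) this] obtain U1 where U1: "U1 \<subseteq> U \<inter> U'" "local_coordinates T G x U1 m g \<rho>"
    and F1: "\<And>F f. holomorphic_in x U m g r F f \<Longrightarrow> holomorphic_in x U1 m g \<rho> F f" by blast
  have "openin T U1" "x \<in> U1" using U1 by (auto simp: local_coordinates_def)
  from shrink[OF c' \<rho>(1,3) this] obtain U2 where U2: "U2 \<subseteq> U' \<inter> U1" "local_coordinates T G x U2 m' g' \<rho>"
    and F2: "\<And>F f. holomorphic_in x U' m' g' r' F f \<Longrightarrow> holomorphic_in x U2 m' g' \<rho> F f" by blast
  have g2: "g i \<in> G U2" if "i < m" for i
    using U1 U2 that by (intro mono[of U1 U2 "g i"]) (auto simp: local_coordinates_def)
  have "local_coordinates T G x U2 (m + m') h \<rho>"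
    using U1 U2 g2 unfolding local_coordinates_def h_def by auto
  moreover have "\<exists>F. holomorphic_in x U2 (m + m') h \<rho> F (f i)" if i: "i < Suc k" for i
  proof (cases "i = k")
    case True
    have "cdifferentiable (m + m') (\<lambda>z. F' (\<lambda>i. z (m + i))) z"
      if z: "\<forall>i<m + m'. cmod (z i - h i x) < \<rho>" for z
    proof (rule cdifferentiable_compose[where G = "\<lambda>i z. z (m + i)" and m = m'])
      have "cmod (z (m + i) - g' i x) < \<rho>" if "i < m'" for i
        using z[rule_format, of "m + i"] that by (simp add: h_def)
      then show "cdifferentiable m' F' (\<lambda>i. z (m + i))"
        using F2[OF F'] by (auto simp: holomorphic_in_def)
    qed (auto intro: cdifferentiable_proj)
    then have "holomorphic_in x U2 (m + m') h \<rho> (\<lambda>z. F' (\<lambda>i. z (m + i))) (f k)"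
      using F2[OF F'] by (auto simp: holomorphic_in_def h_def)
    then show ?thesis using True by blast
  next
    case False
    then obtain F where "holomorphic_in x U m g r F (f i)" using F i by force
    note F = F1[OF this]
    have dF: "cdifferentiable m F z" if "\<forall>i<m. cmod (z i - h i x) < \<rho>" for z
      using F that by (auto simp: holomorphic_in_def h_def)
    \<comment> \<open>\<open>h\<close> and \<open>g\<close> agree only below \<open>m\<close>;
      differentiability of \<open>F\<close> at these values makes it blind to the other
      entries.\<close>
    have "F (\<lambda>i. h i y) = F (\<lambda>i. g i y)" if "y \<in> U2" for y
    proof -
      have "\<forall>i<m. cmod (g i y - g i x) < \<rho>" using that U1 U2 by (auto simp: local_coordinates_def)
      then have "cdifferentiable m F (\<lambda>i. g i y)" using F by (auto simp: holomorphic_in_def)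
      from cdifferentiable_cong[OF this, of "\<lambda>i. h i y"] show ?thesis by (simp add: h_def)
    qed
    moreover have "cdifferentiable (m + m') (\<lambda>z. F (\<lambda>i. z i)) z"
      if z: "\<forall>i<m + m'. cmod (z i - h i x) < \<rho>" for z
      by (rule cdifferentiable_compose[where G = "\<lambda>i z. z i" and m = m]) (use dF z in \<open>auto intro: cdifferentiable_proj\<close>)
    ultimately have "holomorphic_in x U2 (m + m') h \<rho> F (f i)"
      using F U2(1) by (auto simp: holomorphic_in_def)
    then show ?thesis by blast
  qed
  ultimately show ?case by blast
qed

text \<open>The generator is its own chart: one coordinate, with \<open>F\<close> the projection to
  it. The radius 1 is arbitrary.\<close>

lemma generator_hol:
  assumes W: "openin T W" and g: "g \<in> G W"
  shows "g \<in> hol (generated_space T G) W"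
  unfolding hol_generated_space
proof (intro conjI ballI)
  fix x assume x: "x \<in> W"
  let ?U = "{y \<in> W. g y \<in> ball (g x) 1}"
  have "openin T ?U" by (intro continuous W g) auto
  then have "local_coordinates T G x ?U 1 (\<lambda>_. g) 1"
    using x mono[OF W _ _ g, of ?U] by (auto simp: local_coordinates_def dist_norm norm_minus_commute)
  moreover have "holomorphic_in x ?U 1 (\<lambda>_. g) 1 (\<lambda>z. z 0) g"
    by (auto simp: holomorphic_in_def intro: cdifferentiable_proj)
  ultimately show "\<exists>U m g' r F. U \<subseteq> W \<and> local_coordinates T G x U m g' r \<and> holomorphic_in x U m g' r F g"
    by (intro exI conjI) auto
qed (rule W)

text \<open>Continuity and gluing come from shrinking charts. For the composition axiom the inner
  functions are put into one chart, where the substituted function is differentiable by the chain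
  rule.\<close>

lemma function_sheaf: "function_sheaf (generated_space T G)"
proof
  fix f W assume f: "f \<in> hol (generated_space T G) W"
  show "openin (ctop (generated_space T G)) W"
    using f by (simp add: hol_generated_space)
  fix B :: "complex set" assume B: "open B"
  show "openin (ctop (generated_space T G)) {x \<in> W. f x \<in> B}"
    unfolding generated_space_simps
  proof (subst openin_subopen, intro ballI)
    fix x assume x: "x \<in> {x \<in> W. f x \<in> B}"
    then obtain U m g r F where U: "U \<subseteq> W" and c: "local_coordinates T G x U m g r" and F: "holomorphic_in x U m g r F f"
      using f unfolding hol_generated_space by blast
    obtain e where e: "e > 0" "ball (f x) e \<subseteq> B" using B x by (auto simp: open_contains_ball)
    have "cdifferentiable m F (\<lambda>i. g i x)" using c F by (auto simp: local_coordinates_def holomorphic_in_def)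
    from cdifferentiable_continuous[OF this e(1)] obtain s where s: "s > 0"
      "\<And>z. (\<forall>i<m. cmod (z i - g i x) < s) \<Longrightarrow> cmod (F z - F (\<lambda>i. g i x)) < e" by blast
    have "0 < min r s" using s c by (auto simp: local_coordinates_def)
    moreover have "openin T U" "x \<in> U" using c by (auto simp: local_coordinates_def)
    ultimately obtain U' where U': "U' \<subseteq> U \<inter> U" and c': "local_coordinates T G x U' m g (min r s)"
      using shrink[OF c, of "min r s" U] by auto
    have "f y \<in> B" if y: "y \<in> U'" for y
    proof -
      have "f y = F (\<lambda>i. g i y)" "f x = F (\<lambda>i. g i x)"
        using F U' y c by (auto simp: holomorphic_in_def local_coordinates_def)
      then have "cmod (f y - f x) < e" using s(2)[of "\<lambda>i. g i y"] c' y by (auto simp: local_coordinates_def)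
      then show ?thesis using e(2) by (auto simp: dist_norm norm_minus_commute subset_iff)
    qed
    then show "\<exists>V. openin T V \<and> x \<in> V \<and> V \<subseteq> {x \<in> W. f x \<in> B}"
      using c' U U' by (intro exI[of _ U']) (auto simp: local_coordinates_def)
  qed
next
  fix W f
  assume W: "openin (ctop (generated_space T G)) W" and
    loc: "\<And>x. x \<in> W \<Longrightarrow> \<exists>W' g. openin (ctop (generated_space T G)) W' \<and> x \<in> W' \<and> g \<in> hol (generated_space T G) W' \<and> (\<forall>y\<in>W' \<inter> W. f y = g y)"
  show "f \<in> hol (generated_space T G) W"
    unfolding hol_generated_space
  proof (intro conjI ballI)
    fix x assume x: "x \<in> W"
    obtain W' h where h: "x \<in> W'" "h \<in> hol (generated_space T G) W'" "\<forall>y\<in>W' \<inter> W. f y = h y"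
      using loc[OF x] by blast
    then obtain U m g r F where U: "U \<subseteq> W'" and c: "local_coordinates T G x U m g r" and F: "holomorphic_in x U m g r F h"
      unfolding hol_generated_space by blast
    have "0 < r" using c by (auto simp: local_coordinates_def)
    then obtain U' where U': "U' \<subseteq> U \<inter> W" "local_coordinates T G x U' m g r" "holomorphic_in x U' m g r F h"
      using shrink[OF c, of r W] F W x by auto
    moreover have "holomorphic_in x U' m g r F f"
      using U' U h unfolding holomorphic_in_def by (metis IntD1 IntD2 IntI subset_iff)
    ultimately show "\<exists>U m g r F. U \<subseteq> W \<and> local_coordinates T G x U m g r \<and> holomorphic_in x U m g r F f"
      by blast
  qed (use W in simp)
next
  fix W m g F
  assume W: "openin (ctop (generated_space T G)) W" and
    g: "\<And>i. i < m \<Longrightarrow> g i \<in> hol (generated_space T G) W" and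
    F: "\<And>x. x \<in> W \<Longrightarrow> \<exists>r>0. \<forall>z. (\<forall>i<m. cmod (z i - g i x) < r) \<longrightarrow> cdifferentiable m F z"
  show "(\<lambda>x. F (\<lambda>i. g i x)) \<in> hol (generated_space T G) W"
    unfolding hol_generated_space
  proof (intro conjI ballI)
    fix x assume x: "x \<in> W"
    have "x \<in> topspace T" using W x openin_subset by fastforce
    moreover have "\<exists>U n h r F. local_coordinates T G x U n h r \<and> holomorphic_in x U n h r F (g i)" if "i < m" for i
      using g[OF that] x unfolding hol_generated_space by blast
    ultimately obtain U n h r where c: "local_coordinates T G x U n h r"
      and "\<forall>i<m. \<exists>F. holomorphic_in x U n h r F (g i)"
      using joint_coordinates[of m x g] by blast
    then obtain H where H: "\<And>i. i < m \<Longrightarrow> holomorphic_in x U n h r (H i) (g i)" by metis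
    obtain s where s: "s > 0" "\<And>z. (\<forall>i<m. cmod (z i - g i x) < s) \<Longrightarrow> cdifferentiable m F z"
      using F[OF x] by blast
    have r: "r > 0" "x \<in> U" using c by (auto simp: local_coordinates_def)
    have gx: "g i x = H i (\<lambda>i. h i x)" if "i < m" for i
      using H[OF that] r by (auto simp: holomorphic_in_def)
    have dH: "cdifferentiable n (H i) z" if "i < m" "\<forall>j<n. cmod (z j - h j x) < r" for i z
      using H[OF that(1)] that(2) by (auto simp: holomorphic_in_def)
    have "\<exists>r>0. \<forall>i<m. \<forall>z. (\<forall>j<n. cmod (z j - h j x) < r) \<longrightarrow> cmod (H i z - g i x) < s"
    proof (rule finite_radius)
      fix i assume i: "i < m"
      show "\<exists>r>0. \<forall>z. (\<forall>j<n. cmod (z j - h j x) < r) \<longrightarrow> cmod (H i z - g i x) < s"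
        unfolding gx[OF i] by (rule cdifferentiable_continuous) (use i r s dH in auto)
    qed (meson less_le_trans)
    then obtain r' where r': "r' > 0"
      "\<And>i z. i < m \<Longrightarrow> (\<forall>j<n. cmod (z j - h j x) < r') \<Longrightarrow> cmod (H i z - g i x) < s" by blast
    \<comment> \<open>Within this radius the \<open>H i\<close> are differentiable and their values
      stay where \<open>F\<close> is differentiable.\<close>
    define \<rho> where "\<rho> = min r r'"
    have \<rho>: "0 < \<rho>" "\<rho> \<le> r" "\<rho> \<le> r'" using r r' by (auto simp: \<rho>_def)
    obtain U' where U': "U' \<subseteq> U \<inter> W" "local_coordinates T G x U' n h \<rho>"
      using shrink[OF c \<rho>(1,2), of W] W x by auto
    have "cdifferentiable n (\<lambda>z. F (\<lambda>i. H i z)) z" if z: "\<forall>i<n. cmod (z i - h i x) < \<rho>" for z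
    proof (rule cdifferentiable_compose[where G = H])
      have z': "\<forall>i<n. cmod (z i - h i x) < r" "\<forall>i<n. cmod (z i - h i x) < r'" using z \<rho> by auto
      show "cdifferentiable n (H i) z" if "i < m" for i using dH that z' by blast
      show "cdifferentiable m F (\<lambda>i. H i z)" by (rule s(2)) (use r'(2) z' in auto)
    qed
    moreover have "F (\<lambda>i. g i y) = F (\<lambda>i. H i (\<lambda>j. h j y))" if "y \<in> U'" for y
    proof -
      have eq: "\<forall>i<m. H i (\<lambda>j. h j y) = g i y"
        using H that U' by (auto simp: holomorphic_in_def)
      have "\<forall>i<m. cmod (H i (\<lambda>j. h j y) - g i x) < s"
        using that U'(2) r'(2)[of _ "\<lambda>j. h j y"] \<rho> unfolding local_coordinates_def
        by (meson less_le_trans)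
      then have "cdifferentiable m F (\<lambda>i. g i y)" using s(2)[of "\<lambda>i. g i y"] eq by simp
      from cdifferentiable_cong[OF this, of "\<lambda>i. H i (\<lambda>j. h j y)"] show ?thesis by (simp add: eq)
    qed
    ultimately have "holomorphic_in x U' n h \<rho> (\<lambda>z. F (\<lambda>i. H i z)) (\<lambda>x. F (\<lambda>i. g i x))"
      by (auto simp: holomorphic_in_def)
    then show "\<exists>U m g' r F'. U \<subseteq> W \<and> local_coordinates T G x U m g' r \<and> holomorphic_in x U m g' r F' (\<lambda>x. F (\<lambda>i. g i x))"
      using U' by blast
  qed (use W in simp)
qed

end

text \<open>Finitely many strict inequalities leave a common margin. Thus around every point of an
  open polydisc a smaller polydisc still lies in the domain of \<open>F\<close>.\<close>

lemma radius_gap: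
  fixes a :: "nat \<Rightarrow> real"
  assumes "\<And>i. i < m \<Longrightarrow> a i < r"
  shows "\<exists>s>0. \<forall>i<m. a i + s \<le> r"
proof (rule finite_radius)
  fix i assume "i < m" then show "\<exists>s>0. a i + s \<le> r"
    using assms by (intro exI[of _ "r - a i"]) auto
qed auto

text \<open>A section of the target is locally \<open>F\<close> of generators, so its pullback is
  \<open>F\<close> of pulled-back generators, and the composition axiom of the source
  applies.\<close>

lemma (in function_sheaf) holomorphic_map_on_generated:
  assumes W: "openin (ctop X) W" and sub: "f ` W \<subseteq> topspace T"
    and cont: "\<And>U. openin T U \<Longrightarrow> openin (ctop X) {x \<in> W. f x \<in> U}"
    and gen: "\<And>U g. openin T U \<Longrightarrow> g \<in> G U \<Longrightarrow> (\<lambda>x. g (f x)) \<in> hol X {x \<in> W. f x \<in> U}"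
  shows "holomorphic_map_on X W (generated_space T G) f"
proof -
  have "(\<lambda>x. h (f x)) \<in> hol X {x \<in> W. f x \<in> U}"
    if U: "openin T U" and h: "h \<in> hol (generated_space T G) U" for U h
  proof (rule hol_local[OF cont[OF U]])
    fix x assume x: "x \<in> {x \<in> W. f x \<in> U}"
    then obtain U' m g r F where U': "U' \<subseteq> U" and c: "local_coordinates T G (f x) U' m g r"
      and F: "holomorphic_in (f x) U' m g r F h"
      using h unfolding hol_generated_space by blast
    let ?V = "{x \<in> W. f x \<in> U'}"
    have oU': "openin T U'" using c by (auto simp: local_coordinates_def)
    have "(\<lambda>x. F (\<lambda>i. g i (f x))) \<in> hol X ?V"
    proof (rule hol_compose[OF cont[OF oU'], of m "\<lambda>i x. g i (f x)" F])
      show "(\<lambda>x. g i (f x)) \<in> hol X ?V" if "i < m" for i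
        using c that by (intro gen oU') (auto simp: local_coordinates_def)
      fix y assume y: "y \<in> ?V"
      then have "\<And>i. i < m \<Longrightarrow> cmod (g i (f y) - g i (f x)) < r" using c by (auto simp: local_coordinates_def)
      from radius_gap[of m "\<lambda>i. cmod (g i (f y) - g i (f x))" r, OF this]
      obtain s where s: "s > 0" "\<forall>i<m. cmod (g i (f y) - g i (f x)) + s \<le> r" by blast
      have "cdifferentiable m F z" if z: "\<forall>i<m. cmod (z i - g i (f y)) < s" for z
      proof -
        have "cmod (z i - g i (f x)) < r" if "i < m" for i
          using z[rule_format, OF that] s(2)[rule_format, OF that] norm_triangle_ineq[of "z i - g i (f y)" "g i (f y) - g i (f x)"]
          by simp
        then show ?thesis using F by (auto simp: holomorphic_in_def)
      qed
      then show "\<exists>s>0. \<forall>z. (\<forall>i<m. cmod (z i - g i (f y)) < s) \<longrightarrow> cdifferentiable m F z" using s by blast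
    qed
    then show "\<exists>V k. openin (ctop X) V \<and> x \<in> V \<and> k \<in> hol X V \<and> (\<forall>y\<in>V \<inter> {x \<in> W. f x \<in> U}. h (f y) = k y)"
      using cont[OF oU'] x c F
      by (intro exI[of _ ?V] exI[of _ "\<lambda>x. F (\<lambda>i. g i (f x))"]) (auto simp: holomorphic_in_def local_coordinates_def)
  qed
  then show ?thesis using W sub cont unfolding holomorphic_map_on_def comp_def by simp
qed

section \<open>Spaces with prescribed coordinate functions\<close>

lemma topspace_weak_topology [simp]: "topspace (weak_topology X \<Phi>) = X"
  unfolding weak_topology_def by auto

lemma generators_coordinate: "generators (weak_topology X \<Phi>) (\<lambda>_. \<Phi>)"
proof
  fix U g and B :: "complex set"
  assume U: "openin (weak_topology X \<Phi>) U" and g: "g \<in> \<Phi>" and B: "open B"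
  have "openin (weak_topology X \<Phi>) {x \<in> X. g x \<in> B}"
    unfolding weak_topology_def by (rule topology_generated_by_Basis) (use g B in blast)
  then have "openin (weak_topology X \<Phi>) (U \<inter> {x \<in> X. g x \<in> B})" using U by blast
  moreover have "{x \<in> U. g x \<in> B} = U \<inter> {x \<in> X. g x \<in> B}"
    using openin_subset[OF U] by auto
  ultimately show "openin (weak_topology X \<Phi>) {x \<in> U. g x \<in> B}" by simp
qed

lemma ctop_coordinate_space [simp]: "ctop (coordinate_space X \<Phi>) = weak_topology X \<Phi>"
  by (simp add: coordinate_space_def)

lemma function_sheaf_coordinate: "function_sheaf (coordinate_space X \<Phi>)"
  unfolding coordinate_space_def by (rule generators.function_sheaf[OF generators_coordinate])

lemma coordinate_hol:
  "openin (weak_topology X \<Phi>) W \<Longrightarrow> \<phi> \<in> \<Phi> \<Longrightarrow> \<phi> \<in> hol (coordinate_space X \<Phi>) W"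
  unfolding coordinate_space_def by (rule generators.generator_hol[OF generators_coordinate])

text \<open>The target carries the coarsest topology that makes the functions in \<Phi> continuous,
  so continuity of \<open>f\<close> follows from that of its coordinates.\<close>

lemma (in function_sheaf) holomorphic_map_on_coordinate:
  assumes W: "openin (ctop X) W" and sub: "f ` W \<subseteq> Q" and hol: "\<And>\<phi>. \<phi> \<in> \<Phi> \<Longrightarrow> (\<lambda>x. \<phi> (f x)) \<in> hol X W"
  shows "holomorphic_map_on X W (coordinate_space Q \<Phi>) f"
proof -
  have WX: "W \<subseteq> points X" using W openin_subset by blast
  have "continuous_map (subtopology (ctop X) W) (weak_topology Q \<Phi>) f"
    unfolding weak_topology_def continuous_on_generated_topo_iff
  proof (intro conjI allI impI)
    fix U assume "U \<in> insert Q {{x \<in> Q. \<phi> x \<in> U} |\<phi> U. \<phi> \<in> \<Phi> \<and> open U}"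
    then consider "U = Q" | \<phi> B where "\<phi> \<in> \<Phi>" "open B" "U = {x \<in> Q. \<phi> x \<in> B}" by blast
    then have "openin (ctop X) {x \<in> W. f x \<in> U}"
    proof cases
      case 1
      then have "{x \<in> W. f x \<in> U} = W" using sub by auto
      then show ?thesis using W by simp
    next
      case 2
      then have "{x \<in> W. f x \<in> U} = {x \<in> W. \<phi> (f x) \<in> B}" using sub by auto
      then show ?thesis using hol_continuous[OF hol[OF 2(1)] 2(2)] by simp
    qed
    moreover have "f -` U \<inter> topspace (subtopology (ctop X) W) = {x \<in> W. f x \<in> U}"
      using WX by auto
    ultimately show "openin (subtopology (ctop X) W) (f -` U \<inter> topspace (subtopology (ctop X) W))"
      using W by (simp add: openin_open_subtopology)
  qed (use sub in auto)
  then have cont: "openin (ctop X) {x \<in> W. f x \<in> U}" if "openin (weak_topology Q \<Phi>) U" for U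
    using openin_continuous_map_preimage[OF _ that] W WX
    by (fastforce simp: openin_open_subtopology inf.absorb2)
  show ?thesis
    unfolding coordinate_space_def
  proof (rule holomorphic_map_on_generated[OF W])
    fix U \<phi> assume "openin (weak_topology Q \<Phi>) U" "\<phi> \<in> \<Phi>"
    then show "(\<lambda>x. \<phi> (f x)) \<in> hol X {x \<in> W. f x \<in> U}"
      using hol_restrict[OF hol cont] by blast
  qed (use sub cont in auto)
qed

section \<open>Products of spaces\<close>

lemma ctop_product_space [simp]: "ctop (product_space X Y) = prod_topology (ctop X) (ctop Y)"
  by (simp add: product_space_def)

text \<open>A generator is a section of one factor whose domain contains the projection of
  \<open>W\<close>; this inclusion persists when \<open>W\<close> shrinks.\<close>

lemma generators_product:
  assumes X: "function_sheaf X" and Y: "function_sheaf Y"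
  shows "generators (prod_topology (ctop X) (ctop Y))
     (\<lambda>W. {\<lambda>p. g (fst p) | g U. g \<in> hol X U \<and> fst ` W \<subseteq> U} \<union>
          {\<lambda>p. h (snd p) | h U. h \<in> hol Y U \<and> snd ` W \<subseteq> U})"
proof
  fix W k and B :: "complex set"
  assume W: "openin (prod_topology (ctop X) (ctop Y)) W" and B: "open B"
    and k: "k \<in> {\<lambda>p. g (fst p) | g U. g \<in> hol X U \<and> fst ` W \<subseteq> U} \<union>
          {\<lambda>p. h (snd p) | h U. h \<in> hol Y U \<and> snd ` W \<subseteq> U}"
  from k consider g U where "k = (\<lambda>p. g (fst p))" "g \<in> hol X U" "fst ` W \<subseteq> U"
    | h U where "k = (\<lambda>p. h (snd p))" "h \<in> hol Y U" "snd ` W \<subseteq> U" by auto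
  then show "openin (prod_topology (ctop X) (ctop Y)) {x \<in> W. k x \<in> B}"
  proof cases
    case 1
    have "openin (prod_topology (ctop X) (ctop Y)) {p \<in> topspace (prod_topology (ctop X) (ctop Y)). fst p \<in> {x \<in> U. g x \<in> B}}"
      using continuous_map_fst function_sheaf.hol_continuous[OF X 1(2) B] by (rule openin_continuous_map_preimage)
    moreover have "{x \<in> W. k x \<in> B} = W \<inter> {p \<in> topspace (prod_topology (ctop X) (ctop Y)). fst p \<in> {x \<in> U. g x \<in> B}}"
      using openin_subset[OF W] 1 by auto
    ultimately show ?thesis using W by (simp only: openin_Int)
  next
    case 2
    have "openin (prod_topology (ctop X) (ctop Y)) {p \<in> topspace (prod_topology (ctop X) (ctop Y)). snd p \<in> {x \<in> U. h x \<in> B}}"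
      using continuous_map_snd function_sheaf.hol_continuous[OF Y 2(2) B] by (rule openin_continuous_map_preimage)
    moreover have "{x \<in> W. k x \<in> B} = W \<inter> {p \<in> topspace (prod_topology (ctop X) (ctop Y)). snd p \<in> {x \<in> U. h x \<in> B}}"
      using openin_subset[OF W] 2 by auto
    ultimately show ?thesis using W by (simp only: openin_Int)
  qed
qed (blast intro: image_mono subset_trans)

lemma function_sheaf_product: "function_sheaf X \<Longrightarrow> function_sheaf Y \<Longrightarrow> function_sheaf (product_space X Y)"
  unfolding product_space_def by (rule generators.function_sheaf[OF generators_product])

lemma holomorphic_fst:
  assumes X: "function_sheaf X" and Y: "function_sheaf Y"
  shows "holomorphic_map_on (product_space X Y) (points X \<times> points Y) X fst"
  unfolding holomorphic_map_on_def
proof (intro conjI allI impI ballI)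
  fix U assume U: "openin (ctop X) U"
  have "{x \<in> points X \<times> points Y. fst x \<in> U} = U \<times> points Y"
    using openin_subset[OF U] by auto
  then show op: "openin (ctop (product_space X Y)) {x \<in> points X \<times> points Y. fst x \<in> U}"
    using U by (simp add: openin_prod_Times_iff)
  fix g assume "g \<in> hol X U"
  then show "g \<circ> fst \<in> hol (product_space X Y) {x \<in> points X \<times> points Y. fst x \<in> U}"
    using op unfolding product_space_def comp_def
    by (intro generators.generator_hol[OF generators_product[OF X Y]]) auto
qed (auto simp: openin_prod_Times_iff)

lemma holomorphic_snd:
  assumes X: "function_sheaf X" and Y: "function_sheaf Y"
  shows "holomorphic_map_on (product_space X Y) (points X \<times> points Y) Y snd"
  unfolding holomorphic_map_on_def
proof (intro conjI allI impI ballI)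
  fix U assume U: "openin (ctop Y) U"
  have "{x \<in> points X \<times> points Y. snd x \<in> U} = points X \<times> U"
    using openin_subset[OF U] by auto
  then show op: "openin (ctop (product_space X Y)) {x \<in> points X \<times> points Y. snd x \<in> U}"
    using U by (simp add: openin_prod_Times_iff)
  fix g assume "g \<in> hol Y U"
  then show "g \<circ> snd \<in> hol (product_space X Y) {x \<in> points X \<times> points Y. snd x \<in> U}"
    using op unfolding product_space_def comp_def
    by (intro generators.generator_hol[OF generators_product[OF X Y]]) auto
qed (auto simp: openin_prod_Times_iff)

lemma (in function_sheaf) holomorphic_map_on_Pair:
  assumes Y: "function_sheaf Y" and Z: "function_sheaf Z"
    and f: "holomorphic_map_on X W Y f" and g: "holomorphic_map_on X W Z g"
  shows "holomorphic_map_on X W (product_space Y Z) (\<lambda>x. (f x, g x))"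
  unfolding product_space_def
proof (rule holomorphic_map_on_generated)
  show W: "openin (ctop X) W" using f by (rule holomorphic_map_on_openD)
  show "(\<lambda>x. (f x, g x)) ` W \<subseteq> topspace (prod_topology (ctop Y) (ctop Z))"
    using holomorphic_map_on_pointsD[OF f] holomorphic_map_on_pointsD[OF g] by auto
  show cont: "openin (ctop X) {x \<in> W. (f x, g x) \<in> U}"
    if U: "openin (prod_topology (ctop Y) (ctop Z)) U" for U
  proof (subst openin_subopen, intro ballI)
    fix x assume x: "x \<in> {x \<in> W. (f x, g x) \<in> U}"
    then have "(f x, g x) \<in> U" by simp
    from openin_prod_topology_alt[THEN iffD1, OF U, rule_format, OF this]
    obtain A B where AB: "openin (ctop Y) A" "openin (ctop Z) B" "f x \<in> A" "g x \<in> B" "A \<times> B \<subseteq> U"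
      by blast
    have "openin (ctop X) ({x \<in> W. f x \<in> A} \<inter> {x \<in> W. g x \<in> B})"
      by (intro openin_Int holomorphic_map_on_preimage[OF f AB(1)] holomorphic_map_on_preimage[OF g AB(2)])
    then show "\<exists>T. openin (ctop X) T \<and> x \<in> T \<and> T \<subseteq> {x \<in> W. (f x, g x) \<in> U}"
      using AB x by (intro exI[of _ "{x \<in> W. f x \<in> A} \<inter> {x \<in> W. g x \<in> B}"]) auto
  qed
  fix U k
  assume U: "openin (prod_topology (ctop Y) (ctop Z)) U"
    and k: "k \<in> {\<lambda>p. g (fst p) | g U'. g \<in> hol Y U' \<and> fst ` U \<subseteq> U'} \<union>
          {\<lambda>p. h (snd p) | h U'. h \<in> hol Z U' \<and> snd ` U \<subseteq> U'}"
  from k consider h U' where "k = (\<lambda>p. h (fst p))" "h \<in> hol Y U'" "fst ` U \<subseteq> U'"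
    | h U' where "k = (\<lambda>p. h (snd p))" "h \<in> hol Z U'" "snd ` U \<subseteq> U'" by auto
  then show "(\<lambda>x. k (f x, g x)) \<in> hol X {x \<in> W. (f x, g x) \<in> U}"
  proof cases
    case 1
    have "(\<lambda>x. h (f x)) \<in> hol X {x \<in> W. f x \<in> U'}"
      by (rule holomorphic_map_on_pullback[OF f function_sheaf.hol_open[OF Y 1(2)] 1(2)])
    then show ?thesis unfolding 1(1) fst_conv by (rule hol_restrict[OF _ cont[OF U]]) (use 1(3) in force)
  next
    case 2
    have "(\<lambda>x. h (g x)) \<in> hol X {x \<in> W. g x \<in> U'}"
      by (rule holomorphic_map_on_pullback[OF g function_sheaf.hol_open[OF Z 2(2)] 2(2)])
    then show ?thesis unfolding 2(1) snd_conv by (rule hol_restrict[OF _ cont[OF U]]) (use 2(3) in force)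
  qed
qed

section \<open>Quotients of spaces\<close>

lemma openin_quotient_space:
  "openin (ctop (quotient_space X p)) U \<longleftrightarrow>
     U \<subseteq> p ` points X \<and> openin (ctop X) {x \<in> points X. p x \<in> U}"
proof -
  have "istopology (\<lambda>U. U \<subseteq> p ` points X \<and> openin (ctop X) {x \<in> points X. p x \<in> U})"
    unfolding istopology_def
  proof (intro conjI allI impI; (elim conjE)?)
    fix S T assume "openin (ctop X) {x \<in> points X. p x \<in> S}" "openin (ctop X) {x \<in> points X. p x \<in> T}"
    then have "openin (ctop X) ({x \<in> points X. p x \<in> S} \<inter> {x \<in> points X. p x \<in> T})" by (rule openin_Int)
    then show "openin (ctop X) {x \<in> points X. p x \<in> S \<inter> T}"
      by (rule back_subst[of "openin (ctop X)"]) auto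
  next
    fix K assume K: "\<forall>S\<in>K. S \<subseteq> p ` points X \<and> openin (ctop X) {x \<in> points X. p x \<in> S}"
    then have "openin (ctop X) (\<Union>S\<in>K. {x \<in> points X. p x \<in> S})" by blast
    then show "openin (ctop X) {x \<in> points X. p x \<in> \<Union>K}"
      by (rule back_subst[of "openin (ctop X)"]) auto
  qed auto
  then show ?thesis
    unfolding quotient_space_def Let_def by (simp add: topology_inverse')
qed

lemma hol_quotient_space:
  "f \<in> hol (quotient_space X p) U \<longleftrightarrow> openin (ctop (quotient_space X p)) U \<and>
     (\<lambda>x. f (p x)) \<in> hol X {x \<in> points X. p x \<in> U}"
  by (simp add: quotient_space_def Let_def comp_def)

lemma points_quotient_space [simp]: "points (quotient_space X p) = p ` points X"
proof
  have "{x \<in> points X. p x \<in> p ` points X} = points X" by auto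
  then have "openin (ctop (quotient_space X p)) (p ` points X)"
    unfolding openin_quotient_space by simp
  then show "p ` points X \<subseteq> points (quotient_space X p)" by (rule openin_subset)
  show "points (quotient_space X p) \<subseteq> p ` points X"
    using openin_quotient_space[of X p] openin_topspace by blast
qed

text \<open>Openness and holomorphy on the quotient are by definition those of the pullback along
  \<open>p\<close>, so each axiom is inherited from \<open>X\<close>.\<close>

lemma function_sheaf_quotient:
  assumes "function_sheaf X" shows "function_sheaf (quotient_space X p)"
proof -
  interpret X: function_sheaf X by fact
  show ?thesis
  proof
    fix f W assume f: "f \<in> hol (quotient_space X p) W"
    then show W: "openin (ctop (quotient_space X p)) W" by (simp add: hol_quotient_space)
    fix B :: "complex set" assume "open B"
    then show "openin (ctop (quotient_space X p)) {x \<in> W. f x \<in> B}"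
      using X.hol_continuous[of "\<lambda>x. f (p x)" "{x \<in> points X. p x \<in> W}" B] f
      unfolding hol_quotient_space openin_quotient_space by (auto simp: conj_assoc)
  next
    fix W f
    assume W: "openin (ctop (quotient_space X p)) W"
      and loc: "\<And>x. x \<in> W \<Longrightarrow> \<exists>W' g. openin (ctop (quotient_space X p)) W' \<and> x \<in> W' \<and> g \<in> hol (quotient_space X p) W' \<and> (\<forall>y\<in>W' \<inter> W. f y = g y)"
    have "(\<lambda>x. f (p x)) \<in> hol X {x \<in> points X. p x \<in> W}"
    proof (rule X.hol_local)
      show "openin (ctop X) {x \<in> points X. p x \<in> W}" using W by (simp add: openin_quotient_space)
      fix x assume x: "x \<in> {x \<in> points X. p x \<in> W}"
      then obtain W' g where "p x \<in> W'" "g \<in> hol (quotient_space X p) W'" "\<forall>y\<in>W' \<inter> W. f y = g y"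
        using loc[of "p x"] by auto
      then show "\<exists>W' g. openin (ctop X) W' \<and> x \<in> W' \<and> g \<in> hol X W' \<and> (\<forall>y\<in>W' \<inter> {x \<in> points X. p x \<in> W}. f (p y) = g y)"
        using x unfolding hol_quotient_space openin_quotient_space
        by (intro exI[of _ "{x \<in> points X. p x \<in> W'}"] exI[of _ "\<lambda>x. g (p x)"]) auto
    qed
    then show "f \<in> hol (quotient_space X p) W" using W by (simp add: hol_quotient_space)
  next
    fix W m g F
    assume W: "openin (ctop (quotient_space X p)) W"
      and g: "\<And>i. i < m \<Longrightarrow> g i \<in> hol (quotient_space X p) W"
      and F: "\<And>x. x \<in> W \<Longrightarrow> \<exists>r>0. \<forall>z. (\<forall>i<m. cmod (z i - g i x) < r) \<longrightarrow> cdifferentiable m F z"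
    have "(\<lambda>x. F (\<lambda>i. g i (p x))) \<in> hol X {x \<in> points X. p x \<in> W}"
      by (rule X.hol_compose[of _ m "\<lambda>i x. g i (p x)"])
        (use W g F in \<open>auto simp: hol_quotient_space openin_quotient_space\<close>)
    then show "(\<lambda>x. F (\<lambda>i. g i x)) \<in> hol (quotient_space X p) W"
      using W by (simp add: hol_quotient_space)
  qed
qed

lemma holomorphic_quotient_map:
  "holomorphic_map_on X (points X) (quotient_space X p) p"
  unfolding holomorphic_map_on_def comp_def by (auto simp: openin_quotient_space hol_quotient_space)

text \<open>Universal property of the quotient.\<close>

lemma holomorphic_map_on_from_quotient:
  assumes W: "openin (ctop (quotient_space X p)) W"
    and f: "holomorphic_map_on X {x \<in> points X. p x \<in> W} Y (\<lambda>x. f (p x))"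
  shows "holomorphic_map_on (quotient_space X p) W Y f"
  unfolding holomorphic_map_on_def
proof (intro conjI allI impI ballI)
  have sub: "W \<subseteq> p ` points X" using W by (simp add: openin_quotient_space)
  then show "f ` W \<subseteq> points Y" using holomorphic_map_on_pointsD[OF f] by fastforce
  fix U assume U: "openin (ctop Y) U"
  have eq: "{x \<in> points X. p x \<in> {x \<in> W. f x \<in> U}} = {x \<in> {x \<in> points X. p x \<in> W}. f (p x) \<in> U}" by auto
  show op: "openin (ctop (quotient_space X p)) {x \<in> W. f x \<in> U}"
    using holomorphic_map_on_preimage[OF f U] sub unfolding openin_quotient_space eq by auto
  fix g assume g: "g \<in> hol Y U"
  show "g \<circ> f \<in> hol (quotient_space X p) {x \<in> W. f x \<in> U}"
    using holomorphic_map_on_pullback[OF f U g] op unfolding hol_quotient_space eq by (simp add: comp_def)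
qed (rule W)

section \<open>Directional derivatives in several complex variables\<close>

definition dir_deriv :: "(complex^'k \<Rightarrow> complex) \<Rightarrow> complex^'k \<Rightarrow> complex^'k \<Rightarrow> complex" where
  "dir_deriv f t \<xi> = deriv (\<lambda>c. f (t + c *s \<xi>)) 0"

text \<open>\<open>has_derivative\<close> expresses real differentiability; complex linearity of the
  derivative is imposed by writing it with coefficients \<open>d a\<close>.\<close>

definition cdiff_at :: "(complex^'k \<Rightarrow> complex) \<Rightarrow> complex^'k \<Rightarrow> bool" where
  "cdiff_at f t \<longleftrightarrow> (\<exists>d. (f has_derivative (\<lambda>h. \<Sum>a\<in>UNIV. d a * h $ a)) (at t))"

lemma norm_vector_smult: "norm (c *s (x :: complex^'k)) = cmod c * norm x"
  by (simp add: norm_vec_def L2_set_def norm_mult power_mult_distrib real_sqrt_mult sum_distrib_left[symmetric])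

lemma bounded_linear_vector_smult: "bounded_linear (\<lambda>c. c *s (x :: complex^'k))"
proof
  show "\<exists>K. \<forall>c. norm (c *s x) \<le> norm c * K" by (auto simp: norm_vector_smult)
  show "(r *\<^sub>R c) *s x = r *\<^sub>R (c *s x)" for r c
    unfolding vec_eq_iff vector_scaleR_component vector_smult_component by simp
qed (simp add: vector_sadd_rdistrib)

lemma cdiff_at_has_derivative:
  assumes "cdiff_at f t"
  shows "(f has_derivative dir_deriv f t) (at t)"
    and "\<exists>d. dir_deriv f t = (\<lambda>h. \<Sum>a\<in>UNIV. d a * h $ a)"
    and "((\<lambda>c. f (t + c *s \<xi>)) has_field_derivative dir_deriv f t \<xi>) (at 0)"
proof -
  obtain d where d: "(f has_derivative (\<lambda>h. \<Sum>a\<in>UNIV. d a * h $ a)) (at t)"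
    using assms by (auto simp: cdiff_at_def)
  have line: "((\<lambda>c. f (t + c *s \<xi>)) has_field_derivative (\<Sum>a\<in>UNIV. d a * \<xi> $ a)) (at 0)" for \<xi>
  proof -
    have "((\<lambda>c. t + c *s \<xi>) has_derivative (\<lambda>c. 0 + c *s \<xi>)) (at 0)"
      by (intro has_derivative_add has_derivative_const bounded_linear_imp_has_derivative bounded_linear_vector_smult)
    then have "((\<lambda>c. f (t + c *s \<xi>)) has_derivative (\<lambda>c. \<Sum>a\<in>UNIV. d a * (0 + c *s \<xi>) $ a)) (at 0)"
      by (rule has_derivative_compose) (use d in simp)
    then show ?thesis unfolding has_field_derivative_def
      by (rule has_derivative_eq_rhs) (simp add: sum_distrib_left sum_distrib_right mult_ac fun_eq_iff)
  qed
  then have eq: "dir_deriv f t = (\<lambda>h. \<Sum>a\<in>UNIV. d a * h $ a)"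
    unfolding dir_deriv_def by (intro ext DERIV_imp_deriv)
  show "(f has_derivative dir_deriv f t) (at t)" using d by (simp add: eq)
  show "\<exists>d. dir_deriv f t = (\<lambda>h. \<Sum>a\<in>UNIV. d a * h $ a)" using eq by blast
  show "((\<lambda>c. f (t + c *s \<xi>)) has_field_derivative dir_deriv f t \<xi>) (at 0)" using line by (simp add: eq)
qed

lemma dir_deriv_linear:
  assumes "cdiff_at f t"
  shows "dir_deriv f t (x + y) = dir_deriv f t x + dir_deriv f t y"
    and "dir_deriv f t (x - y) = dir_deriv f t x - dir_deriv f t y"
    and "dir_deriv f t (c *s x) = c * dir_deriv f t x"
  using cdiff_at_has_derivative(2)[OF assms]
  by (auto simp: algebra_simps sum.distrib sum_subtractf sum_distrib_left)

lemma dir_deriv_coordinates: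
  assumes "cdiff_at f t"
  shows "dir_deriv f t \<xi> = (\<Sum>a\<in>UNIV. dir_deriv f t (axis a 1) * \<xi> $ a)"
proof -
  obtain d where d: "dir_deriv f t = (\<lambda>h. \<Sum>a\<in>UNIV. d a * h $ a)"
    using cdiff_at_has_derivative(2)[OF assms] by blast
  have "(\<Sum>b\<in>UNIV. d b * axis a 1 $ b) = d a" for a
    by (simp add: axis_def if_distrib[of "(*) (d _)"] cong: if_cong)
  then show ?thesis unfolding d by simp
qed

lemma cdiff_at_continuous: "cdiff_at f t \<Longrightarrow> continuous (at t) f"
  using cdiff_at_has_derivative(1) has_derivative_continuous by blast

lemma cdiff_on_continuous_on: "(\<And>t. t \<in> W \<Longrightarrow> cdiff_at f t) \<Longrightarrow> continuous_on W f"
  by (intro continuous_at_imp_continuous_on ballI cdiff_at_continuous) auto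

lemma cdiff_line:
  assumes "cdiff_at f (t + c *s \<xi>)"
  shows "((\<lambda>c. f (t + c *s \<xi>)) has_field_derivative dir_deriv f (t + c *s \<xi>) \<xi>) (at c)"
proof -
  have "((\<lambda>e. f (t + c *s \<xi> + e *s \<xi>)) has_field_derivative dir_deriv f (t + c *s \<xi>) \<xi>) (at 0)"
    by (rule cdiff_at_has_derivative(3)[OF assms])
  then have "((\<lambda>e. f (t + (c + e) *s \<xi>)) has_field_derivative dir_deriv f (t + c *s \<xi>) \<xi>) (at 0)"
    by (simp add: vector_sadd_rdistrib add.assoc)
  then show ?thesis using DERIV_shift[of "\<lambda>c. f (t + c *s \<xi>)" _ 0 c] by (simp add: add.commute)
qed

lemma line_holomorphic:
  assumes "\<And>c. c \<in> ball 0 r \<Longrightarrow> cdiff_at f (t + c *s \<xi>)"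
  shows "(\<lambda>c. f (t + c *s \<xi>)) holomorphic_on ball 0 r"
  using cdiff_line[OF assms] unfolding holomorphic_on_open[OF open_ball] by blast

lemma polydisc_in_open:
  fixes t :: "complex^'k"
  assumes "open W" "t \<in> W"
  obtains r where "r > 0" "\<And>s c. norm (s - t) \<le> r \<Longrightarrow> cmod c \<le> r \<Longrightarrow> s + c *s \<xi> \<in> W"
proof -
  obtain e where e: "e > 0" "ball t e \<subseteq> W" using assms by (auto simp: open_contains_ball)
  \<comment> \<open>Chosen so that \<open>r * (1 + norm \<xi>)\<close>, which bounds the distance
    from \<open>t\<close>, equals \<open>e / 2\<close>.\<close>
  define r where "r = e / (2 * (1 + norm \<xi>))"
  have r: "r > 0" using e by (simp add: r_def add_pos_nonneg)
  have n: "1 + norm \<xi> > 0" by (simp add: add_pos_nonneg)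
  have "s + c *s \<xi> \<in> W" if "norm (s - t) \<le> r" "cmod c \<le> r" for s c
  proof -
    have "norm ((s - t) + c *s \<xi>) \<le> norm (s - t) + cmod c * norm \<xi>"
      using norm_triangle_ineq[of "s - t" "c *s \<xi>"] by (simp add: norm_vector_smult)
    also have "\<dots> \<le> r + r * norm \<xi>" using that by (intro add_mono mult_right_mono) auto
    also have "\<dots> = r * (1 + norm \<xi>)" by (simp add: algebra_simps)
    also have "\<dots> = e / 2" using n by (simp add: r_def divide_simps)
    also have "\<dots> < e" using e by simp
    finally show ?thesis using e(2) by (auto simp: dist_norm norm_minus_commute algebra_simps subset_iff)
  qed
  then show ?thesis using that r by blast
qed

lemma deriv_0_le:
  assumes "\<And>c. cmod c \<le> r \<Longrightarrow> cmod (F c) \<le> B" "r > 0" "continuous_on (cball 0 r) F" "F holomorphic_on ball 0 r"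
  shows "cmod (deriv F 0) \<le> B / r"
  using Cauchy_inequality[of F 0 r B 1] assms by (auto simp: dist_norm)

text \<open>Cauchy's estimate, applied to the difference of \<open>f\<close> on two parallel discs.\<close>

lemma dir_deriv_continuous:
  fixes f :: "complex^'k \<Rightarrow> complex"
  assumes W: "open W" and f: "\<And>t. t \<in> W \<Longrightarrow> cdiff_at f t"
  shows "continuous_on W (\<lambda>t. dir_deriv f t \<xi>)"
proof (rule continuous_at_imp_continuous_on, intro ballI)
  fix t assume t: "t \<in> W"
  obtain r where r: "r > 0" "\<And>s c. norm (s - t) \<le> r \<Longrightarrow> cmod c \<le> r \<Longrightarrow> s + c *s \<xi> \<in> W"
    using polydisc_in_open[OF W t] by blast
  \<comment> \<open>The compact set swept out by the discs in direction \<xi> centred near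
    \<open>t\<close>; on it \<open>f\<close> is uniformly continuous.\<close>
  define K where "K = (\<lambda>p. fst p + snd p *s \<xi>) ` (cball t r \<times> cball 0 r)"
  have cont: "continuous_on A (\<lambda>p. fst p + snd p *s \<xi>)" for A
    by (intro continuous_intros bounded_linear.continuous_on[OF bounded_linear_vector_smult])
  have "compact K" unfolding K_def by (intro compact_continuous_image cont compact_Times compact_cball)
  moreover have "K \<subseteq> W" using r by (auto simp: K_def dist_norm norm_minus_commute)
  ultimately have uc: "uniformly_continuous_on K f"
    using cdiff_on_continuous_on[of K f] f compact_uniformly_continuous by blast
  have "\<exists>d>0. \<forall>s. dist s t < d \<longrightarrow> dist (dir_deriv f s \<xi>) (dir_deriv f t \<xi>) < e" if e: "e > 0" for e
  proof -
    \<comment> \<open>Cauchy's estimate divides by \<open>r\<close>: a difference of at most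
      \<open>e * r / 2\<close> on the discs leaves \<open>e / 2\<close> for the derivatives.\<close>
    have "e * r / 2 > 0" using e r by simp
    then obtain d where d: "d > 0" "\<And>x y. x \<in> K \<Longrightarrow> y \<in> K \<Longrightarrow> dist x y < d \<Longrightarrow> dist (f x) (f y) < e * r / 2"
      using uc unfolding uniformly_continuous_on_def by metis
    have "dist (dir_deriv f s \<xi>) (dir_deriv f t \<xi>) < e" if s: "dist s t < min d r" for s
    proof -
      let ?F = "\<lambda>c. f (s + c *s \<xi>) - f (t + c *s \<xi>)"
      have sr: "norm (s - t) \<le> r" "norm (t - t) \<le> r" using s r by (auto simp: dist_norm)
      have c1: "cdiff_at f (s + c *s \<xi>)" "cdiff_at f (t + c *s \<xi>)" if "cmod c \<le> r" for c
        using f r(2) sr that by blast+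
      have "continuous_on (cball 0 r) ?F"
        using c1[THEN cdiff_line, THEN DERIV_isCont]
        by (intro continuous_at_imp_continuous_on ballI continuous_diff) auto
      moreover have "?F holomorphic_on ball 0 r"
        by (intro holomorphic_on_diff line_holomorphic c1) auto
      moreover have "cmod (?F c) \<le> e * r / 2" if c: "cmod c \<le> r" for c
      proof -
        have "s + c *s \<xi> \<in> K" "t + c *s \<xi> \<in> K"
          using c sr r unfolding K_def
          by (intro rev_image_eqI[of "(s, c)"] rev_image_eqI[of "(t, c)"];
              simp add: dist_norm norm_minus_commute)+
        from d(2)[OF this] s show ?thesis by (auto simp: dist_norm)
      qed
      ultimately have "cmod (deriv ?F 0) \<le> e * r / 2 / r" using r by (intro deriv_0_le) auto
      moreover have "deriv ?F 0 = dir_deriv f s \<xi> - dir_deriv f t \<xi>"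
        using r by (intro DERIV_imp_deriv DERIV_diff) (use c1(1)[of 0] c1(2)[of 0] cdiff_at_has_derivative(3) in auto)
      ultimately show ?thesis using e r by (auto simp: dist_norm)
    qed
    then show ?thesis using d r by (intro exI[of _ "min d r"]) auto
  qed
  then show "isCont (\<lambda>t. dir_deriv f t \<xi>) t" unfolding continuous_at_eps_delta
    by (auto simp: dist_norm)
qed


text \<open>Mean value inequality on the unit disc for the restriction of \<open>f\<close> to the
  line in direction \<open>w\<close>, minus its linear part.\<close>

lemma taylor_remainder_le:
  assumes f: "\<And>c. cmod c \<le> 1 \<Longrightarrow> cdiff_at f (s + c *s w)"
    and B: "\<And>c. cmod c \<le> 1 \<Longrightarrow> cmod (dir_deriv f (s + c *s w) w - dir_deriv f s w) \<le> B"
  shows "cmod (f (s + w) - f s - dir_deriv f s w) \<le> B"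
proof -
  let ?\<phi> = "\<lambda>c. f (s + c *s w) - c * dir_deriv f s w"
  have "(?\<phi> has_field_derivative dir_deriv f (s + c *s w) w - dir_deriv f s w) (at c within cball 0 1)"
    if "c \<in> cball 0 1" for c
    using that by (auto intro!: derivative_eq_intros has_field_derivative_at_within[OF cdiff_line] f)
  then have "cmod (?\<phi> 1 - ?\<phi> 0) \<le> B * cmod (1 - 0)"
    by (intro field_differentiable_bound[of "cball 0 1" ?\<phi> "\<lambda>c. dir_deriv f (s + c *s w) w - dir_deriv f s w"])
      (use B in auto)
  then show ?thesis by (simp add: algebra_simps)
qed

text \<open>Cauchy's estimate requires the Taylor bound along a whole disc in direction \<xi> at
  once. The partial derivatives are uniformly continuous on a compact set, and this makes the bound
  uniform.\<close>

lemma taylor_remainder_uniform: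
  fixes f :: "complex^'k \<Rightarrow> complex"
  assumes W: "open W" and f: "\<And>t. t \<in> W \<Longrightarrow> cdiff_at f t" and t: "t \<in> W"
  obtains r where "r > 0" "\<And>s c. norm (s - t) \<le> r \<Longrightarrow> cmod c \<le> r \<Longrightarrow> s + c *s \<xi> \<in> W"
    "\<And>e. e > 0 \<Longrightarrow> \<exists>\<delta>>0. \<delta> \<le> r \<and> (\<forall>w c. norm w < \<delta> \<longrightarrow> cmod c \<le> r \<longrightarrow>
       cmod (f (t + w + c *s \<xi>) - f (t + c *s \<xi>) - dir_deriv f (t + c *s \<xi>) w) \<le> e * norm w)"
proof -
  obtain r where r: "r > 0" "\<And>s c. norm (s - t) \<le> r \<Longrightarrow> cmod c \<le> r \<Longrightarrow> s + c *s \<xi> \<in> W"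
    using polydisc_in_open[OF W t] by blast
  define K where "K = (\<lambda>p. fst p + snd p *s \<xi>) ` (cball t r \<times> cball 0 r)"
  have cont: "continuous_on A (\<lambda>p. fst p + snd p *s \<xi>)" for A
    by (intro continuous_intros bounded_linear.continuous_on[OF bounded_linear_vector_smult])
  have "compact K" unfolding K_def by (intro compact_continuous_image cont compact_Times compact_cball)
  moreover have KW: "K \<subseteq> W" using r by (auto simp: K_def dist_norm norm_minus_commute)
  ultimately have uc: "uniformly_continuous_on K (\<lambda>t. dir_deriv f t \<eta>)" for \<eta>
    using continuous_on_subset[OF dir_deriv_continuous[OF W f]] compact_uniformly_continuous by blast
  have "\<exists>\<delta>>0. \<delta> \<le> r \<and> (\<forall>w c. norm w < \<delta> \<longrightarrow> cmod c \<le> r \<longrightarrow>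
       cmod (f (t + w + c *s \<xi>) - f (t + c *s \<xi>) - dir_deriv f (t + c *s \<xi>) w) \<le> e * norm w)"
    if e: "e > 0" for e
  proof -
    \<comment> \<open>An equal share of \<open>e\<close> for each of the \<open>CARD('k)\<close>
      partial derivatives.\<close>
    define e' where "e' = e / real CARD('k)"
    have e': "e' > 0" using e by (simp add: e'_def)
    have "\<forall>a. \<exists>d>0. \<forall>x\<in>K. \<forall>y\<in>K. dist x y < d \<longrightarrow> dist (dir_deriv f x (axis a 1)) (dir_deriv f y (axis a 1)) < e'"
      using uc e' unfolding uniformly_continuous_on_def by (metis dist_commute)
    then obtain d where d: "\<And>a. d a > 0"
      "\<And>a x y. x \<in> K \<Longrightarrow> y \<in> K \<Longrightarrow> dist x y < d a \<Longrightarrow> dist (dir_deriv f x (axis a 1)) (dir_deriv f y (axis a 1)) < e'"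
      by metis
    \<comment> \<open>The bound by \<open>r\<close> keeps the points between \<open>t\<close> and
      \<open>t + w\<close>, and their discs, inside \<open>K\<close>; the bounds by
      \<open>d a\<close> control the partial derivatives.\<close>
    define \<delta> where "\<delta> = Min (insert r (range d))"
    have \<delta>: "\<delta> > 0" "\<delta> \<le> r" "\<And>a. \<delta> \<le> d a"
      unfolding \<delta>_def using r d(1) by (auto simp: Min_gr_iff intro!: Min_le simp del: Min_insert)
    have "cmod (f (t + w + c *s \<xi>) - f (t + c *s \<xi>) - dir_deriv f (t + c *s \<xi>) w) \<le> e * norm w"
      if w: "norm w < \<delta>" and c: "cmod c \<le> r" for w c
    proof -
      have K1: "t + c *s \<xi> + b *s w \<in> K" if "cmod b \<le> 1" for b
      proof -
        have "cmod b * norm w \<le> 1 * r" using that w \<delta> by (intro mult_mono) auto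
        then show ?thesis using c unfolding K_def
          by (intro rev_image_eqI[of "(t + b *s w, c)"]) (simp_all add: dist_norm norm_vector_smult)
      qed
      have "cmod (f (t + c *s \<xi> + w) - f (t + c *s \<xi>) - dir_deriv f (t + c *s \<xi>) w) \<le> e * norm w"
      proof (rule taylor_remainder_le)
        fix b :: complex assume b: "cmod b \<le> 1"
        let ?x = "t + c *s \<xi> + b *s w" and ?y = "t + c *s \<xi>"
        have xy: "?x \<in> K" "?y \<in> K" using K1[OF b] K1[of 0] by auto
        show x: "cdiff_at f ?x" using xy KW f by blast
        have y: "cdiff_at f ?y" using xy KW f by blast
        have "cmod b * norm w \<le> 1 * norm w" using b by (intro mult_right_mono) auto
        then have "dist ?x ?y < \<delta>" using w by (simp add: dist_norm norm_vector_smult)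
        then have "dist (dir_deriv f ?x (axis a 1)) (dir_deriv f ?y (axis a 1)) < e'" for a
          using d(2)[OF xy] \<delta>(3)[of a] by (meson less_le_trans)
        then have le: "cmod ((dir_deriv f ?x (axis a 1) - dir_deriv f ?y (axis a 1)) * w $ a) \<le> e' * norm w" for a
          unfolding norm_mult dist_norm using e' by (intro mult_mono Finite_Cartesian_Product.norm_nth_le) (auto simp: less_imp_le)
        have "dir_deriv f ?x w - dir_deriv f ?y w
            = (\<Sum>a\<in>UNIV. (dir_deriv f ?x (axis a 1) - dir_deriv f ?y (axis a 1)) * w $ a)"
          using dir_deriv_coordinates[OF x, of w] dir_deriv_coordinates[OF y, of w]
          by (simp add: left_diff_distrib sum_subtractf)
        also have "cmod \<dots> \<le> (\<Sum>a\<in>(UNIV :: 'k set). e' * norm w)"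
          by (rule sum_norm_le) (rule le)
        also have "\<dots> = e * norm w" by (simp add: e'_def)
        finally show "cmod (dir_deriv f ?x w - dir_deriv f ?y w) \<le> e * norm w" .
      qed
      then show ?thesis by (simp add: add_ac)
    qed
    then show ?thesis using \<delta> by blast
  qed
  then show ?thesis using that r by blast
qed

text \<open>Along the line, the derivative in direction \<eta> is the uniform limit of difference
  quotients, which are holomorphic in \<open>c\<close>; Weierstrass's theorem applies.\<close>

lemma dir_deriv_line_holomorphic:
  assumes r: "r > 0" and f: "\<And>s c. norm (s - t) \<le> r \<Longrightarrow> cmod c \<le> r \<Longrightarrow> cdiff_at f (s + c *s \<xi>)"
    and unif: "\<And>e. e > 0 \<Longrightarrow> \<exists>\<delta>>0. \<delta> \<le> r \<and> (\<forall>w c. norm w < \<delta> \<longrightarrow> cmod c \<le> r \<longrightarrow>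
       cmod (f (t + w + c *s \<xi>) - f (t + c *s \<xi>) - dir_deriv f (t + c *s \<xi>) w) \<le> e * norm w)"
  shows "continuous_on (cball 0 r) (\<lambda>c. dir_deriv f (t + c *s \<xi>) \<eta>)"
    and "(\<lambda>c. dir_deriv f (t + c *s \<xi>) \<eta>) holomorphic_on ball 0 r"
proof -
  let ?g = "\<lambda>h c. (f (t + h *s \<eta> + c *s \<xi>) - f (t + c *s \<xi>)) / h"
  have small: "\<forall>\<^sub>F h in at 0. norm (h *s \<eta>) < d \<and> h \<noteq> 0" if d: "d > 0" for d
  proof -
    have "((\<lambda>h. norm (h *s \<eta>)) \<longlongrightarrow> norm (0 *s \<eta>)) (at 0)"
      by (intro tendsto_norm bounded_linear.tendsto[OF bounded_linear_vector_smult]) auto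
    then have "\<forall>\<^sub>F h in at 0. norm (h *s \<eta>) < d" by (rule order_tendstoD) (use d in simp)
    then show ?thesis by (intro eventually_conj) (auto simp: eventually_at_filter)
  qed
  have hol: "continuous_on (cball 0 r) (\<lambda>c. f (s + c *s \<xi>)) \<and> (\<lambda>c. f (s + c *s \<xi>)) holomorphic_on ball 0 r"
    if "norm (s - t) \<le> r" for s
    using f[OF that, THEN cdiff_line, THEN DERIV_isCont]
    by (intro conjI continuous_at_imp_continuous_on ballI line_holomorphic f that) auto
  have "\<forall>\<^sub>F h in at 0. continuous_on (cball 0 r) (?g h) \<and> ?g h holomorphic_on ball 0 r"
    using small[OF r]
  proof eventually_elim
    case (elim h)
    then show ?case using hol[of "t + h *s \<eta>"] hol[of t] r
      by (auto intro!: continuous_intros holomorphic_intros)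
  qed
  moreover have "uniform_limit (cball 0 r) ?g (\<lambda>c. dir_deriv f (t + c *s \<xi>) \<eta>) (at 0)"
    unfolding uniform_limit_iff
  proof (intro allI impI)
    fix e :: real assume e: "e > 0"
    \<comment> \<open>The summand 1 covers \<eta> = 0 and makes the final estimate strict.\<close>
    define e' where "e' = e / (norm \<eta> + 1)"
    have n: "norm \<eta> + 1 > 0" by (simp add: add_nonneg_pos)
    have e': "e' > 0" using e n by (simp add: e'_def)
    obtain \<delta> where \<delta>: "\<delta> > 0" "\<And>w c. norm w < \<delta> \<Longrightarrow> cmod c \<le> r \<Longrightarrow>
       cmod (f (t + w + c *s \<xi>) - f (t + c *s \<xi>) - dir_deriv f (t + c *s \<xi>) w) \<le> e' * norm w"
      using unif[OF e'] by blast
    show "\<forall>\<^sub>F h in at 0. \<forall>c\<in>cball 0 r. dist (?g h c) (dir_deriv f (t + c *s \<xi>) \<eta>) < e"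
      using small[OF \<delta>(1)]
    proof eventually_elim
      case (elim h)
      have "dist (?g h c) (dir_deriv f (t + c *s \<xi>) \<eta>) < e" if c: "cmod c \<le> r" for c
      proof -
        have "cdiff_at f (t + c *s \<xi>)" using f[of t c] c r by simp
        then have "f (t + h *s \<eta> + c *s \<xi>) - f (t + c *s \<xi>) - dir_deriv f (t + c *s \<xi>) (h *s \<eta>)
            = h * (?g h c - dir_deriv f (t + c *s \<xi>) \<eta>)"
          using elim by (simp add: dir_deriv_linear(3) field_simps)
        then have "cmod h * dist (?g h c) (dir_deriv f (t + c *s \<xi>) \<eta>) \<le> e' * norm (h *s \<eta>)"
          using \<delta>(2)[of "h *s \<eta>" c] elim c by (simp add: dist_norm norm_mult)
        also have "\<dots> = cmod h * (e' * norm \<eta>)" by (simp add: norm_vector_smult)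
        finally have "dist (?g h c) (dir_deriv f (t + c *s \<xi>) \<eta>) \<le> e' * norm \<eta>"
          using elim by (simp only: mult_le_cancel_left) simp
        also have "\<dots> < e" using e n by (simp add: e'_def field_simps)
        finally show ?thesis .
      qed
      then show ?case by auto
    qed
  qed
  ultimately show "continuous_on (cball 0 r) (\<lambda>c. dir_deriv f (t + c *s \<xi>) \<eta>)"
    and "(\<lambda>c. dir_deriv f (t + c *s \<xi>) \<eta>) holomorphic_on ball 0 r"
    using holomorphic_uniform_limit[of 0 r ?g "at 0"] by auto
qed

text \<open>Cauchy's estimate, applied to the Taylor remainder of \<open>f\<close> on a disc in direction \<open>\<xi>\<close>, shows that
  the derivative of \<open>t \<mapsto> dir_deriv f t \<xi>\<close> is \<open>w \<mapsto> M w\<close>, where \<open>M w\<close> is by construction the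
  derivative in direction \<open>\<xi>\<close> of \<open>t \<mapsto> dir_deriv f t w\<close>.\<close>

theorem dir_deriv_cdiff:
  fixes f :: "complex^'k \<Rightarrow> complex"
  assumes W: "open W" and f: "\<And>t. t \<in> W \<Longrightarrow> cdiff_at f t" and t: "t \<in> W"
  shows "cdiff_at (\<lambda>t. dir_deriv f t \<xi>) t"
    and "dir_deriv (\<lambda>t. dir_deriv f t \<xi>) t \<eta> = dir_deriv (\<lambda>t. dir_deriv f t \<eta>) t \<xi>"
proof -
  obtain r where r: "r > 0" "\<And>s c. norm (s - t) \<le> r \<Longrightarrow> cmod c \<le> r \<Longrightarrow> s + c *s \<xi> \<in> W"
    and unif: "\<And>e. e > 0 \<Longrightarrow> \<exists>\<delta>>0. \<delta> \<le> r \<and> (\<forall>w c. norm w < \<delta> \<longrightarrow> cmod c \<le> r \<longrightarrow>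
       cmod (f (t + w + c *s \<xi>) - f (t + c *s \<xi>) - dir_deriv f (t + c *s \<xi>) w) \<le> e * norm w)"
    using taylor_remainder_uniform[of W f t \<xi>, OF W f t] by blast
  have cd: "cdiff_at f (s + c *s \<xi>)" if "norm (s - t) \<le> r" "cmod c \<le> r" for s c
    using f r(2) that by blast
  have line: "continuous_on (cball 0 r) (\<lambda>c. dir_deriv f (t + c *s \<xi>) \<eta>)"
    "(\<lambda>c. dir_deriv f (t + c *s \<xi>) \<eta>) holomorphic_on ball 0 r" for \<eta>
    by (rule dir_deriv_line_holomorphic[of r t f \<xi> \<eta>], fact r(1), fact cd, fact unif)+
  define M where "M w = deriv (\<lambda>c. dir_deriv f (t + c *s \<xi>) w) 0" for w
  have M: "((\<lambda>c. dir_deriv f (t + c *s \<xi>) w) has_field_derivative M w) (at 0)" for w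
    unfolding M_def using line(2)[of w] r(1) by (intro holomorphic_derivI[of _ "ball 0 r"]) auto
  \<comment> \<open>Linearity of \<open>M\<close>: the derivative in direction \<open>w\<close>
    expands over the axes at every point of the disc, and the expansion is differentiated in
    \<open>c\<close>.\<close>
  have M_sum: "M w = (\<Sum>a\<in>UNIV. M (axis a 1) * w $ a)" for w
  proof -
    have *: "((\<lambda>c. \<Sum>a\<in>UNIV. dir_deriv f (t + c *s \<xi>) (axis a 1) * w $ a) has_field_derivative
        (\<Sum>a\<in>UNIV. M (axis a 1) * w $ a)) (at 0)"
      by (intro DERIV_sum DERIV_cmult_right M)
    have "((\<lambda>c. dir_deriv f (t + c *s \<xi>) w) has_field_derivative
        (\<Sum>a\<in>UNIV. M (axis a 1) * w $ a)) (at 0)"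
    proof -
      have "\<forall>\<^sub>F c in nhds 0. c \<in> ball 0 r" using r by (intro eventually_nhds_in_open) auto
      then have "\<forall>\<^sub>F c in nhds 0. (\<Sum>a\<in>UNIV. dir_deriv f (t + c *s \<xi>) (axis a 1) * w $ a) = dir_deriv f (t + c *s \<xi>) w"
      proof eventually_elim
        case (elim c)
        then have "cdiff_at f (t + c *s \<xi>)" using cd[of t c] r by simp
        from dir_deriv_coordinates[OF this, of w] show ?case by simp
      qed
      from DERIV_cong_ev[OF refl this refl] * show ?thesis by simp
    qed
    with M show ?thesis by (rule DERIV_unique)
  qed
  have est: "cmod (dir_deriv f (t + w) \<xi> - dir_deriv f t \<xi> - M w) \<le> e * norm w / r"
    if w: "norm w < \<delta>" and \<delta>: "\<delta> \<le> r" and le: "\<And>c. cmod c \<le> r \<Longrightarrow>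
       cmod (f (t + w + c *s \<xi>) - f (t + c *s \<xi>) - dir_deriv f (t + c *s \<xi>) w) \<le> e * norm w" for w \<delta> e
  proof -
    let ?H = "\<lambda>c. f (t + w + c *s \<xi>) - f (t + c *s \<xi>) - dir_deriv f (t + c *s \<xi>) w"
    have cw: "cdiff_at f (t + w + c *s \<xi>)" "cdiff_at f (t + c *s \<xi>)" if "cmod c \<le> r" for c
      using cd[of "t + w" c] cd[of t c] w \<delta> r(1) that by auto
    have "continuous_on (cball 0 r) ?H"
    proof (intro continuous_on_diff line(1))
      show "continuous_on (cball 0 r) (\<lambda>c. f (t + w + c *s \<xi>))" "continuous_on (cball 0 r) (\<lambda>c. f (t + c *s \<xi>))"
        using cw[THEN cdiff_line, THEN DERIV_isCont]
        by (auto intro!: continuous_at_imp_continuous_on)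
    qed
    moreover have "?H holomorphic_on ball 0 r"
      by (intro holomorphic_on_diff line(2) line_holomorphic cw) auto
    ultimately have "cmod (deriv ?H 0) \<le> e * norm w / r" using r le by (intro deriv_0_le) auto
    moreover have "deriv ?H 0 = dir_deriv f (t + w) \<xi> - dir_deriv f t \<xi> - M w"
      using cw[of 0] r by (intro DERIV_imp_deriv DERIV_diff M cdiff_at_has_derivative(3)) auto
    ultimately show ?thesis by simp
  qed
  have M_eq: "M = (\<lambda>h. \<Sum>a\<in>UNIV. M (axis a 1) * h $ a)"
    by (rule ext) (rule M_sum)
  have deriv: "((\<lambda>s. dir_deriv f s \<xi>) has_derivative M) (at t)"
    unfolding has_derivative_at_alt
  proof (intro conjI allI impI)
    show "bounded_linear M"
      by (subst M_eq) (intro bounded_linear_sum bounded_linear_const_mult bounded_linear_vec_nth)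
    fix e :: real assume e: "e > 0"
    \<comment> \<open>The tolerance \<open>e * r\<close> compensates for the division by
      \<open>r\<close> in \<open>est\<close>.\<close>
    then have "e * r > 0" using r by simp
    from unif[OF this] obtain \<delta> where \<delta>: "\<delta> > 0" "\<delta> \<le> r" "\<And>w c. norm w < \<delta> \<Longrightarrow> cmod c \<le> r \<Longrightarrow>
       cmod (f (t + w + c *s \<xi>) - f (t + c *s \<xi>) - dir_deriv f (t + c *s \<xi>) w) \<le> e * r * norm w" by blast
    have "norm (dir_deriv f y \<xi> - dir_deriv f t \<xi> - M (y - t)) \<le> e * norm (y - t)" if "norm (y - t) < \<delta>" for y
      using est[OF that \<delta>(2) \<delta>(3)[OF that]] r(1) by simp
    then show "\<exists>d>0. \<forall>y. norm (y - t) < d \<longrightarrow>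
        norm (dir_deriv f y \<xi> - dir_deriv f t \<xi> - M (y - t)) \<le> e * norm (y - t)"
      using \<delta>(1) by blast
  qed
  then show cd': "cdiff_at (\<lambda>t. dir_deriv f t \<xi>) t"
    unfolding cdiff_at_def by (subst (asm) M_eq) (rule exI[of _ "\<lambda>a. M (axis a 1)"])
  have "dir_deriv (\<lambda>t. dir_deriv f t \<xi>) t = M"
    by (rule has_derivative_unique[OF cdiff_at_has_derivative(1)[OF cd'] deriv])
  then show "dir_deriv (\<lambda>t. dir_deriv f t \<xi>) t \<eta> = dir_deriv (\<lambda>t. dir_deriv f t \<eta>) t \<xi>"
    by (simp only: M_def dir_deriv_def[of "\<lambda>t. dir_deriv f t \<eta>"])
qed

section \<open>The complex vector space as an analytic space\<close>

abbreviation affine_space :: "(complex^'k) cspace" where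
  "affine_space \<equiv> coordinate_space UNIV (range (\<lambda>a (t::complex^'k). t $ a))"

text \<open>A polydisc of radius \<open>e / CARD('k)\<close> lies in the ball of radius
  \<open>e\<close>, since the norm is at most the sum of the moduli of the coordinates.\<close>

lemma openin_affine_space [simp]: "openin (weak_topology UNIV (range (\<lambda>a (t::complex^'k). t $ a))) W \<longleftrightarrow> open W"
proof
  assume "openin (weak_topology UNIV (range (\<lambda>a (t::complex^'k). t $ a))) W"
  then show "open W"
    unfolding weak_topology_def openin_topology_generated_by_iff
  proof (induction rule: generate_topology_on.induct)
    case (Basis s)
    then consider "s = UNIV" | a B where "open B" "s = (\<lambda>t. t $ a) -` B" by (auto simp: vimage_def)
    then show ?case by cases (auto intro: open_vimage_vec_nth)
  qed auto
next
  assume W: "open W"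
  show "openin (weak_topology UNIV (range (\<lambda>a (t::complex^'k). t $ a))) W"
  proof (subst openin_subopen, intro ballI)
    fix t assume "t \<in> W"
    then obtain e where e: "e > 0" "ball t e \<subseteq> W" using W by (auto simp: open_contains_ball)
    define r where "r = e / real CARD('k)"
    have r: "r > 0" using e by (simp add: r_def)
    let ?B = "\<Inter>a\<in>UNIV. {s \<in> UNIV. s $ a \<in> ball (t $ a) r}"
    have "openin (weak_topology UNIV (range (\<lambda>a (t::complex^'k). t $ a))) ?B"
    proof (intro openin_INT2)
      fix a :: 'k
      have U: "openin (weak_topology UNIV (range (\<lambda>a (t::complex^'k). t $ a))) UNIV"
        using openin_topspace[of "weak_topology UNIV (range (\<lambda>a (t::complex^'k). t $ a))"] by simp
      show "openin (weak_topology UNIV (range (\<lambda>a (t::complex^'k). t $ a))) {s \<in> UNIV. s $ a \<in> ball (t $ a) r}"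
        by (rule generators.continuous[OF generators_coordinate U]) auto
    qed auto
    moreover have "?B \<subseteq> W"
    proof
      fix s assume "s \<in> ?B"
      then have s: "\<And>a. cmod ((s - t) $ a) < r" by (auto simp: dist_norm norm_minus_commute)
      have "norm (s - t) \<le> (\<Sum>a\<in>UNIV. cmod ((s - t) $ a))"
        unfolding norm_vec_def by (rule L2_set_le_sum) auto
      also have "\<dots> < (\<Sum>a\<in>(UNIV::'k set). r)" by (rule sum_strict_mono) (use s in auto)
      also have "\<dots> = e" by (simp add: r_def)
      finally show "s \<in> W" using e by (auto simp: dist_norm norm_minus_commute)
    qed
    ultimately show "\<exists>T. openin (weak_topology UNIV (range (\<lambda>a (t::complex^'k). t $ a))) T \<and> t \<in> T \<and> T \<subseteq> W"
      using r by (intro exI[of _ ?B]) auto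
  qed
qed

lemma cdiff_at_transform:
  assumes "cdiff_at f t" "open U" "t \<in> U" "\<And>s. s \<in> U \<Longrightarrow> f s = g s"
  shows "cdiff_at g t"
  using assms has_derivative_transform_within_open unfolding cdiff_at_def by blast

text \<open>The list \<open>a\<close> may repeat a coordinate or omit one; the coefficients
  belonging to the same coordinate are added up.\<close>

lemma cdiff_at_coordinates:
  fixes F :: "(nat \<Rightarrow> complex) \<Rightarrow> complex" and a :: "nat \<Rightarrow> 'k::finite"
  assumes "cdifferentiable m F (\<lambda>i. t $ a i)"
  shows "cdiff_at (\<lambda>s. F (\<lambda>i. s $ a i)) t"
proof -
  obtain d where d: "\<And>e. e > 0 \<Longrightarrow> \<exists>r>0. \<forall>z. (\<forall>i<m. cmod (z i - t $ a i) < r) \<longrightarrow>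
     cmod (F z - F (\<lambda>i. t $ a i) - (\<Sum>i<m. d i * (z i - t $ a i))) \<le> e * (\<Sum>i<m. cmod (z i - t $ a i))"
    using assms unfolding cdifferentiable_def by blast
  have "((\<lambda>s. F (\<lambda>i. s $ a i)) has_derivative (\<lambda>h. \<Sum>i<m. d i * h $ a i)) (at t)"
    unfolding has_derivative_at_alt
  proof (intro conjI allI impI)
    show "bounded_linear (\<lambda>h. \<Sum>i<m. d i * h $ a i)"
      by (intro bounded_linear_sum bounded_linear_const_mult bounded_linear_vec_nth)
    fix e :: real assume e: "e > 0"
    define e' where "e' = e / (real m + 1)"
    have e': "e' > 0" using e by (simp add: e'_def add_nonneg_pos)
    obtain r where r: "r > 0" "\<And>z. (\<forall>i<m. cmod (z i - t $ a i) < r) \<Longrightarrow>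
     cmod (F z - F (\<lambda>i. t $ a i) - (\<Sum>i<m. d i * (z i - t $ a i))) \<le> e' * (\<Sum>i<m. cmod (z i - t $ a i))"
      using d[OF e'] by blast
    have "cmod (F (\<lambda>i. s $ a i) - F (\<lambda>i. t $ a i) - (\<Sum>i<m. d i * (s - t) $ a i)) \<le> e * norm (s - t)"
      if s: "norm (s - t) < r" for s
    proof -
      have n: "cmod (s $ a i - t $ a i) \<le> norm (s - t)" for i
        using Finite_Cartesian_Product.norm_nth_le[of "s - t" "a i"] by simp
      then have "\<forall>i<m. cmod (s $ a i - t $ a i) < r" using s by (meson le_less_trans)
      from r(2)[OF this] have "cmod (F (\<lambda>i. s $ a i) - F (\<lambda>i. t $ a i) - (\<Sum>i<m. d i * (s - t) $ a i))
          \<le> e' * (\<Sum>i<m. cmod (s $ a i - t $ a i))" by simp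
      also have "\<dots> \<le> e' * (\<Sum>i<m. norm (s - t))"
        using e' n by (intro mult_left_mono sum_mono) auto
      also have "\<dots> = (e' * real m) * norm (s - t)" by simp
      also have "\<dots> \<le> e * norm (s - t)"
        using e by (intro mult_right_mono) (auto simp: e'_def field_simps)
      finally show ?thesis .
    qed
    then show "\<exists>r>0. \<forall>s. norm (s - t) < r \<longrightarrow>
       cmod (F (\<lambda>i. s $ a i) - F (\<lambda>i. t $ a i) - (\<Sum>i<m. d i * (s - t) $ a i)) \<le> e * norm (s - t)"
      using r by blast
  qed
  moreover have "(\<Sum>i<m. d i * h $ a i) = (\<Sum>b\<in>UNIV. (\<Sum>i | i < m \<and> a i = b. d i) * h $ b)" for h
  proof -
    have "(\<Sum>i<m. d i * h $ a i) = (\<Sum>b\<in>UNIV. \<Sum>i | i \<in> {..<m} \<and> a i = b. d i * h $ a i)"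
      by (rule sum.group[symmetric]) auto
    then show ?thesis by (simp add: sum_distrib_right)
  qed
  ultimately show ?thesis unfolding cdiff_at_def
    by (intro exI[of _ "\<lambda>b. \<Sum>i | i < m \<and> a i = b. d i"]) simp
qed

text \<open>The coefficients are carried along \<open>idx\<close>; an index outside its range
  receives the empty sum 0.\<close>

lemma cdifferentiable_coordinates:
  fixes f :: "complex^'k \<Rightarrow> complex" and idx :: "'k \<Rightarrow> nat"
  assumes f: "cdiff_at f (\<chi> a. z (idx a))" and idx: "\<And>a. idx a < m" "inj idx"
  shows "cdifferentiable m (\<lambda>z. f (\<chi> a. z (idx a))) z"
proof -
  let ?t = "\<lambda>z. (\<chi> a. z (idx a)) :: complex^'k"
  obtain d where d: "(f has_derivative (\<lambda>h. \<Sum>a\<in>UNIV. d a * h $ a)) (at (?t z))"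
    using f by (auto simp: cdiff_at_def)
  define d' where "d' i = (\<Sum>a | idx a = i. d a)" for i
  have sum_idx: "(\<Sum>i<m. d' i * v i) = (\<Sum>a\<in>UNIV. d a * v (idx a))" for v
  proof -
    have "(\<Sum>a\<in>UNIV. d a * v (idx a)) = (\<Sum>i<m. \<Sum>a | a \<in> UNIV \<and> idx a = i. d a * v (idx a))"
      by (rule sum.group[symmetric]) (use idx in auto)
    then show ?thesis by (simp add: d'_def sum_distrib_right)
  qed
  have norm_le: "norm (?t y - ?t z) \<le> (\<Sum>i<m. cmod (y i - z i))" for y
  proof -
    have "norm (?t y - ?t z) \<le> (\<Sum>a\<in>UNIV. cmod ((?t y - ?t z) $ a))"
      unfolding norm_vec_def by (rule L2_set_le_sum) auto
    also have "\<dots> = (\<Sum>i\<in>range idx. cmod (y i - z i))"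
      by (simp add: sum.reindex idx)
    also have "\<dots> \<le> (\<Sum>i<m. cmod (y i - z i))"
      by (rule sum_mono2) (use idx in auto)
    finally show ?thesis .
  qed
  show ?thesis unfolding cdifferentiable_def
  proof (intro exI[of _ d'] allI impI)
    fix e :: real assume e: "e > 0"
    obtain r where r: "r > 0" "\<And>y. norm (y - ?t z) < r \<Longrightarrow>
        norm (f y - f (?t z) - (\<Sum>a\<in>UNIV. d a * (y - ?t z) $ a)) \<le> e * norm (y - ?t z)"
      using d e unfolding has_derivative_at_alt by blast
    have "m > 0" using idx(1) by (rule le_less_trans[OF le0])
    have "cmod (f (?t y) - f (?t z) - (\<Sum>i<m. d' i * (y i - z i))) \<le> e * (\<Sum>i<m. cmod (y i - z i))"
      if y: "\<forall>i<m. cmod (y i - z i) < r / real m" for y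
    proof -
      have "(\<Sum>i<m. cmod (y i - z i)) < (\<Sum>i<m. r / real m)"
        by (rule sum_strict_mono) (use y \<open>m > 0\<close> in auto)
      then have "norm (?t y - ?t z) < r" using norm_le[of y] \<open>m > 0\<close> by simp
      from r(2)[OF this] have "cmod (f (?t y) - f (?t z) - (\<Sum>i<m. d' i * (y i - z i))) \<le> e * norm (?t y - ?t z)"
        by (simp add: sum_idx)
      also have "\<dots> \<le> e * (\<Sum>i<m. cmod (y i - z i))" using norm_le[of y] e by simp
      finally show ?thesis .
    qed
    then show "\<exists>r>0. \<forall>y. (\<forall>i<m. cmod (y i - z i) < r) \<longrightarrow>
        cmod (f (?t y) - f (?t z) - (\<Sum>i<m. d' i * (y i - z i))) \<le> e * (\<Sum>i<m. cmod (y i - z i))"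
      using r(1) \<open>m > 0\<close> by (intro exI[of _ "r / real m"]) auto
  qed
qed

text \<open>The bridge from sheaves, with which the spaces are built, to calculus, in which the
  connection is computed. One direction renames generators as coordinates, the other uses all
  coordinates, enumerated by natural numbers, as a chart.\<close>

lemma hol_affine_space:
  fixes f :: "complex^'k \<Rightarrow> complex"
  shows "f \<in> hol affine_space W \<longleftrightarrow> open W \<and> (\<forall>t\<in>W. cdiff_at f t)"
proof (intro iffI conjI ballI)
  assume f: "f \<in> hol affine_space W"
  then show W: "open W"
    using function_sheaf.hol_open[OF function_sheaf_coordinate] by (fastforce simp: openin_affine_space)
  fix t assume "t \<in> W"
  with f obtain U m g r F where U: "U \<subseteq> W"
    "local_coordinates (weak_topology UNIV (range (\<lambda>a (t::complex^'k). t $ a))) (\<lambda>_. range (\<lambda>a t. t $ a)) t U m g r"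
    and F: "holomorphic_in t U m g r F f"
    unfolding coordinate_space_def hol_generated_space by blast
  have oU: "open U" "t \<in> U" and g: "\<And>i. i < m \<Longrightarrow> \<exists>a. g i = (\<lambda>t. t $ a)" and "r > 0"
    using U(2) by (auto simp: local_coordinates_def openin_affine_space)
  from g obtain a where a: "\<And>i. i < m \<Longrightarrow> g i = (\<lambda>t. t $ a i)" by metis
  \<comment> \<open>The \<open>g i\<close> are known to be coordinates only for
    \<open>i < m\<close>; the remaining entries have no effect on \<open>F\<close>.\<close>
  have eq: "F (\<lambda>i. s $ a i) = F (\<lambda>i. g i s)" if "s \<in> U" for s
    by (rule cdifferentiable_cong[of m])
      (use F U(2) that in \<open>auto simp: holomorphic_in_def local_coordinates_def a\<close>)
  have "cdifferentiable m F (\<lambda>i. t $ a i)"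
    using F \<open>r > 0\<close> by (auto simp: holomorphic_in_def a)
  from cdiff_at_coordinates[of m F t a, OF this] show "cdiff_at f t"
    by (rule cdiff_at_transform[OF _ oU]) (use F eq in \<open>auto simp: holomorphic_in_def\<close>)
next
  assume W: "open W \<and> (\<forall>t\<in>W. cdiff_at f t)"
  obtain e :: "nat \<Rightarrow> 'k" where e: "bij_betw e {0..<CARD('k)} UNIV"
    using ex_bij_betw_nat_finite[OF finite_class.finite_UNIV] by blast
  define idx where "idx = inv_into {0..<CARD('k)} e"
  have idx: "idx a < CARD('k)" "e (idx a) = a" for a
    using bij_betw_inv_into_right[OF e] inv_into_into[of a e "{0..<CARD('k)}"] e
    by (auto simp: idx_def bij_betw_def)
  then have "inj idx" by (metis injI)
  let ?F = "\<lambda>z. f (\<chi> a. z (idx a))"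
  have "(\<lambda>t. ?F (\<lambda>i. t $ e i)) \<in> hol affine_space W"
  proof (rule function_sheaf.hol_compose[OF function_sheaf_coordinate, of _ _ W "CARD('k)" "\<lambda>i t. t $ e i" ?F])
    show "openin (ctop (affine_space :: (complex^'k) cspace)) W" using W by (simp add: openin_affine_space)
    then show "(\<lambda>t. t $ e i) \<in> hol affine_space W" for i by (auto intro: coordinate_hol)
    fix t assume t: "t \<in> W"
    obtain r where r: "r > 0" "ball t r \<subseteq> W" using W t by (meson open_contains_ball)
    have "cdifferentiable CARD('k) ?F z" if z: "\<forall>i<CARD('k). cmod (z i - t $ e i) < r / real CARD('k)" for z
    proof (rule cdifferentiable_coordinates[OF _ idx(1) \<open>inj idx\<close>])
      have "norm ((\<chi> a. z (idx a)) - t) \<le> (\<Sum>a\<in>UNIV. cmod (((\<chi> a. z (idx a)) - t) $ a))"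
        unfolding norm_vec_def by (rule L2_set_le_sum) auto
      also have "\<dots> < (\<Sum>a\<in>(UNIV::'k set). r / real CARD('k))"
        using z idx by (intro sum_strict_mono) (auto, metis)
      finally have "(\<chi> a. z (idx a)) \<in> W" using r by (auto simp: dist_norm norm_minus_commute subset_iff)
      then show "cdiff_at f (\<chi> a. z (idx a))" using W by blast
    qed
    then show "\<exists>r>0. \<forall>z. (\<forall>i<CARD('k). cmod (z i - t $ e i) < r) \<longrightarrow> cdifferentiable CARD('k) ?F z"
      using r by (intro exI[of _ "r / real CARD('k)"]) auto
  qed
  then show "f \<in> hol affine_space W" by (simp add: idx)
qed

section \<open>The monoid algebra\<close>

abbreviation "lookup \<equiv> Poly_Mapping.lookup"
abbreviation "keys \<equiv> Poly_Mapping.keys"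

lemma lookup_scal [simp]: "lookup (scal c p) \<alpha> = c * lookup p \<alpha>"
  by (simp add: scal_def Poly_Mapping.map.rep_eq when_def)

lemma lookup_monomial: "lookup (monomial \<alpha>) \<beta> = (if \<alpha> = \<beta> then 1 else 0)"
  by (simp add: monomial_def lookup_single when_def)

text \<open>The linear form on the monoid algebra with value \<open>\<kappa> \<alpha>\<close> on
  each monomial. The points of \<open>Q\<close> arise from those \<kappa> that are characters of
  \<open>S\<close>.\<close>

definition linear_extension :: "('n exponent \<Rightarrow> complex) \<Rightarrow> 'n regular \<Rightarrow> complex" where
  "linear_extension \<kappa> p = (\<Sum>\<alpha>\<in>keys p. lookup p \<alpha> * \<kappa> \<alpha>)"

lemma linear_extension_superset:
  assumes "finite A" "keys p \<subseteq> A"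
  shows "linear_extension \<kappa> p = (\<Sum>\<alpha>\<in>A. lookup p \<alpha> * \<kappa> \<alpha>)"
  unfolding linear_extension_def
  by (rule sum.mono_neutral_left) (use assms in \<open>auto simp: in_keys_iff\<close>)

lemma linear_extension_add: "linear_extension \<kappa> (p + q) = linear_extension \<kappa> p + linear_extension \<kappa> q"
proof -
  let ?A = "keys p \<union> keys q"
  show ?thesis
    using linear_extension_superset[of ?A p \<kappa>] linear_extension_superset[of ?A q \<kappa>]
      linear_extension_superset[of ?A "p + q" \<kappa>] Poly_Mapping.keys_add[of p q]
    by (simp add: lookup_add algebra_simps sum.distrib)
qed

lemma linear_extension_0 [simp]: "linear_extension \<kappa> 0 = 0"
  by (simp add: linear_extension_def)

lemma linear_extension_sum: "linear_extension \<kappa> (\<Sum>i\<in>A. f i) = (\<Sum>i\<in>A. linear_extension \<kappa> (f i))"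
  by (induction A rule: infinite_finite_induct) (auto simp: linear_extension_add)

lemma linear_extension_single [simp]: "linear_extension \<kappa> (Poly_Mapping.single \<alpha> c) = c * \<kappa> \<alpha>"
  by (simp add: linear_extension_superset[of "{\<alpha>}"])

lemma linear_extension_scal: "linear_extension \<kappa> (scal c p) = c * linear_extension \<kappa> p"
  using linear_extension_superset[of "keys p" "scal c p" \<kappa>]
  by (simp add: linear_extension_def in_keys_iff subset_iff sum_distrib_left mult.assoc)

lemma poly_mapping_sum_singles:
  assumes "finite A" "keys p \<subseteq> A"
  shows "p = (\<Sum>\<alpha>\<in>A. Poly_Mapping.single \<alpha> (lookup p \<alpha>))"
  using assms
  by (intro poly_mapping_eqI) (auto simp: lookup_sum lookup_single when_def in_keys_iff subset_iff)

lemma mult_sum_singles: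
  fixes p q :: "('a::monoid_add) \<Rightarrow>\<^sub>0 ('b::semiring_0)"
  assumes "finite A" "keys p \<subseteq> A" "finite B" "keys q \<subseteq> B"
  shows "p * q = (\<Sum>\<alpha>\<in>A. \<Sum>\<beta>\<in>B. Poly_Mapping.single (\<alpha> + \<beta>) (lookup p \<alpha> * lookup q \<beta>))"
proof -
  have "p * q = (\<Sum>\<alpha>\<in>A. Poly_Mapping.single \<alpha> (lookup p \<alpha>)) *
      (\<Sum>\<beta>\<in>B. Poly_Mapping.single \<beta> (lookup q \<beta>))"
    using poly_mapping_sum_singles[OF assms(1,2)] poly_mapping_sum_singles[OF assms(3,4)] by simp
  then show ?thesis by (simp add: sum_product mult_single)
qed

text \<open>Multiplicativity is requested only for exponents that occur, since a character of
  \<open>S\<close> is controlled only on \<open>S\<close>.\<close>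

lemma linear_extension_mult:
  assumes "\<And>\<alpha> \<beta>. \<alpha> \<in> keys p \<Longrightarrow> \<beta> \<in> keys q \<Longrightarrow> \<kappa> (\<alpha> + \<beta>) = \<kappa> \<alpha> * \<kappa> \<beta>"
  shows "linear_extension \<kappa> (p * q) = linear_extension \<kappa> p * linear_extension \<kappa> q"
proof -
  have "linear_extension \<kappa> (p * q) = (\<Sum>\<alpha>\<in>keys p. \<Sum>\<beta>\<in>keys q.
      lookup p \<alpha> * lookup q \<beta> * \<kappa> (\<alpha> + \<beta>))"
    by (subst mult_sum_singles[OF finite_keys subset_refl finite_keys subset_refl])
      (simp add: linear_extension_sum)
  also have "\<dots> = linear_extension \<kappa> p * linear_extension \<kappa> q"
    unfolding linear_extension_def sum_product by (intro sum.cong refl) (simp add: assms mult_ac)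
  finally show ?thesis .
qed

section \<open>Characters of lattices\<close>

text \<open>Compatibility with differences yields the value at zero, then inverses, products and
  integer powers, in this order.\<close>

lemma powi_character:
  fixes \<kappa> :: "('n \<Rightarrow> int) \<Rightarrow> complex"
  assumes G: "(\<lambda>_. 0) \<in> G" "\<And>g h. g \<in> G \<Longrightarrow> h \<in> G \<Longrightarrow> (\<lambda>j. g j - h j) \<in> G"
    and \<kappa>: "\<And>g h. g \<in> G \<Longrightarrow> h \<in> G \<Longrightarrow> \<kappa> (\<lambda>j. g j - h j) = \<kappa> g / \<kappa> h" "\<And>g. g \<in> G \<Longrightarrow> \<kappa> g \<noteq> 0"
    and g: "g \<in> G"
  shows "(\<lambda>j. m * g j) \<in> G \<and> \<kappa> (\<lambda>j. m * g j) = \<kappa> g powi m"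
proof -
  have \<kappa>0: "\<kappa> (\<lambda>_. 0) = 1" using \<kappa>(1)[OF G(1) G(1)] \<kappa>(2)[OF G(1)] by simp
  have minus: "(\<lambda>j. - h j) \<in> G \<and> \<kappa> (\<lambda>j. - h j) = inverse (\<kappa> h)" if "h \<in> G" for h
    using G(2)[OF G(1) that] \<kappa>(1)[OF G(1) that] \<kappa>0 by (simp add: divide_inverse)
  have add: "(\<lambda>j. h j + k j) \<in> G \<and> \<kappa> (\<lambda>j. h j + k j) = \<kappa> h * \<kappa> k" if "h \<in> G" "k \<in> G" for h k
    using G(2)[OF that(1), of "\<lambda>j. - k j"] \<kappa>(1)[OF that(1), of "\<lambda>j. - k j"] minus[OF that(2)]
    by (simp add: divide_inverse)
  have nat: "(\<lambda>j. int n * g j) \<in> G \<and> \<kappa> (\<lambda>j. int n * g j) = \<kappa> g ^ n" for n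
  proof (induction n)
    case 0 then show ?case using G(1) \<kappa>0 by simp
  next
    case (Suc n)
    have "(\<lambda>j. int (Suc n) * g j) = (\<lambda>j. g j + int n * g j)" by (auto simp: algebra_simps)
    then show ?case using add[OF g, of "\<lambda>j. int n * g j"] Suc by simp
  qed
  show ?thesis
  proof (cases "m \<ge> 0")
    case True
    then show ?thesis using nat[of "nat m"] by (simp add: power_int_def)
  next
    case False
    have "(\<lambda>j. - (int (nat (- m)) * g j)) = (\<lambda>j. m * g j)" using False by (auto simp: fun_eq_iff)
    then show ?thesis using minus[of "\<lambda>j. int (nat (- m)) * g j"] nat[of "nat (- m)"] False
      by (simp add: power_int_def power_inverse)
  qed
qed

lemma prod_powi: "(\<Prod>j\<in>J. f j powi m) = (\<Prod>j\<in>J. f j :: complex) powi m"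
  by (induction J rule: infinite_finite_induct) (auto simp: power_int_mult_distrib)

text \<open>Induction on the number of coordinates: a minimal positive value \<open>d\<close> of the new coordinate
  on \<open>G\<close> splits \<open>G\<close> as a multiple of one element plus the kernel, and the new component of \<open>w\<close> is
  a \<open>d\<close>-th root.\<close>

lemma lattice_character:
  fixes \<kappa> :: "('n \<Rightarrow> int) \<Rightarrow> complex"
  assumes "finite J" "\<And>g j. g \<in> G \<Longrightarrow> j \<notin> J \<Longrightarrow> g j = 0"
    and "(\<lambda>_. 0) \<in> G" "\<And>g h. g \<in> G \<Longrightarrow> h \<in> G \<Longrightarrow> (\<lambda>j. g j - h j) \<in> G"
    and "\<And>g h. g \<in> G \<Longrightarrow> h \<in> G \<Longrightarrow> \<kappa> (\<lambda>j. g j - h j) = \<kappa> g / \<kappa> h" "\<And>g. g \<in> G \<Longrightarrow> \<kappa> g \<noteq> 0"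
  shows "\<exists>w. (\<forall>j. w j \<noteq> 0) \<and> (\<forall>g\<in>G. \<kappa> g = (\<Prod>j\<in>J. w j powi g j))"
  using assms
proof (induction J arbitrary: G rule: finite_induct)
  case empty
  have "\<kappa> (\<lambda>_. 0) = 1" using empty.prems(4)[OF empty.prems(2,2)] empty.prems(5)[OF empty.prems(2)] by simp
  moreover have "g = (\<lambda>_. 0)" if "g \<in> G" for g using empty.prems(1)[OF that] by auto
  ultimately show ?case by (intro exI[of _ "\<lambda>_. 1"]) auto
next
  case (insert j J)
  let ?G = "{g \<in> G. g j = 0}"
  \<comment> \<open>The kernel of the new coordinate is supported on \<open>J\<close>, so the
    induction hypothesis provides the old components.\<close>
  have "\<exists>w. (\<forall>j. w j \<noteq> 0) \<and> (\<forall>g\<in>?G. \<kappa> g = (\<Prod>j\<in>J. w j powi g j))"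
  proof (rule insert.IH)
    show "g i = 0" if "g \<in> ?G" "i \<notin> J" for g i using insert.prems(1) that by (cases "i = j") auto
  qed (use insert.prems in auto)
  then obtain w where w: "\<And>j. w j \<noteq> 0" "\<And>g. g \<in> ?G \<Longrightarrow> \<kappa> g = (\<Prod>j\<in>J. w j powi g j)" by blast
  show ?case
  proof (cases "\<exists>g\<in>G. g j \<noteq> 0")
    case False
    have "\<kappa> g = (\<Prod>j\<in>insert j J. w j powi g j)" if "g \<in> G" for g
    proof -
      have "g j = 0" using False that by blast
      then show ?thesis using w(2)[of g] insert.hyps that by simp
    qed
    then show ?thesis using w(1) by blast
  next
    case True
    have mult: "(\<lambda>j. m * g j) \<in> G \<and> \<kappa> (\<lambda>j. m * g j) = \<kappa> g powi m" if "g \<in> G" for g m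
      by (rule powi_character) (use insert.prems that in auto)
    obtain g where g: "g \<in> G" "g j \<noteq> 0" using True by blast
    \<comment> \<open>A minimal positive value exists as soon as some value is positive; a negative
      one is reversed by the multiple -1.\<close>
    have "\<exists>n. n > 0 \<and> (\<exists>g\<in>G. g j = int n)"
    proof (cases "g j > 0")
      case True
      then show ?thesis using g by (intro exI[of _ "nat (g j)"]) auto
    next
      case False
      then show ?thesis using g mult[OF g(1), of "-1"]
        by (intro exI[of _ "nat (- g j)"]) (auto intro!: bexI[of _ "\<lambda>j. - g j"])
    qed
    then obtain d where d: "d > 0" "\<exists>g\<in>G. g j = int d" "\<And>n. n < d \<Longrightarrow> \<not> (n > 0 \<and> (\<exists>g\<in>G. g j = int n))"
      using exists_least_iff[of "\<lambda>n. n > 0 \<and> (\<exists>g\<in>G. g j = int n)"] by blast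
    obtain g0 where g0: "g0 \<in> G" "g0 j = int d" using d(2) by blast
    \<comment> \<open>The contribution of the old components at \<open>g0\<close>; the new component
      has to supply the missing factor \<open>\<kappa> g0 / P\<close>.\<close>
    define P where "P = (\<Prod>j\<in>J. w j powi g0 j)"
    have P: "P \<noteq> 0" using w(1) insert.hyps by (simp add: P_def)
    define \<zeta> where "\<zeta> = exp (Ln (\<kappa> g0 / P) / of_nat d)"
    have "\<kappa> g0 / P \<noteq> 0" using P insert.prems(5)[OF g0(1)] by simp
    then have \<zeta>: "\<zeta> ^ d = \<kappa> g0 / P" using d(1) by (simp add: \<zeta>_def exp_of_nat_mult[symmetric])
    define w' where "w' = w(j := \<zeta>)"
    have w'J: "w' i = w i" if "i \<in> J" for i using that insert.hyps by (auto simp: w'_def)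
    have "\<kappa> h = (\<Prod>j\<in>insert j J. w' j powi h j)" if h: "h \<in> G" for h
    proof -
      define m where "m = h j div int d"
      let ?k = "\<lambda>j. h j - m * g0 j" and ?l = "\<lambda>j. m * g0 j"
      have l: "?l \<in> G" "\<kappa> ?l = \<kappa> g0 powi m" using mult[OF g0(1), of m] by auto
      have k: "?k \<in> G" "\<kappa> ?k = \<kappa> h / \<kappa> ?l"
        using insert.prems(3)[OF h l(1)] insert.prems(4)[OF h l(1)] by auto
      have kj: "?k j = h j mod int d" using g0(2) by (simp add: m_def minus_div_mult_eq_mod[symmetric])
      \<comment> \<open>A nonzero remainder modulo \<open>d\<close> would be a positive value
        smaller than the minimal one.\<close>
      have "?k j = 0"
      proof (rule ccontr)
        assume "?k j \<noteq> 0"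
        then have *: "nat (?k j) > 0" "?k j = int (nat (?k j))" "nat (?k j) < d"
          unfolding kj using d(1) by (auto simp: nat_less_iff) (smt (verit) pos_mod_sign of_nat_0_less_iff)
        have "\<exists>g\<in>G. g j = int (nat (?k j))" by (rule bexI[where x = ?k, OF _ k(1)]) (rule *(2))
        then show False using d(3)[OF *(3)] *(1) by simp
      qed
      then have "\<kappa> ?k = (\<Prod>j\<in>J. w j powi ?k j)" using k(1) by (intro w(2)) auto
      also have "\<dots> = (\<Prod>j\<in>J. w j powi h j / (w j powi g0 j) powi m)"
        using w(1) by (intro prod.cong refl) (simp add: power_int_diff power_int_mult[symmetric] mult.commute)
      also have "\<dots> = (\<Prod>j\<in>J. w j powi h j) / P powi m"
        by (simp add: prod_dividef P_def prod_powi)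
      finally have kk: "\<kappa> ?k = (\<Prod>j\<in>J. w j powi h j) / P powi m" .
      have "\<kappa> h = \<kappa> ?l * \<kappa> ?k" using k(2) insert.prems(5)[OF l(1)] by simp
      also have "\<dots> = \<kappa> g0 powi m * ((\<Prod>j\<in>J. w j powi h j) / P powi m)"
        by (simp only: l(2) kk)
      also have "\<dots> = (\<kappa> g0 / P) powi m * (\<Prod>j\<in>J. w j powi h j)"
        by (simp add: power_int_divide_distrib)
      also have "(\<kappa> g0 / P) powi m = \<zeta> powi h j"
      proof -
        have "h j = int d * m" using \<open>?k j = 0\<close> g0(2) by (simp add: mult.commute)
        then show ?thesis by (simp add: \<zeta>[symmetric] power_int_mult)
      qed
      also have "\<zeta> powi h j * (\<Prod>j\<in>J. w j powi h j) = (\<Prod>j\<in>insert j J. w' j powi h j)"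
        using insert.hyps w'J by (simp add: w'_def)
      finally show ?thesis .
    qed
    moreover have "w' i \<noteq> 0" for i using w(1) by (simp add: w'_def \<zeta>_def)
    ultimately show ?thesis by blast
  qed
qed

section \<open>Linear weights\<close>

locale linear_weights =
  fixes \<Lambda> :: "'n::finite \<Rightarrow> complex^'k \<Rightarrow> complex" and I :: "'n set"
  assumes linear: "Vector_Spaces.linear (*s) (*) (\<Lambda> j)"
begin

lemma weight_simps [simp]:
  "\<Lambda> j (s + t) = \<Lambda> j s + \<Lambda> j t" "\<Lambda> j (s - t) = \<Lambda> j s - \<Lambda> j t" "\<Lambda> j (- t) = - \<Lambda> j t"
  "\<Lambda> j 0 = 0" "\<Lambda> j (c *s t) = c * \<Lambda> j t"
proof -
  interpret Vector_Spaces.linear "(*s)" "(*)" "\<Lambda> j" by (rule linear)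
  show "\<Lambda> j (s + t) = \<Lambda> j s + \<Lambda> j t" "\<Lambda> j (s - t) = \<Lambda> j s - \<Lambda> j t" "\<Lambda> j (- t) = - \<Lambda> j t"
    "\<Lambda> j 0 = 0" "\<Lambda> j (c *s t) = c * \<Lambda> j t"
    by (rule add diff neg zero scale)+
qed

abbreviation "\<nu> \<equiv> nu \<Lambda> I"
abbreviation "V \<equiv> V_set \<Lambda> I"
abbreviation "\<Gamma> \<equiv> Gamma \<Lambda> I"
abbreviation "\<V> \<equiv> V_space \<Lambda> I"
abbreviation "\<L> \<equiv> L_space \<Lambda> I"
abbreviation "\<Q> \<equiv> Q_space \<Lambda> I"
abbreviation "\<E> \<equiv> E_space \<Lambda> I"
abbreviation "sact \<equiv> susp_act \<Lambda> I"
abbreviation "susp \<equiv> susp_class \<Lambda> I"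
abbreviation "\<D> \<equiv> ext_d \<Lambda> I"
abbreviation connection ("\<nabla>") where "connection \<equiv> nabla \<Lambda> I"

lemma nu_simps [simp]:
  "\<nu> \<alpha> (s + t) = \<nu> \<alpha> s + \<nu> \<alpha> t" "\<nu> \<alpha> (s - t) = \<nu> \<alpha> s - \<nu> \<alpha> t"
  "\<nu> \<alpha> (- t) = - \<nu> \<alpha> t" "\<nu> \<alpha> 0 = 0" "\<nu> \<alpha> (c *s t) = c * \<nu> \<alpha> t"
  by (simp_all add: nu_def algebra_simps sum.distrib sum_subtractf sum_negf sum_distrib_left)

lemma nu_add [simp]: "\<nu> (\<alpha> + \<beta>) t = \<nu> \<alpha> t + \<nu> \<beta> t"
  by (simp add: nu_def lookup_add algebra_simps sum.distrib)

lemma nu_zero [simp]: "\<nu> 0 t = 0"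
  by (simp add: nu_def)

abbreviation "S \<equiv> S_monoid \<Lambda> I"
abbreviation "\<A> \<equiv> S_algebra \<Lambda> I"
abbreviation "Q \<equiv> Q_set \<Lambda> I"

lemma in_S_iff: "\<alpha> \<in> S \<longleftrightarrow> keys \<alpha> \<subseteq> - I \<and> (\<forall>t\<in>isotropy \<Lambda> I. \<nu> \<alpha> t = 0)"
  by (simp add: S_monoid_def nu_def)

lemma S_zero [simp]: "0 \<in> S"
  by (simp add: in_S_iff)

lemma S_add: "\<alpha> \<in> S \<Longrightarrow> \<beta> \<in> S \<Longrightarrow> \<alpha> + \<beta> \<in> S"
  using Poly_Mapping.keys_add[of \<alpha> \<beta>] by (auto simp: in_S_iff)

lemma monomial_in_algebra [simp]: "monomial \<alpha> \<in> \<A> \<longleftrightarrow> \<alpha> \<in> S"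
  by (simp add: S_algebra_def monomial_def)

lemma algebra_closed:
  "p \<in> \<A> \<Longrightarrow> q \<in> \<A> \<Longrightarrow> p + q \<in> \<A>" "p \<in> \<A> \<Longrightarrow> q \<in> \<A> \<Longrightarrow> p * q \<in> \<A>" "p \<in> \<A> \<Longrightarrow> scal c p \<in> \<A>" "0 \<in> \<A>" "1 \<in> \<A>"
proof -
  show "p + q \<in> \<A>" if "p \<in> \<A>" "q \<in> \<A>"
    using that Poly_Mapping.keys_add[of p q] by (auto simp: S_algebra_def)
  show "p * q \<in> \<A>" if "p \<in> \<A>" "q \<in> \<A>"
    using that keys_mult[of p q] S_add by (fastforce simp: S_algebra_def)
  show "scal c p \<in> \<A>" if "p \<in> \<A>"
    using that by (auto simp: S_algebra_def in_keys_iff)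
qed (auto simp: S_algebra_def)

lemma algebra_sum_closed: "(\<And>i. i \<in> A \<Longrightarrow> f i \<in> \<A>) \<Longrightarrow> sum f A \<in> \<A>"
  by (induction A rule: infinite_finite_induct) (auto intro: algebra_closed)

text \<open>A point of \<open>Q\<close> is linear, hence determined by its values at monomials. That
  it vanishes at 0 is extracted from the scaling rule with factor 0.\<close>

lemma Q_eval:
  assumes x: "x \<in> Q" and p: "p \<in> \<A>"
  shows "x p = linear_extension (\<lambda>\<alpha>. x (monomial \<alpha>)) p"
proof -
  have keys: "\<alpha> \<in> S" if "\<alpha> \<in> keys p" for \<alpha> using p that by (auto simp: S_algebra_def)
  have x0: "x 0 = 0"
  proof -
    have "x (scal 0 0) = 0 * x 0" using x algebra_closed(4) unfolding Q_set_def by blast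
    moreover have "scal 0 0 = (0 :: 'n regular)" by (rule poly_mapping_eqI) simp
    ultimately show ?thesis by simp
  qed
  have sum: "x (\<Sum>\<alpha>\<in>A. scal (c \<alpha>) (monomial \<alpha>)) = (\<Sum>\<alpha>\<in>A. c \<alpha> * x (monomial \<alpha>))"
    if "finite A" "A \<subseteq> S" for A c
    using that
  proof (induction A rule: finite_induct)
    case (insert \<alpha> A)
    have "(\<Sum>\<alpha>\<in>A. scal (c \<alpha>) (monomial \<alpha>)) \<in> \<A>"
      using insert by (intro algebra_sum_closed algebra_closed) auto
    moreover have "scal (c \<alpha>) (monomial \<alpha>) \<in> \<A>" using insert by (intro algebra_closed) auto
    moreover have "x (scal (c \<alpha>) (monomial \<alpha>)) = c \<alpha> * x (monomial \<alpha>)"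
      using x insert by (auto simp: Q_set_def)
    ultimately show ?case using insert x by (simp add: Q_set_def)
  qed (simp add: x0)
  have "p = (\<Sum>\<alpha>\<in>keys p. scal (lookup p \<alpha>) (monomial \<alpha>))"
    by (rule poly_mapping_eqI)
      (auto simp: lookup_sum lookup_monomial in_keys_iff if_distrib[of "(*) _"] cong: if_cong)
  then have "x p = x (\<Sum>\<alpha>\<in>keys p. scal (lookup p \<alpha>) (monomial \<alpha>))" by simp
  also have "\<dots> = linear_extension (\<lambda>\<alpha>. x (monomial \<alpha>)) p"
    unfolding linear_extension_def by (rule sum) (use keys in auto)
  finally show ?thesis .
qed

lemma Q_eqI:
  assumes "x \<in> Q" "y \<in> Q" "\<And>\<alpha>. \<alpha> \<in> S \<Longrightarrow> x (monomial \<alpha>) = y (monomial \<alpha>)"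
  shows "x = y"
proof (rule extensionalityI)
  show "x p = y p" if p: "p \<in> \<A>" for p
    unfolding Q_eval[OF assms(1) p] Q_eval[OF assms(2) p] linear_extension_def
    using p by (intro sum.cong refl) (auto simp: S_algebra_def assms(3))
qed (use assms in \<open>auto simp: Q_set_def\<close>)

lemma Q_monomial_zero: "x \<in> Q \<Longrightarrow> x (monomial 0) = 1"
  by (simp add: Q_set_def monomial_def)

lemma Q_monomial_add: "x \<in> Q \<Longrightarrow> \<alpha> \<in> S \<Longrightarrow> \<beta> \<in> S \<Longrightarrow> x (monomial (\<alpha> + \<beta>)) = x (monomial \<alpha>) * x (monomial \<beta>)"
proof -
  assume *: "x \<in> Q" "\<alpha> \<in> S" "\<beta> \<in> S"
  have "monomial (\<alpha> + \<beta>) = monomial \<alpha> * monomial \<beta>" by (simp add: monomial_def mult_single)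
  moreover have "x (p * q) = x p * x q" if "p \<in> \<A>" "q \<in> \<A>" for p q using *(1) that by (simp add: Q_set_def)
  ultimately show ?thesis using *(2,3) by simp
qed

text \<open>Inverse to reading off the values at monomials. The restriction to \<open>\<A>\<close>
  matches \<open>Q_set\<close>, whose points are extensional.\<close>

definition character_point :: "('n exponent \<Rightarrow> complex) \<Rightarrow> 'n regular \<Rightarrow> complex" where
  "character_point \<kappa> = (\<lambda>p\<in>\<A>. linear_extension \<kappa> p)"

lemma character_point_in_Q:
  assumes "\<kappa> 0 = 1" "\<And>\<alpha> \<beta>. \<alpha> \<in> S \<Longrightarrow> \<beta> \<in> S \<Longrightarrow> \<kappa> (\<alpha> + \<beta>) = \<kappa> \<alpha> * \<kappa> \<beta>"
  shows "character_point \<kappa> \<in> Q"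
proof -
  have "linear_extension \<kappa> 1 = 1"
    using linear_extension_single[of \<kappa> 0 1] assms(1) by (simp add: single_one)
  moreover have "linear_extension \<kappa> (p * q) = linear_extension \<kappa> p * linear_extension \<kappa> q" if "p \<in> \<A>" "q \<in> \<A>" for p q
    using that assms(2) by (intro linear_extension_mult) (auto simp: S_algebra_def)
  ultimately show ?thesis
    by (simp add: Q_set_def character_point_def algebra_closed linear_extension_add linear_extension_scal)
qed

lemma character_point_monomial: "\<alpha> \<in> S \<Longrightarrow> character_point \<kappa> (monomial \<alpha>) = \<kappa> \<alpha>"
  by (simp add: character_point_def) (simp add: monomial_def)

lemma quotient_map_q_eq:
  "quotient_map_q \<Lambda> I w = character_point (\<lambda>\<alpha>. \<Prod>j\<in>- I. w j ^ lookup \<alpha> j)"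
  by (simp add: quotient_map_q_def character_point_def linear_extension_def)

lemma quotient_map_q_in_Q: "quotient_map_q \<Lambda> I w \<in> Q"
  unfolding quotient_map_q_eq
  by (rule character_point_in_Q) (simp_all add: lookup_add power_add prod.distrib)

lemma quotient_map_q_monomial:
  "\<alpha> \<in> S \<Longrightarrow> quotient_map_q \<Lambda> I w (monomial \<alpha>) = (\<Prod>j\<in>- I. w j ^ lookup \<alpha> j)"
  by (simp add: quotient_map_q_eq character_point_monomial)

text \<open>The monomials not vanishing at \<open>x\<close> are those supported on the union \<open>J\<close> of their supports:
  if \<open>\<alpha>\<close> is supported on \<open>J\<close>, then \<open>\<alpha> + \<beta>\<close> is a multiple of an exponent \<open>\<alpha>0\<close> with full support \<open>J\<close>.
  Extending \<open>x\<close> from the group they generate to \<open>\<int>\<^sup>J\<close> gives the components \<open>w\<^sub>j\<close>, \<open>j \<in> J\<close>; the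
  others vanish.\<close>

theorem quotient_map_q_surj:
  assumes x: "x \<in> Q"
  shows "\<exists>w\<in>normal_coords I. quotient_map_q \<Lambda> I w = x"
proof -
  define \<kappa> where "\<kappa> \<alpha> = x (monomial \<alpha>)" for \<alpha>
  have \<kappa>0: "\<kappa> 0 = 1" and \<kappa>_add: "\<And>\<alpha> \<beta>. \<alpha> \<in> S \<Longrightarrow> \<beta> \<in> S \<Longrightarrow> \<kappa> (\<alpha> + \<beta>) = \<kappa> \<alpha> * \<kappa> \<beta>"
    using Q_monomial_zero[OF x] Q_monomial_add[OF x] by (auto simp: \<kappa>_def)
  define F where "F = {\<alpha> \<in> S. \<kappa> \<alpha> \<noteq> 0}"
  have F0: "0 \<in> F" and F_add: "\<And>\<alpha> \<beta>. \<alpha> \<in> F \<Longrightarrow> \<beta> \<in> F \<Longrightarrow> \<alpha> + \<beta> \<in> F"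
    using \<kappa>0 \<kappa>_add S_add by (auto simp: F_def)
  have F_sum: "sum f A \<in> F" if "\<And>i. i \<in> A \<Longrightarrow> f i \<in> F" for f :: "'b \<Rightarrow> 'n exponent" and A
    using that by (induction A rule: infinite_finite_induct) (auto intro: F0 F_add)
  define J where "J = (\<Union>\<alpha>\<in>F. keys \<alpha>)"
  have JI: "J \<subseteq> - I" by (auto simp: J_def F_def in_S_iff)
  have "\<forall>j\<in>J. \<exists>\<alpha>\<in>F. lookup \<alpha> j \<noteq> 0" by (auto simp: J_def in_keys_iff)
  then obtain f where f: "\<And>j. j \<in> J \<Longrightarrow> f j \<in> F" "\<And>j. j \<in> J \<Longrightarrow> lookup (f j) j \<noteq> 0"
    by metis
  define \<alpha>0 where "\<alpha>0 = (\<Sum>j\<in>J. f j)"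
  have \<alpha>0: "\<alpha>0 \<in> F" unfolding \<alpha>0_def by (rule F_sum) (rule f)
  have \<alpha>0_pos: "lookup \<alpha>0 j > 0" if "j \<in> J" for j
  proof -
    have "lookup (f j) j \<le> (\<Sum>i\<in>J. lookup (f i) j)"
      using that by (intro member_le_sum) auto
    then show ?thesis using f(2)[OF that] by (simp add: \<alpha>0_def lookup_sum)
  qed
  have face: "\<alpha> \<in> F" if \<alpha>: "\<alpha> \<in> S" "keys \<alpha> \<subseteq> J" for \<alpha>
  proof -
    \<comment> \<open>The total degree bounds every entry of \<alpha>, and \<open>\<alpha>0\<close>
      is at least 1 on \<open>J\<close>, so \<open>N\<close> copies of \<open>\<alpha>0\<close>
      dominate \<alpha>.\<close>
    define N where "N = (\<Sum>j\<in>UNIV. lookup \<alpha> j)"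
    define \<gamma> where "\<gamma> = (\<Sum>i\<in>{..<N}. \<alpha>0)"
    define \<beta> where "\<beta> = \<gamma> - \<alpha>"
    have \<gamma>: "\<gamma> \<in> F" unfolding \<gamma>_def by (rule F_sum) (rule \<alpha>0)
    have le: "lookup \<alpha> j \<le> lookup \<gamma> j" for j
    proof (cases "j \<in> J")
      case True
      have "lookup \<alpha> j \<le> N * 1" unfolding N_def by (simp add: member_le_sum)
      also have "\<dots> \<le> N * lookup \<alpha>0 j" using \<alpha>0_pos[OF True] by (intro mult_left_mono) auto
      finally show ?thesis by (simp add: \<gamma>_def lookup_sum)
    next
      case False
      then have "lookup \<alpha> j = 0" using \<alpha>(2) by (auto simp: in_keys_iff)
      then show ?thesis by simp
    qed
    have sum: "\<alpha> + \<beta> = \<gamma>"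
      by (rule poly_mapping_eqI) (simp add: \<beta>_def lookup_add lookup_minus le)
    have "keys \<beta> \<subseteq> keys \<gamma>" by (auto simp: \<beta>_def in_keys_iff lookup_minus)
    \<comment> \<open>By additivity of \<nu>, \<beta> inherits the vanishing on the isotropy from
      \<gamma> and \<alpha>.\<close>
    moreover have "\<nu> \<beta> t = 0" if "t \<in> isotropy \<Lambda> I" for t
      using nu_add[of \<alpha> \<beta> t] \<alpha>(1) \<gamma> that unfolding sum by (auto simp: F_def in_S_iff)
    ultimately have "\<beta> \<in> S" using \<gamma> by (auto simp: F_def in_S_iff)
    then have "\<kappa> \<alpha> * \<kappa> \<beta> \<noteq> 0" using \<kappa>_add[OF \<alpha>(1)] sum \<gamma> by (auto simp: F_def)
    then show ?thesis using \<alpha>(1) by (auto simp: F_def)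
  qed
  define diff :: "'n exponent \<Rightarrow> 'n exponent \<Rightarrow> 'n \<Rightarrow> int" where
    "diff \<alpha> \<beta> = (\<lambda>j. int (lookup \<alpha> j) - int (lookup \<beta> j))" for \<alpha> \<beta>
  define G where "G = {diff \<alpha> \<beta> | \<alpha> \<beta>. \<alpha> \<in> F \<and> \<beta> \<in> F}"
  \<comment> \<open>The same difference has many presentations; the choice is justified by the next
    fact.\<close>
  define \<psi> where "\<psi> g = (SOME c. \<exists>\<alpha>\<in>F. \<exists>\<beta>\<in>F. g = diff \<alpha> \<beta> \<and> c = \<kappa> \<alpha> / \<kappa> \<beta>)" for g
  have \<psi>: "\<psi> (diff \<alpha> \<beta>) = \<kappa> \<alpha> / \<kappa> \<beta>" if "\<alpha> \<in> F" "\<beta> \<in> F" for \<alpha> \<beta>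
  proof -
    have "\<exists>\<alpha>'\<in>F. \<exists>\<beta>'\<in>F. diff \<alpha> \<beta> = diff \<alpha>' \<beta>' \<and> \<psi> (diff \<alpha> \<beta>) = \<kappa> \<alpha>' / \<kappa> \<beta>'"
      unfolding \<psi>_def by (rule someI_ex) (use that in blast)
    then obtain \<alpha>' \<beta>' where *: "\<alpha>' \<in> F" "\<beta>' \<in> F" "diff \<alpha> \<beta> = diff \<alpha>' \<beta>'" "\<psi> (diff \<alpha> \<beta>) = \<kappa> \<alpha>' / \<kappa> \<beta>'"
      by blast
    \<comment> \<open>Equal differences give equal cross sums, which multiplicativity of \<kappa>
      turns into equal quotients.\<close>
    have "\<alpha> + \<beta>' = \<alpha>' + \<beta>"
      using *(3) by (intro poly_mapping_eqI) (simp add: diff_def lookup_add fun_eq_iff, smt (verit) of_nat_add of_nat_eq_iff)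
    then have "\<kappa> \<alpha> * \<kappa> \<beta>' = \<kappa> \<alpha>' * \<kappa> \<beta>"
      using \<kappa>_add that *(1,2) by (metis (mono_tags, lifting) F_def mem_Collect_eq)
    moreover have "\<kappa> \<beta> \<noteq> 0" "\<kappa> \<beta>' \<noteq> 0" using that * by (auto simp: F_def)
    ultimately have "\<kappa> \<alpha> / \<kappa> \<beta> = \<kappa> \<alpha>' / \<kappa> \<beta>'" by (simp add: frac_eq_eq)
    then show ?thesis using *(4) by simp
  qed
  have diff_diff: "(\<lambda>j. diff \<alpha> \<beta> j - diff \<alpha>' \<beta>' j) = diff (\<alpha> + \<beta>') (\<beta> + \<alpha>')" for \<alpha> \<beta> \<alpha>' \<beta>'
    by (auto simp: diff_def fun_eq_iff lookup_add)
  have "\<exists>w. (\<forall>j. w j \<noteq> 0) \<and> (\<forall>g\<in>G. \<psi> g = (\<Prod>j\<in>J. w j powi g j))"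
  proof (rule lattice_character)
    show "finite J" by simp
    show "g j = 0" if "g \<in> G" "j \<notin> J" for g j
      using that by (auto simp: G_def J_def diff_def in_keys_iff)
    have "diff 0 0 = (\<lambda>_. 0)" by (auto simp: diff_def)
    then show "(\<lambda>_. 0) \<in> G" using F0 unfolding G_def by force
    show "(\<lambda>j. g j - h j) \<in> G" if "g \<in> G" "h \<in> G" for g h
      using that F_add unfolding G_def by (auto simp: diff_diff) blast
    show "\<psi> (\<lambda>j. g j - h j) = \<psi> g / \<psi> h" if gh: "g \<in> G" "h \<in> G" for g h
    proof -
      obtain \<alpha> \<beta> where 1: "\<alpha> \<in> F" "\<beta> \<in> F" "g = diff \<alpha> \<beta>" using gh(1) unfolding G_def by blast
      obtain \<alpha>' \<beta>' where "\<alpha>' \<in> F" "\<beta>' \<in> F" "h = diff \<alpha>' \<beta>'" using gh(2) unfolding G_def by blast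
      with 1 show ?thesis using F_add \<kappa>_add by (simp add: diff_diff \<psi>) (simp add: F_def)
    qed
    show "\<psi> g \<noteq> 0" if "g \<in> G" for g
      using that by (auto simp: G_def \<psi>) (auto simp: F_def)
  qed
  then obtain w where w: "\<And>j. w j \<noteq> 0" "\<And>g. g \<in> G \<Longrightarrow> \<psi> g = (\<Prod>j\<in>J. w j powi g j)" by blast
  define w' where "w' = (\<lambda>j\<in>- I. if j \<in> J then w j else 0)"
  have "\<kappa> \<alpha> = (\<Prod>j\<in>- I. w' j ^ lookup \<alpha> j)" if \<alpha>: "\<alpha> \<in> S" for \<alpha>
  proof (cases "keys \<alpha> \<subseteq> J")
    case True
    have "\<kappa> \<alpha> = \<psi> (diff \<alpha> 0)" using \<psi>[OF face[OF \<alpha> True] F0] \<kappa>0 by simp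
    also have "\<dots> = (\<Prod>j\<in>J. w j powi diff \<alpha> 0 j)"
      by (rule w(2)) (use face[OF \<alpha> True] F0 in \<open>auto simp: G_def\<close>)
    also have "\<dots> = (\<Prod>j\<in>J. w' j ^ lookup \<alpha> j)"
      using JI by (intro prod.cong refl) (auto simp: diff_def w'_def)
    also have "\<dots> = (\<Prod>j\<in>- I. w' j ^ lookup \<alpha> j)"
    proof (rule prod.mono_neutral_left)
      have "lookup \<alpha> j = 0" if "j \<notin> J" for j using True that by (auto simp: in_keys_iff)
      then show "\<forall>j\<in>- I - J. w' j ^ lookup \<alpha> j = 1" by simp
    qed (use JI in auto)
    finally show ?thesis .
  next
    case False
    \<comment> \<open>An entry outside \<open>J\<close> excludes \<alpha> from \<open>F\<close>, so
      the left side is 0; on the right the factor with \<open>w' j = 0\<close> has positive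
      exponent.\<close>
    then obtain j where j: "j \<in> keys \<alpha>" "j \<notin> J" by blast
    then have "\<kappa> \<alpha> = 0" using \<alpha> by (auto simp: J_def F_def)
    moreover have "j \<in> - I" using j \<alpha> by (auto simp: in_S_iff)
    moreover have "w' j ^ lookup \<alpha> j = 0" using j \<open>j \<in> - I\<close> by (simp add: w'_def in_keys_iff)
    ultimately show ?thesis by (metis finite prod_zero)
  qed
  then have "quotient_map_q \<Lambda> I w' = x"
    by (intro Q_eqI[OF quotient_map_q_in_Q x]) (simp add: quotient_map_q_monomial \<kappa>_def)
  moreover have "w' \<in> normal_coords I" by (auto simp: w'_def normal_coords_def)
  ultimately show ?thesis by blast
qed

end

text \<open>An action is a homomorphism into a group of extensional bijections, whose product is
  composition restricted to \<open>E\<close>; extensionality reduces the homomorphism law to points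
  of \<open>E\<close>.\<close>

lemma group_actionI:
  assumes "group G" "\<And>g. g \<in> carrier G \<Longrightarrow> \<phi> g \<in> Bij E"
    "\<And>g h x. g \<in> carrier G \<Longrightarrow> h \<in> carrier G \<Longrightarrow> x \<in> E \<Longrightarrow> \<phi> (g \<otimes>\<^bsub>G\<^esub> h) x = \<phi> g (\<phi> h x)"
  shows "group_action G E \<phi>"
  unfolding group_action_def group_hom_def group_hom_axioms_def
proof (intro conjI assms(1) group_BijGroup homI)
  fix g h assume gh: "g \<in> carrier G" "h \<in> carrier G"
  show "\<phi> (g \<otimes>\<^bsub>G\<^esub> h) = \<phi> g \<otimes>\<^bsub>BijGroup E\<^esub> \<phi> h"
  proof (rule extensionalityI[of _ E])
    have "g \<otimes>\<^bsub>G\<^esub> h \<in> carrier G" using gh assms(1) by (simp add: group.is_monoid monoid.m_closed)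
    then show "\<phi> (g \<otimes>\<^bsub>G\<^esub> h) \<in> extensional E" using assms(2) by (auto simp: Bij_def)
    show "\<phi> g \<otimes>\<^bsub>BijGroup E\<^esub> \<phi> h \<in> extensional E"
      using assms(2) gh by (simp add: BijGroup_def compose_def)
    show "\<phi> (g \<otimes>\<^bsub>G\<^esub> h) x = (\<phi> g \<otimes>\<^bsub>BijGroup E\<^esub> \<phi> h) x" if "x \<in> E" for x
      using assms(2,3) gh that by (simp add: BijGroup_def compose_def)
  qed
qed (simp add: BijGroup_def assms(2))

lemma (in function_sheaf) holomorphic_map_on_affine:
  fixes f :: "'a \<Rightarrow> complex^'m"
  assumes "openin (ctop X) W" "\<And>a. (\<lambda>x. f x $ a) \<in> hol X W"
  shows "holomorphic_map_on X W affine_space f"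
  by (rule holomorphic_map_on_coordinate) (use assms in auto)

text \<open>At a point of \<open>Q\<close> a regular function takes a finite linear combination of
  the values of monomials, which reduces the test to monomials.\<close>

lemma (in function_sheaf) holomorphic_map_on_Q:
  fixes \<Lambda> :: "'m::finite \<Rightarrow> complex^'k \<Rightarrow> complex"
  assumes lw: "linear_weights \<Lambda>" and W: "openin (ctop X) W" and sub: "f ` W \<subseteq> Q_set \<Lambda> I"
    and hol: "\<And>\<alpha>. \<alpha> \<in> S_monoid \<Lambda> I \<Longrightarrow> (\<lambda>x. f x (monomial \<alpha>)) \<in> hol X W"
  shows "holomorphic_map_on X W (Q_space \<Lambda> I) f"
  unfolding Q_space_def
proof (rule holomorphic_map_on_coordinate[OF W sub])
  interpret linear_weights \<Lambda> I by (rule lw)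
  fix \<phi> :: "('m regular \<Rightarrow> complex) \<Rightarrow> complex" assume "\<phi> \<in> (\<lambda>p x. x p) ` S_algebra \<Lambda> I"
  then obtain p where p: "p \<in> S_algebra \<Lambda> I" "\<phi> = (\<lambda>x. x p)" by blast
  have "(\<lambda>x. linear_extension (\<lambda>\<alpha>. f x (monomial \<alpha>)) p) \<in> hol X W"
    unfolding linear_extension_def using p
    by (intro hol_sum hol_mult hol_const hol W) (auto simp: S_algebra_def)
  then show "(\<lambda>x. \<phi> (f x)) \<in> hol X W"
    by (rule hol_cong) (use p Q_eval[OF _ p(1)] sub in auto)
qed

section \<open>Cosets of the isotropy, periods and points of the leaf\<close>

context linear_weights
begin

abbreviation "H \<equiv> isotropy \<Lambda> I"
abbreviation "K \<equiv> period_group \<Lambda> I"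
abbreviation "coset \<equiv> hcoset \<Lambda> I"
abbreviation "leaf \<equiv> leaf_point \<Lambda> I"

lemma isotropy_closed [simp]:
  "0 \<in> H" "s \<in> H \<Longrightarrow> t \<in> H \<Longrightarrow> s + t \<in> H" "s \<in> H \<Longrightarrow> t \<in> H \<Longrightarrow> s - t \<in> H"
  "- t \<in> H \<longleftrightarrow> t \<in> H" "t \<in> H \<Longrightarrow> c *s t \<in> H"
  by (auto simp: isotropy_def)

lemma isotropy_subset_period: "H \<subseteq> K"
  by (auto simp: isotropy_def period_group_def intro: exI[of _ 0])

lemma period_closed [simp]:
  "0 \<in> K" "s \<in> K \<Longrightarrow> t \<in> K \<Longrightarrow> s + t \<in> K" "s \<in> K \<Longrightarrow> t \<in> K \<Longrightarrow> s - t \<in> K" "t \<in> K \<Longrightarrow> - t \<in> K"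
proof -
  show 0: "0 \<in> K" by (auto simp: period_group_def intro: exI[of _ 0])
  show diff: "s - t \<in> K" if st: "s \<in> K" "t \<in> K" for s t
    unfolding period_group_def
  proof (intro CollectI ballI)
    fix i assume "i \<in> I"
    then obtain m n :: int where "\<Lambda> i s = 2 * of_real pi * \<i> * of_int m" "\<Lambda> i t = 2 * of_real pi * \<i> * of_int n"
      using st unfolding period_group_def by blast
    then show "\<exists>m::int. \<Lambda> i (s - t) = 2 * of_real pi * \<i> * of_int m"
      by (intro exI[of _ "m - n"]) (simp add: algebra_simps)
  qed
  show "- t \<in> K" if "t \<in> K" for t using diff[OF 0 that] by simp
  then show "s + t \<in> K" if "s \<in> K" "t \<in> K" using diff[OF that(1), of "- t"] that by simp
qed

lemma mem_hcoset: "u \<in> coset t \<longleftrightarrow> u - t \<in> H"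
  by (auto simp: hcoset_def elt_set_plus_def intro: bexI[of _ "u - t"])

lemma hcoset_eq_iff: "coset s = coset t \<longleftrightarrow> s - t \<in> H"
proof
  assume "coset s = coset t"
  then show "s - t \<in> H" using mem_hcoset[of s s] mem_hcoset[of s t] by simp
next
  assume st: "s - t \<in> H"
  have "u - s \<in> H \<longleftrightarrow> u - t \<in> H" for u
    using isotropy_closed(2)[OF _ st, of "u - s"] isotropy_closed(3)[OF _ st, of "u - t"] by auto
  then show "coset s = coset t" by (auto simp: mem_hcoset)
qed

lemma hcoset_add [simp]: "coset s + coset t = coset (s + t)"
proof -
  have "H + H = H"
  proof
    show "H + H \<subseteq> H" by (auto elim!: set_plus_elim)
    show "H \<subseteq> H + H" by (rule set_zero_plus2) simp
  qed
  then show ?thesis by (simp add: hcoset_def set_plus_rearrange)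
qed

lemma leaf_point_conv: "leaf t = (\<lambda>p. coset (t + p)) ` K"
  by (auto simp: leaf_point_def elt_set_plus_def Gamma_def)

lemma hcoset_plus_Gamma: "coset t +o \<Gamma> = leaf t"
  by (simp add: leaf_point_def)

lemma hcoset_in_leaf: "coset s \<in> leaf t \<longleftrightarrow> s - t \<in> K"
proof
  assume "coset s \<in> leaf t"
  then obtain p where p: "p \<in> K" "s - (t + p) \<in> H" by (auto simp: leaf_point_conv hcoset_eq_iff)
  then have "(s - (t + p)) + p \<in> K" using isotropy_subset_period by (intro period_closed(2)) auto
  then show "s - t \<in> K" by (simp add: algebra_simps)
qed (auto simp: leaf_point_conv intro: image_eqI[of _ _ "s - t"])

lemma leaf_point_eq_iff: "leaf s = leaf t \<longleftrightarrow> s - t \<in> K"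
proof
  assume "leaf s = leaf t"
  then show "s - t \<in> K" using hcoset_in_leaf[of s s] hcoset_in_leaf[of s t] by simp
next
  assume st: "s - t \<in> K"
  have "u - s \<in> K \<longleftrightarrow> u - t \<in> K" for u
    using period_closed(2)[OF _ st, of "u - s"] period_closed(3)[OF _ st, of "u - t"] by auto
  then have "coset u \<in> leaf s \<longleftrightarrow> coset u \<in> leaf t" for u by (simp add: hcoset_in_leaf)
  then show "leaf s = leaf t" by (auto simp: leaf_point_conv)
qed

lemma hcoset_plus_leaf: "coset s +o leaf t = leaf (s + t)"
  by (simp add: leaf_point_def set_plus_rearrange2)

lemma mem_Union_leaf: "u \<in> \<Union>(leaf t) \<longleftrightarrow> u - t \<in> K"
proof
  assume "u \<in> \<Union>(leaf t)"
  then obtain p where p: "p \<in> K" "u - (t + p) \<in> H" by (auto simp: leaf_point_conv mem_hcoset)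
  then have "(u - (t + p)) + p \<in> K" using isotropy_subset_period by (intro period_closed(2)) auto
  then show "u - t \<in> K" by (simp add: algebra_simps)
next
  assume "u - t \<in> K"
  then have "coset u \<in> leaf t" by (simp add: hcoset_in_leaf)
  moreover have "u \<in> coset u" by (simp add: mem_hcoset)
  ultimately show "u \<in> \<Union>(leaf t)" by blast
qed

lemma group_V_group: "group (V_group \<Lambda> I)"
proof (rule groupI)
  fix x assume "x \<in> carrier (V_group \<Lambda> I)"
  then obtain t where "x = coset t" by (auto simp: V_group_def V_set_def)
  then show "\<exists>y\<in>carrier (V_group \<Lambda> I). y \<otimes>\<^bsub>V_group \<Lambda> I\<^esub> x = \<one>\<^bsub>V_group \<Lambda> I\<^esub>"
    by (intro bexI[of _ "coset (- t)"]) (auto simp: V_group_def V_set_def)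
qed (auto simp: V_group_def V_set_def add.assoc)

lemma group_Gamma_group: "group (Gamma_group \<Lambda> I)"
proof (rule groupI)
  fix x assume "x \<in> carrier (Gamma_group \<Lambda> I)"
  then obtain t where "t \<in> K" "x = coset t" by (auto simp: Gamma_group_def Gamma_def)
  then show "\<exists>y\<in>carrier (Gamma_group \<Lambda> I). y \<otimes>\<^bsub>Gamma_group \<Lambda> I\<^esub> x = \<one>\<^bsub>Gamma_group \<Lambda> I\<^esub>"
    by (intro bexI[of _ "coset (- t)"]) (auto simp: Gamma_group_def Gamma_def)
qed (auto simp: Gamma_group_def Gamma_def add.assoc)

section \<open>The explicit transport and the actions tau and rho\<close>

definition transport :: "complex^'k \<Rightarrow> ('n regular \<Rightarrow> complex) \<Rightarrow> 'n regular \<Rightarrow> complex" where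
  "transport t = (\<lambda>x\<in>Q. character_point (\<lambda>\<alpha>. exp (\<nu> \<alpha> t) * x (monomial \<alpha>)))"

lemma transport_in_Q: "x \<in> Q \<Longrightarrow> transport t x \<in> Q"
  unfolding transport_def
  by (simp, rule character_point_in_Q) (simp_all add: Q_monomial_zero Q_monomial_add exp_add)

lemma transport_monomial: "x \<in> Q \<Longrightarrow> \<alpha> \<in> S \<Longrightarrow> transport t x (monomial \<alpha>) = exp (\<nu> \<alpha> t) * x (monomial \<alpha>)"
  by (simp add: transport_def character_point_monomial)

lemma transport_extensional: "transport t \<in> extensional Q"
  by (simp add: transport_def)

lemma transport_transport: "x \<in> Q \<Longrightarrow> transport s (transport t x) = transport (s + t) x"
  by (intro Q_eqI) (auto simp: transport_in_Q transport_monomial exp_add mult_ac)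

lemma transport_zero: "x \<in> Q \<Longrightarrow> transport 0 x = x"
  by (intro Q_eqI) (auto simp: transport_in_Q transport_monomial)

lemma transport_minus: "x \<in> Q \<Longrightarrow> transport t (transport (- t) x) = x" "x \<in> Q \<Longrightarrow> transport (- t) (transport t x) = x"
  by (simp_all add: transport_transport transport_zero)

lemma nu_isotropy_cong: "\<alpha> \<in> S \<Longrightarrow> s - t \<in> H \<Longrightarrow> \<nu> \<alpha> s = \<nu> \<alpha> t"
  using nu_simps(2)[of \<alpha> s t] by (auto simp: in_S_iff)

lemma transport_cong:
  assumes "s - t \<in> H" shows "transport s = transport t"
proof (rule extensionalityI[OF transport_extensional transport_extensional])
  fix x assume "x \<in> Q"
  then show "transport s x = transport t x"
    using assms by (intro Q_eqI) (auto simp: transport_in_Q transport_monomial nu_isotropy_cong)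
qed

lemma transport_Bij: "transport t \<in> Bij Q"
proof -
  have "bij_betw (transport t) Q Q"
    by (rule bij_betw_byWitness[where f' = "transport (- t)"]) (auto simp: transport_minus transport_in_Q)
  then show ?thesis by (simp add: Bij_def transport_extensional)
qed

lemma quotient_map_q_normal_act:
  "quotient_map_q \<Lambda> I (normal_act \<Lambda> I t w) = transport t (quotient_map_q \<Lambda> I w)"
proof (rule Q_eqI)
  fix \<alpha> assume \<alpha>: "\<alpha> \<in> S"
  have "(\<Prod>j\<in>- I. exp (\<Lambda> j t) ^ lookup \<alpha> j) = exp (\<nu> \<alpha> t)"
    by (simp add: nu_def exp_sum exp_of_nat_mult)
  then show "quotient_map_q \<Lambda> I (normal_act \<Lambda> I t w) (monomial \<alpha>) = transport t (quotient_map_q \<Lambda> I w) (monomial \<alpha>)"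
    using \<alpha> by (simp add: quotient_map_q_monomial transport_monomial quotient_map_q_in_Q normal_act_def
        power_mult_distrib prod.distrib)
qed (auto simp: quotient_map_q_in_Q transport_in_Q)

lemma induced_transport_iff: "induced_transport \<Lambda> I t \<sigma> \<longleftrightarrow> \<sigma> = transport t"
proof
  assume \<sigma>: "induced_transport \<Lambda> I t \<sigma>"
  show "\<sigma> = transport t"
  proof (rule extensionalityI[OF _ transport_extensional])
    show "\<sigma> \<in> extensional Q" using \<sigma> by (simp add: induced_transport_def PiE_def)
    fix x assume "x \<in> Q"
    then obtain w where "w \<in> normal_coords I" "quotient_map_q \<Lambda> I w = x" using quotient_map_q_surj by blast
    then show "\<sigma> x = transport t x"
      using \<sigma> quotient_map_q_normal_act[of t w] by (simp add: induced_transport_def)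
  qed
next
  assume "\<sigma> = transport t"
  then show "induced_transport \<Lambda> I t \<sigma>"
    by (auto simp: induced_transport_def quotient_map_q_normal_act PiE_def transport_in_Q transport_extensional)
qed

text \<open>All members of a coset induce the same transport, so the definite description in
  \<open>tau\<close> has exactly one solution.\<close>

lemma tau_hcoset [simp]: "tau \<Lambda> I (coset t) = transport t"
  unfolding tau_def
proof (rule the_equality)
  show "\<exists>s\<in>coset t. induced_transport \<Lambda> I s (transport t)"
    by (intro bexI[of _ t]) (auto simp: induced_transport_iff mem_hcoset)
qed (auto simp: induced_transport_iff mem_hcoset intro: transport_cong)

lemma rho_hcoset: "p \<in> K \<Longrightarrow> rho \<Lambda> I (coset p) = transport p"
  by (simp add: rho_def Gamma_def)

lemma group_action_tau: "group_action (V_group \<Lambda> I) Q (tau \<Lambda> I)"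
  by (rule group_actionI[OF group_V_group]) (auto simp: V_group_def V_set_def transport_Bij transport_transport)

lemma group_action_rho: "group_action (Gamma_group \<Lambda> I) Q (rho \<Lambda> I)"
proof (rule group_actionI[OF group_Gamma_group])
  fix g h x assume "g \<in> carrier (Gamma_group \<Lambda> I)" "h \<in> carrier (Gamma_group \<Lambda> I)" "x \<in> Q"
  then show "rho \<Lambda> I (g \<otimes>\<^bsub>Gamma_group \<Lambda> I\<^esub> h) x = rho \<Lambda> I g (rho \<Lambda> I h x)"
    by (auto simp: Gamma_group_def Gamma_def rho_hcoset transport_transport)
qed (auto simp: Gamma_group_def Gamma_def rho_hcoset transport_Bij)

section \<open>The action on orbits and transversals\<close>

lemma support_act: "support (act \<Lambda> t p) = support p"
  by (auto simp: support_def act_def)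

lemma act_normal_point:
  "act \<Lambda> t (normal_point I p w) = normal_point I (act \<Lambda> t p) (normal_act \<Lambda> I t w)"
  by (auto simp: act_def normal_point_def normal_act_def vec_eq_iff)

lemma exp_weights_eq_iff: "(\<forall>i\<in>I. exp (\<Lambda> i s) = exp (\<Lambda> i t)) \<longleftrightarrow> leaf s = leaf t"
  unfolding leaf_point_eq_iff period_group_def exp_eq by (simp add: algebra_simps)

text \<open>Coordinates outside \<open>I\<close> vanish and those in \<open>I\<close> can be
  cancelled, which leaves the equality of the exponentials of the weights.\<close>

lemma act_eq_iff:
  assumes "support p = I"
  shows "act \<Lambda> s p = act \<Lambda> t p \<longleftrightarrow> leaf s = leaf t"
  unfolding exp_weights_eq_iff[symmetric] using assms by (auto simp: act_def vec_eq_iff support_def)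

section \<open>Analytic structure of the leaf and of the toric factor\<close>

lemma function_sheaf_affine: "function_sheaf (affine_space :: (complex^'k) cspace)"
  by (rule function_sheaf_coordinate)

lemma function_sheaf_V: "function_sheaf \<V>"
  unfolding V_space_def by (rule function_sheaf_quotient[OF function_sheaf_affine])

lemma function_sheaf_L: "function_sheaf \<L>"
  unfolding L_space_def by (rule function_sheaf_quotient[OF function_sheaf_V])

lemma function_sheaf_Q: "function_sheaf \<Q>"
  unfolding Q_space_def by (rule function_sheaf_coordinate)

sublocale affines: function_sheaf "affine_space :: (complex^'k) cspace" by (rule function_sheaf_affine)
sublocale Vs: function_sheaf \<V> by (rule function_sheaf_V)
sublocale Ls: function_sheaf \<L> by (rule function_sheaf_L)
sublocale Qs: function_sheaf \<Q> by (rule function_sheaf_Q)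

lemmas sheaves = function_sheaf_affine function_sheaf_V function_sheaf_L function_sheaf_Q
  function_sheaf_product

lemma points_V [simp]: "points \<V> = V"
  by (simp add: V_space_def V_set_def)

lemma points_L [simp]: "points \<L> = range leaf"
  by (simp add: L_space_def V_set_def image_image hcoset_plus_Gamma)

lemma points_Q [simp]: "points \<Q> = Q"
  by (simp add: Q_space_def)

lemma openin_L: "openin (ctop \<L>) W \<longleftrightarrow> W \<subseteq> range leaf \<and> open {t. leaf t \<in> W}"
  unfolding L_space_def openin_quotient_space V_space_def points_quotient_space
  by (auto simp: openin_affine_space image_image hcoset_plus_Gamma)

text \<open>Openness and holomorphy are pulled back through both quotient maps, so calculus on the
  leaf becomes calculus on the affine space.\<close>

lemma hol_L: "f \<in> hol \<L> W \<longleftrightarrow> openin (ctop \<L>) W \<and>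
    (\<forall>t. leaf t \<in> W \<longrightarrow> cdiff_at (\<lambda>t. f (leaf t)) t)"
proof -
  have *: "{x \<in> points affine_space. coset x \<in> {x \<in> points (quotient_space affine_space coset). x +o \<Gamma> \<in> W}} = {t. leaf t \<in> W}"
    by (auto simp: hcoset_plus_Gamma)
  show ?thesis
    unfolding openin_L L_space_def hol_quotient_space V_space_def * hcoset_plus_Gamma hol_affine_space
    unfolding openin_quotient_space
    by (auto simp: openin_affine_space image_image hcoset_plus_Gamma)
qed

lemma holomorphic_hcoset: "holomorphic_map_on affine_space UNIV \<V> coset"
  using holomorphic_quotient_map[of affine_space coset] by (simp add: V_space_def)

lemma holomorphic_V_to_L: "holomorphic_map_on \<V> V \<L> (\<lambda>v. v +o \<Gamma>)"
  using holomorphic_quotient_map[of "\<V>"] by (simp add: L_space_def)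

lemma holomorphic_leaf: "holomorphic_map_on affine_space UNIV \<L> leaf"
  using holomorphic_map_on_compose[OF holomorphic_hcoset holomorphic_V_to_L]
  by (auto simp: V_set_def hcoset_plus_Gamma)

lemma holomorphic_from_V:
  assumes "openin (ctop \<V>) W" "holomorphic_map_on affine_space {t. coset t \<in> W} Y (\<lambda>t. f (coset t))"
  shows "holomorphic_map_on \<V> W Y f"
  using assms unfolding V_space_def by (intro holomorphic_map_on_from_quotient) auto

lemma holomorphic_from_L:
  assumes W: "openin (ctop \<L>) W" and f: "holomorphic_map_on affine_space {t. leaf t \<in> W} Y (\<lambda>t. f (leaf t))"
  shows "holomorphic_map_on \<L> W Y f"
proof -
  let ?W = "{v \<in> points \<V>. v +o \<Gamma> \<in> W}"
  have "openin (ctop \<V>) ?W" using W unfolding L_space_def openin_quotient_space by blast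
  then have "holomorphic_map_on \<V> ?W Y (\<lambda>v. f (v +o \<Gamma>))"
    using f by (intro holomorphic_from_V) (auto simp: V_set_def hcoset_plus_Gamma)
  then show ?thesis using W unfolding L_space_def by (intro holomorphic_map_on_from_quotient) auto
qed

text \<open>A linear form is a combination of the coordinates, which exhibits the coefficients that
  \<open>cdiff_at\<close> asks for.\<close>

lemma cdiff_at_weight: "cdiff_at (\<Lambda> j) t" and bounded_linear_weight: "bounded_linear (\<Lambda> j)"
proof -
  have "\<Lambda> j h = (\<Sum>a\<in>UNIV. \<Lambda> j (axis a 1) * h $ a)" for h
  proof -
    interpret Vector_Spaces.linear "(*s)" "(*)" "\<Lambda> j" by (rule linear)
    have "\<Lambda> j h = \<Lambda> j (\<Sum>a\<in>UNIV. h $ a *s axis a 1)" by (simp only: basis_expansion)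
    then show ?thesis by (simp add: sum scale mult.commute)
  qed
  then have eq: "\<Lambda> j = (\<lambda>h. \<Sum>a\<in>UNIV. \<Lambda> j (axis a 1) * h $ a)" by blast
  show "bounded_linear (\<Lambda> j)"
    by (subst eq) (intro bounded_linear_sum bounded_linear_const_mult bounded_linear_vec_nth)
  then have "(\<Lambda> j has_derivative (\<lambda>h. \<Sum>a\<in>UNIV. \<Lambda> j (axis a 1) * h $ a)) (at t)"
    using bounded_linear_imp_has_derivative eq by metis
  then show "cdiff_at (\<Lambda> j) t" unfolding cdiff_at_def by (rule exI[of _ "\<lambda>a. \<Lambda> j (axis a 1)"])
qed

lemma weight_hol: "open W \<Longrightarrow> \<Lambda> j \<in> hol affine_space W"
  by (simp add: hol_affine_space cdiff_at_weight)

lemma nu_hol: "open W \<Longrightarrow> \<nu> \<alpha> \<in> hol affine_space W"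
  unfolding nu_def
  by (intro affines.hol_sum affines.hol_mult
      affines.hol_const weight_hol) auto

lemma holomorphic_translation: "holomorphic_map_on affine_space UNIV affine_space (\<lambda>t. t + (s :: complex^'k))"
proof (rule affines.holomorphic_map_on_affine)
  fix a
  have "(\<lambda>t. t $ a) \<in> hol (affine_space :: (complex^'k) cspace) UNIV"
    by (rule coordinate_hol) (auto simp: openin_affine_space)
  then have "(\<lambda>t. t $ a + s $ a) \<in> hol (affine_space :: (complex^'k) cspace) UNIV"
    by (intro affines.hol_add affines.hol_const) auto
  then show "(\<lambda>t. (t + s) $ a) \<in> hol affine_space UNIV" by simp
qed simp

lemma monomial_hol: "\<alpha> \<in> S \<Longrightarrow> (\<lambda>x. x (monomial \<alpha>)) \<in> hol \<Q> Q"
  unfolding Q_space_def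
  by (rule coordinate_hol) (use openin_topspace[of "weak_topology Q ((\<lambda>p x. x p) ` \<A>)"] in auto)

lemma holomorphic_transport: "holomorphic_map_on \<Q> Q \<Q> (transport t)"
proof (rule Qs.holomorphic_map_on_Q[OF linear_weights_axioms])
  show op: "openin (ctop \<Q>) Q" using openin_topspace[of "ctop \<Q>"] by simp
  fix \<alpha> assume \<alpha>: "\<alpha> \<in> S"
  have "(\<lambda>x. exp (\<nu> \<alpha> t) * x (monomial \<alpha>)) \<in> hol \<Q> Q"
    by (intro Qs.hol_mult Qs.hol_const op monomial_hol \<alpha>)
  then show "(\<lambda>x. transport t x (monomial \<alpha>)) \<in> hol \<Q> Q"
    by (rule Qs.hol_cong) (simp add: transport_monomial \<alpha>)
qed (auto simp: transport_in_Q)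

lemma linear_extension_twist:
  "linear_extension \<kappa> (Poly_Mapping.mapp (\<lambda>\<alpha> a. e \<alpha> * a) p) = linear_extension (\<lambda>\<alpha>. e \<alpha> * \<kappa> \<alpha>) p"
  using linear_extension_superset[OF finite_keys keys_mapp_subset, of \<kappa> "\<lambda>\<alpha> a. e \<alpha> * a" p]
  by (simp add: linear_extension_def lookup_mapp mult_ac)

text \<open>The comorphism multiplies the coefficient of each monomial by
  \<open>exp (\<nu> \<alpha> t)\<close>. The twist by \<open>- t\<close> inverts it, so the regular
  functions are mapped onto themselves.\<close>

lemma transport_Q_aut: "transport t \<in> Q_aut \<Lambda> I"
proof -
  define tw where "tw t p = Poly_Mapping.mapp (\<lambda>\<alpha> a. exp (\<nu> \<alpha> t) * a) p" for t and p :: "'n regular"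
  have tw: "tw t p \<in> \<A>" if "p \<in> \<A>" for t p
    using that keys_mapp_subset unfolding tw_def S_algebra_def by fast
  have ev: "transport t x p = x (tw t p)" if "x \<in> Q" "p \<in> \<A>" for x p t
    using that Q_eval[OF that(1) tw[OF that(2)], of t]
    by (simp add: transport_def character_point_def tw_def linear_extension_twist)
  have "(\<lambda>p. \<lambda>x\<in>Q. transport t x p) ` \<A> = (\<lambda>p. \<lambda>x\<in>Q. x p) ` \<A>"
  proof (intro equalityI image_subsetI)
    fix p assume p: "p \<in> \<A>"
    have "(\<lambda>x\<in>Q. transport t x p) = (\<lambda>x\<in>Q. x (tw t p))"
      using ev p by (intro restrict_ext) auto
    then show "(\<lambda>x\<in>Q. transport t x p) \<in> (\<lambda>p. \<lambda>x\<in>Q. x p) ` \<A>" using tw[OF p] by blast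
    have "(\<lambda>x\<in>Q. x p) = (\<lambda>x\<in>Q. transport t x (tw (- t) p))"
    proof (rule restrict_ext)
      fix x assume x: "x \<in> Q"
      have "transport t x (tw (- t) p) = transport (- t) (transport t x) p"
        using ev[of "transport t x" p "- t"] x p by (simp add: transport_in_Q)
      then show "x p = transport t x (tw (- t) p)" by (simp add: transport_minus x)
    qed
    then show "(\<lambda>x\<in>Q. x p) \<in> (\<lambda>p. \<lambda>x\<in>Q. transport t x p) ` \<A>" using tw[OF p] by blast
  qed
  moreover have "biholomorphic_map \<Q> \<Q> (transport t)"
    unfolding biholomorphic_map_def holomorphic_map_iff points_Q
    using holomorphic_transport transport_minus by blast
  ultimately show ?thesis by (simp add: Q_aut_def transport_Bij)
qed

text \<open>An arbitrary representative, used in expressions that are constant on cosets, such as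
  \<open>transport\<close> and \<nu> at exponents in \<open>S\<close>.\<close>

definition rep :: "(complex^'k) set \<Rightarrow> complex^'k" where
  "rep v = (SOME t. t \<in> v)"

lemma rep_hcoset: "rep (coset t) - t \<in> H"
proof -
  have "rep (coset t) \<in> coset t" unfolding rep_def by (rule someI[of _ t]) (simp add: mem_hcoset)
  then show ?thesis by (simp add: mem_hcoset)
qed

lemma hcoset_rep [simp]: "v \<in> V \<Longrightarrow> coset (rep v) = v"
proof -
  assume "v \<in> V"
  then obtain t where "v = coset t" by (auto simp: V_set_def)
  then show "coset (rep v) = v" by (simp only: hcoset_eq_iff rep_hcoset)
qed

lemma nu_rep_hol: "\<alpha> \<in> S \<Longrightarrow> (\<lambda>v. \<nu> \<alpha> (rep v)) \<in> hol \<V> V"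
proof -
  assume \<alpha>: "\<alpha> \<in> S"
  have "(\<lambda>t. \<nu> \<alpha> (rep (coset t))) = \<nu> \<alpha>"
    using nu_isotropy_cong[OF \<alpha> rep_hcoset] by auto
  then show ?thesis
    using nu_hol[of UNIV \<alpha>] openin_topspace[of "ctop \<V>"]
    by (simp add: V_space_def hol_quotient_space V_set_def)
qed

abbreviation "VQ \<equiv> product_space \<V> \<Q>"

lemma function_sheaf_VQ: "function_sheaf VQ"
  by (intro sheaves)

sublocale VQs: function_sheaf VQ by (rule function_sheaf_VQ)

lemma open_VQ: "openin (ctop VQ) (V \<times> Q)"
  using openin_topspace[of "ctop VQ"] by simp

lemmas holomorphic_fst_VQ = holomorphic_fst[OF function_sheaf_V function_sheaf_Q, simplified]
  and holomorphic_snd_VQ = holomorphic_snd[OF function_sheaf_V function_sheaf_Q, simplified]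

text \<open>The factor \<open>c\<close> serves the action \<open>tau\<close> with
  \<open>c = 1\<close> and the inverse of the trivialisation with \<open>c = -1\<close>.\<close>

lemma holomorphic_transport_V:
  "holomorphic_map_on VQ (V \<times> Q) \<Q> (\<lambda>p. transport (c *s rep (fst p)) (snd p))"
proof (rule VQs.holomorphic_map_on_Q[OF linear_weights_axioms open_VQ])
  fix \<alpha> assume \<alpha>: "\<alpha> \<in> S"
  have V: "openin (ctop \<V>) V" and Q: "openin (ctop \<Q>) Q"
    using openin_topspace[of "ctop \<V>"] openin_topspace[of "ctop \<Q>"] by simp_all
  have eq: "{p \<in> V \<times> Q. fst p \<in> V} = V \<times> Q" "{p \<in> V \<times> Q. snd p \<in> Q} = V \<times> Q"
    by auto
  have "(\<lambda>p. c * \<nu> \<alpha> (rep (fst p))) \<in> hol VQ (V \<times> Q)"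
    using holomorphic_map_on_pullback[OF holomorphic_fst_VQ V nu_rep_hol[OF \<alpha>]] unfolding eq
    by (intro VQs.hol_mult VQs.hol_const open_VQ)
  then have "(\<lambda>p. exp (c * \<nu> \<alpha> (rep (fst p)))) \<in> hol VQ (V \<times> Q)"
    by (rule VQs.hol_comp_holomorphic[OF _ holomorphic_on_exp open_UNIV]) simp
  then have "(\<lambda>p. exp (c * \<nu> \<alpha> (rep (fst p))) * snd p (monomial \<alpha>)) \<in> hol VQ (V \<times> Q)"
    using holomorphic_map_on_pullback[OF holomorphic_snd_VQ Q monomial_hol[OF \<alpha>]] unfolding eq
    by (intro VQs.hol_mult)
  then show "(\<lambda>p. transport (c *s rep (fst p)) (snd p) (monomial \<alpha>)) \<in> hol VQ (V \<times> Q)"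
    by (rule VQs.hol_cong) (auto simp: transport_monomial \<alpha>)
qed (auto simp: transport_in_Q)

lemma transport_rep: "transport (rep (coset t)) = transport t"
  by (rule transport_cong[OF rep_hcoset])

lemma holomorphic_tau:
  "holomorphic_map_on VQ (V \<times> Q) \<Q> (\<lambda>(v, x). tau \<Lambda> I v x)"
  by (rule VQs.holomorphic_map_on_cong[OF holomorphic_transport_V[of 1]])
    (auto simp: V_set_def transport_rep)

lemma holomorphic_V_translation: "holomorphic_map_on \<V> V \<V> (\<lambda>v. v + coset s)"
proof (rule holomorphic_from_V)
  show "openin (ctop \<V>) V" using openin_topspace[of "ctop \<V>"] by simp
  show "holomorphic_map_on affine_space {t. coset t \<in> V} \<V> (\<lambda>t. coset t + coset s)"
    using holomorphic_map_on_compose[OF holomorphic_translation[of s] holomorphic_hcoset] by (simp add: V_set_def)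
qed

text \<open>On the set where all \<open>\<Lambda>\<^sub>i\<close>, \<open>i \<in> I\<close>, stay within distance 1 of their values at \<open>t\<close>, the covering
  \<open>V \<rightarrow> L\<close> is injective, because a period moving two such points into each other has
  \<open>\<bar>\<Lambda>\<^sub>i\<bar> < 2 < 2 \<pi>\<close> and hence lies in \<open>\<hh>\<close>.\<close>

lemma local_section:
  "\<exists>W \<sigma>. openin (ctop \<L>) W \<and> leaf t \<in> W \<and>
     holomorphic_map_on \<L> W \<V> \<sigma> \<and> (\<forall>l\<in>W. \<sigma> l +o \<Gamma> = l)"
proof -
  define B where "B = {s. \<forall>i\<in>I. cmod (\<Lambda> i s - \<Lambda> i t) < 1}"
  have "open {s. cmod (\<Lambda> i s - \<Lambda> i t) < 1}" for i
  proof -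
    have "openin (ctop (affine_space :: (complex^'k) cspace)) {s \<in> UNIV. \<Lambda> i s \<in> ball (\<Lambda> i t) 1}"
      by (rule affines.hol_continuous[OF weight_hol]) auto
    then show ?thesis by (simp add: openin_affine_space dist_norm norm_minus_commute)
  qed
  then have openB: "open B"
    unfolding B_def by (simp add: Collect_ball_eq open_INT)
  have inj: "s - s' \<in> H" if ss: "s \<in> B" "s' \<in> B" "s - s' \<in> K" for s s'
    unfolding isotropy_def
  proof (intro CollectI ballI)
    fix i assume i: "i \<in> I"
    then obtain m :: int where m: "\<Lambda> i (s - s') = 2 * of_real pi * \<i> * of_int m"
      using ss(3) unfolding period_group_def by blast
    have "cmod (\<Lambda> i (s - s')) = cmod ((\<Lambda> i s - \<Lambda> i t) - (\<Lambda> i s' - \<Lambda> i t))" by simp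
    also have "\<dots> < 2" using ss(1,2) i norm_triangle_ineq4[of "\<Lambda> i s - \<Lambda> i t" "\<Lambda> i s' - \<Lambda> i t"]
      by (fastforce simp: B_def)
    finally have "2 * pi * \<bar>real_of_int m\<bar> < 2" unfolding m by (simp add: norm_mult)
    then have "\<bar>real_of_int m\<bar> < 1 / pi" by (simp add: field_simps)
    also have "\<dots> < 1" using pi_gt3 by simp
    finally have "m = 0" by linarith
    then show "\<Lambda> i (s - s') = 0" using m by simp
  qed
  define W where "W = leaf ` B"
  define \<sigma> where "\<sigma> l = coset (SOME s. s \<in> B \<and> leaf s = l)" for l
  have \<sigma>: "\<sigma> l = coset s" if "s \<in> B" "leaf s = l" for l s
  proof -
    have "(SOME s. s \<in> B \<and> leaf s = l) \<in> B \<and> leaf (SOME s. s \<in> B \<and> leaf s = l) = l"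
      by (rule someI[of _ s]) (use that in blast)
    then show ?thesis unfolding \<sigma>_def hcoset_eq_iff using that by (intro inj) (auto simp: leaf_point_eq_iff[symmetric])
  qed
  \<comment> \<open>The preimage of \<open>W\<close> is the union of the translates of
    \<open>B\<close> by periods; on the translate by \<open>p\<close> the section is the coset of
    \<open>s - p\<close>.\<close>
  have pre: "{s. leaf s \<in> W} = (\<Union>p\<in>K. (\<lambda>s. s - p) -` B)"
  proof (intro equalityI subsetI)
    fix s assume "s \<in> {s. leaf s \<in> W}"
    then obtain b where "b \<in> B" "s - b \<in> K" by (auto simp: W_def leaf_point_eq_iff)
    then show "s \<in> (\<Union>p\<in>K. (\<lambda>s. s - p) -` B)" by (auto intro!: bexI[of _ "s - b"])
  next
    fix s assume "s \<in> (\<Union>p\<in>K. (\<lambda>s. s - p) -` B)"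
    then obtain p where "p \<in> K" "s - p \<in> B" by auto
    moreover from this have "leaf s = leaf (s - p)" by (simp add: leaf_point_eq_iff)
    ultimately show "s \<in> {s. leaf s \<in> W}" by (simp add: W_def)
  qed
  have openK: "open ((\<lambda>s. s - p) -` B)" for p
    by (intro open_vimage openB continuous_intros)
  then have "open {s. leaf s \<in> W}" unfolding pre by blast
  then have openW: "openin (ctop \<L>) W" by (auto simp: openin_L W_def)
  have "holomorphic_map_on affine_space {s. leaf s \<in> W} \<V> (\<lambda>s. \<sigma> (leaf s))"
  proof (rule affines.holomorphic_map_on_local)
    show "openin (ctop affine_space) {s. leaf s \<in> W}" using \<open>open {s. leaf s \<in> W}\<close> by simp
    fix s assume "s \<in> {s. leaf s \<in> W}"
    then obtain p where p: "p \<in> K" "s - p \<in> B" unfolding pre by auto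
    have "holomorphic_map_on affine_space UNIV \<V> (\<lambda>s. coset (s + - p))"
      by (rule holomorphic_map_on_compose[OF holomorphic_translation holomorphic_hcoset]) auto
    then have "holomorphic_map_on affine_space ((\<lambda>s. s - p) -` B) \<V> (\<lambda>s. coset (s + - p))"
      by (rule affines.holomorphic_map_on_restrict) (use openK in auto)
    moreover have "\<sigma> (leaf y) = coset (y + - p)" if "y - p \<in> B" for y
      by (rule \<sigma>) (use that p in \<open>auto simp: leaf_point_eq_iff\<close>)
    ultimately show "\<exists>W' g. s \<in> W' \<and> holomorphic_map_on affine_space W' \<V> g \<and>
        (\<forall>y\<in>W' \<inter> {s. leaf s \<in> W}. \<sigma> (leaf y) = g y)"
      using p by (intro exI[of _ "(\<lambda>s. s - p) -` B"] exI[of _ "\<lambda>s. coset (s + - p)"]) auto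
  qed
  then have "holomorphic_map_on \<L> W \<V> \<sigma>"
    by (rule holomorphic_from_L[OF openW])
  moreover have "\<forall>l\<in>W. \<sigma> l +o \<Gamma> = l"
    using \<sigma> by (auto simp: W_def hcoset_plus_Gamma)
  moreover have "leaf t \<in> W" by (auto simp: W_def B_def)
  ultimately show ?thesis using openW by blast
qed

end

context linear_weights
begin

section \<open>The suspension\<close>

lemma inv_transport: "x \<in> Q \<Longrightarrow> inv_into Q (transport t) x = transport (- t) x"
  using transport_Bij[of t] transport_in_Q[of x "- t"] transport_minus(1)[of x t]
  by (metis Bij_def IntD2 bij_betw_inv_into_left mem_Collect_eq)

lemma susp_act_eq: "p \<in> K \<Longrightarrow> x \<in> Q \<Longrightarrow> sact (coset p) (coset t, x) = (coset (t + p), transport (- p) x)"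
  by (simp add: susp_act_def V_set_def rho_hcoset inv_transport)

lemma susp_act_in: "p \<in> K \<Longrightarrow> z \<in> V \<times> Q \<Longrightarrow> sact (coset p) z \<in> V \<times> Q"
  by (auto simp: V_set_def susp_act_eq transport_in_Q)

lemma susp_act_susp_act:
  "p \<in> K \<Longrightarrow> q \<in> K \<Longrightarrow> z \<in> V \<times> Q \<Longrightarrow>
    sact (coset p) (sact (coset q) z) = sact (coset (p + q)) z"
  by (auto simp: V_set_def susp_act_eq transport_in_Q transport_transport add_ac)

lemma susp_act_zero: "z \<in> V \<times> Q \<Longrightarrow> sact (coset 0) z = z"
  by (auto simp: V_set_def susp_act_eq transport_zero)

lemma susp_act_Bij: "p \<in> K \<Longrightarrow> sact (coset p) \<in> Bij (V \<times> Q)"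
proof -
  assume p: "p \<in> K"
  have "bij_betw (sact (coset p)) (V \<times> Q) (V \<times> Q)"
  proof (rule bij_betw_byWitness[where f' = "sact (coset (- p))"]; intro ballI image_subsetI)
    fix z assume z: "z \<in> V \<times> Q"
    show "sact (coset p) z \<in> V \<times> Q" "sact (coset (- p)) z \<in> V \<times> Q"
      using susp_act_in z p period_closed(4) by blast+
    show "sact (coset (- p)) (sact (coset p) z) = z"
      "sact (coset p) (sact (coset (- p)) z) = z"
      using p z by (simp_all add: susp_act_susp_act susp_act_zero)
  qed
  then show ?thesis by (simp add: Bij_def susp_act_def)
qed

lemma group_action_susp: "group_action (Gamma_group \<Lambda> I) (V \<times> Q) (sact)"
proof (rule group_actionI[OF group_Gamma_group])
  fix g h z assume "g \<in> carrier (Gamma_group \<Lambda> I)" "h \<in> carrier (Gamma_group \<Lambda> I)" "z \<in> V \<times> Q"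
  then show "sact (g \<otimes>\<^bsub>Gamma_group \<Lambda> I\<^esub> h) z = sact g (sact h z)"
    by (auto simp: Gamma_group_def Gamma_def susp_act_susp_act)
qed (auto simp: Gamma_group_def Gamma_def susp_act_Bij)

lemma holomorphic_susp_act: "p \<in> K \<Longrightarrow> holomorphic_map_on VQ (V \<times> Q) VQ (sact (coset p))"
proof -
  assume p: "p \<in> K"
  have "holomorphic_map_on VQ (V \<times> Q) VQ (\<lambda>z. (fst z + coset p, transport (- p) (snd z)))"
    by (intro VQs.holomorphic_map_on_Pair[OF function_sheaf_V function_sheaf_Q]
        holomorphic_map_on_compose[OF holomorphic_fst_VQ holomorphic_V_translation]
        holomorphic_map_on_compose[OF holomorphic_snd_VQ holomorphic_transport]) auto
  then show ?thesis
    by (rule VQs.holomorphic_map_on_cong)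
      (use p in \<open>auto simp: V_set_def susp_act_eq\<close>)
qed

lemma points_VQ [simp]: "points VQ = V \<times> Q"
  by simp

lemma biholomorphic_susp_act: "p \<in> K \<Longrightarrow> biholomorphic_map VQ VQ (sact (coset p))"
proof -
  assume p: "p \<in> K"
  show ?thesis
    unfolding biholomorphic_map_def holomorphic_map_iff points_VQ
  proof (intro conjI exI[of _ "sact (coset (- p))"] ballI)
    show "holomorphic_map_on VQ (V \<times> Q) VQ (sact (coset p))"
      "holomorphic_map_on VQ (V \<times> Q) VQ (sact (coset (- p)))"
      using p by (simp_all add: holomorphic_susp_act)
    fix z assume "z \<in> V \<times> Q"
    then show "sact (coset (- p)) (sact (coset p) z) = z"
      "sact (coset p) (sact (coset (- p)) z) = z"
      using p susp_act_susp_act[of p "- p" z] susp_act_susp_act[of "- p" p z] by (simp_all add: susp_act_zero)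
  qed
qed

lemma susp_class_eq: "x \<in> Q \<Longrightarrow> susp (coset t, x) = (\<lambda>p. (coset (t + p), transport (- p) x)) ` K"
  by (auto simp: susp_class_def orbit_def Gamma_group_def Gamma_def susp_act_eq image_iff) (metis susp_act_eq)

text \<open>Starting the orbit at another of its points translates the parameter set
  \<open>K\<close> by a period, which permutes it.\<close>

lemma susp_class_shift:
  assumes "x \<in> Q" "p \<in> K"
  shows "susp (coset (t + p), transport (- p) x) = susp (coset t, x)"
proof -
  have "(\<lambda>q. p + q) ` K = K"
  proof
    show "(\<lambda>q. p + q) ` K \<subseteq> K" using assms by auto
    show "K \<subseteq> (\<lambda>q. p + q) ` K"
    proof
      fix q assume "q \<in> K"
      then show "q \<in> (\<lambda>q. p + q) ` K" using assms by (intro image_eqI[of _ _ "q - p"]) auto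
    qed
  qed
  then have "(\<lambda>p. (coset (t + p), transport (- p) x)) ` K = (\<lambda>q. (coset (t + (p + q)), transport (- (p + q)) x)) ` K"
    by (metis (no_types, lifting) image_cong image_image)
  also have "\<dots> = susp (coset (t + p), transport (- p) x)"
    using assms by (simp add: susp_class_eq transport_in_Q transport_transport add_ac)
  finally show ?thesis using assms by (simp add: susp_class_eq)
qed

lemma leaf_plus_period: "p \<in> K \<Longrightarrow> leaf (t + p) = leaf t"
  by (simp add: leaf_point_eq_iff)

lemma the_elem_image_const: "A \<noteq> {} \<Longrightarrow> (\<And>a. a \<in> A \<Longrightarrow> f a = c) \<Longrightarrow> the_elem (f ` A) = c"
  by (metis image_constant_conv image_cong the_elem_eq)

lemma period_nonempty: "K \<noteq> {}"
  using period_closed(1) by blast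

lemma susp_proj_class: "x \<in> Q \<Longrightarrow> susp_proj \<Lambda> I (susp (coset t, x)) = leaf t"
  unfolding susp_proj_def susp_class_eq
  by (rule the_elem_image_const) (use period_nonempty in \<open>auto simp: hcoset_plus_Gamma leaf_plus_period\<close>)

text \<open>Transport by \<open>t + p\<close> after transport by \<open>- p\<close> is transport by
  \<open>t\<close>, so the map is constant on the class.\<close>

lemma susp_triv_class: "x \<in> Q \<Longrightarrow> susp_triv \<Lambda> I (susp (coset t, x)) = (leaf t, transport t x)"
  unfolding susp_triv_def susp_class_eq
  by (rule the_elem_image_const)
    (use period_nonempty in \<open>auto simp: hcoset_plus_Gamma leaf_plus_period transport_transport\<close>)

lemma points_E [simp]: "points \<E> = susp ` (V \<times> Q)"
  by (simp add: E_space_def)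

lemma holomorphic_from_E:
  assumes "holomorphic_map_on VQ (V \<times> Q) Y (\<lambda>z. f (susp z))"
  shows "holomorphic_map \<E> Y f"
  unfolding holomorphic_map_iff E_space_def
proof (rule holomorphic_map_on_from_quotient)
  have "{z \<in> points VQ. susp z \<in> points (quotient_space VQ (susp))} = V \<times> Q"
    by auto
  then show "holomorphic_map_on VQ {z \<in> points VQ. susp z \<in> points (quotient_space VQ (susp))} Y
      (\<lambda>z. f (susp z))"
    using assms by simp
qed (rule openin_topspace)

lemma holomorphic_susp_class: "holomorphic_map_on VQ (V \<times> Q) \<E> (susp)"
  using holomorphic_quotient_map[of VQ "susp"] by (simp add: E_space_def)

lemma holomorphic_susp_proj: "holomorphic_map \<E> \<L> (susp_proj \<Lambda> I)"
proof (rule holomorphic_from_E)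
  have "holomorphic_map_on VQ (V \<times> Q) \<L> (\<lambda>z. fst z +o \<Gamma>)"
    by (rule holomorphic_map_on_compose[OF holomorphic_fst_VQ holomorphic_V_to_L]) auto
  then show "holomorphic_map_on VQ (V \<times> Q) \<L> (\<lambda>z. susp_proj \<Lambda> I (susp z))"
    by (rule VQs.holomorphic_map_on_cong)
      (auto simp: V_set_def susp_proj_class hcoset_plus_Gamma)
qed

section \<open>The trivialisation and its inverse\<close>

abbreviation "LQ \<equiv> product_space \<L> \<Q>"

lemma function_sheaf_LQ: "function_sheaf LQ"
  by (intro sheaves)

sublocale LQs: function_sheaf LQ by (rule function_sheaf_LQ)

lemma points_LQ [simp]: "points LQ = range leaf \<times> Q"
  by simp

lemma holomorphic_susp_triv: "holomorphic_map \<E> LQ (susp_triv \<Lambda> I)"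
proof (rule holomorphic_from_E)
  have "holomorphic_map_on VQ (V \<times> Q) LQ (\<lambda>z. (fst z +o \<Gamma>, (\<lambda>(v, x). tau \<Lambda> I v x) z))"
    by (intro VQs.holomorphic_map_on_Pair[OF function_sheaf_L function_sheaf_Q]
        holomorphic_map_on_compose[OF holomorphic_fst_VQ holomorphic_V_to_L] holomorphic_tau) auto
  then show "holomorphic_map_on VQ (V \<times> Q) LQ (\<lambda>z. susp_triv \<Lambda> I (susp z))"
    by (rule VQs.holomorphic_map_on_cong)
      (auto simp: V_set_def susp_triv_class hcoset_plus_Gamma)
qed

definition lift :: "(complex^'k) set set \<Rightarrow> complex^'k" where
  "lift l = (SOME t. leaf t = l)"

text \<open>Any \<open>v\<close> above \<open>l\<close>, paired with the inverse transport of
  \<open>y\<close>, represents the required class; \<open>susp_class_shift\<close> makes it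
  independent of the chosen lift.\<close>

definition susp_triv_inv ::
    "(complex^'k) set set \<times> ('n regular \<Rightarrow> complex) \<Rightarrow> ((complex^'k) set \<times> ('n regular \<Rightarrow> complex)) set" where
  "susp_triv_inv = (\<lambda>(l, y). susp (coset (lift l), transport (- lift l) y))"

lemma lift_leaf: "leaf (lift (leaf t)) = leaf t"
  unfolding lift_def by (rule someI) (rule refl)

lemma susp_triv_inv_leaf:
  assumes "y \<in> Q"
  shows "susp_triv_inv (leaf t, y) = susp (coset t, transport (- t) y)"
proof -
  let ?p = "lift (leaf t) - t"
  have "?p \<in> K" using lift_leaf[of t] by (simp add: leaf_point_eq_iff)
  from susp_class_shift[OF transport_in_Q[OF assms, of "- t"] this, of t]
  show ?thesis using assms by (simp add: susp_triv_inv_def transport_transport)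
qed

text \<open>No continuity is known for the chosen lift. Near each point it is replaced by a
  holomorphic section \<sigma> of the covering, which yields the same class.\<close>

lemma holomorphic_susp_triv_inv: "holomorphic_map LQ \<E> susp_triv_inv"
  unfolding holomorphic_map_iff
proof (rule LQs.holomorphic_map_on_local)
  fix z assume "z \<in> points LQ"
  then obtain t y where z: "z = (leaf t, y)" "y \<in> Q" by auto
  from local_section[of t] obtain W \<sigma> where W: "openin (ctop \<L>) W" "leaf t \<in> W"
    and \<sigma>: "holomorphic_map_on \<L> W \<V> \<sigma>" "\<forall>l\<in>W. \<sigma> l +o \<Gamma> = l"
    by (elim exE conjE)
  have WL: "W \<subseteq> range leaf" using openin_subset[OF W(1)] by simp
  have Q: "openin (ctop \<Q>) Q" using openin_topspace[of "ctop \<Q>"] by simp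
  have WQ: "openin (ctop LQ) (W \<times> Q)" using W Q by (simp add: openin_prod_Times_iff)
  have fst: "holomorphic_map_on LQ (W \<times> Q) \<L> fst"
    by (rule LQs.holomorphic_map_on_restrict[OF holomorphic_fst[OF function_sheaf_L function_sheaf_Q] WQ])
      (use WL in auto)
  have snd: "holomorphic_map_on LQ (W \<times> Q) \<Q> snd"
    by (rule LQs.holomorphic_map_on_restrict[OF holomorphic_snd[OF function_sheaf_L function_sheaf_Q] WQ])
      (use WL in auto)
  have \<sigma>V: "\<sigma> l \<in> V" if "l \<in> W" for l using holomorphic_map_on_pointsD[OF \<sigma>(1) that] by simp
  have 1: "holomorphic_map_on LQ (W \<times> Q) \<V> (\<lambda>z. \<sigma> (fst z))"
    by (rule holomorphic_map_on_compose[OF fst \<sigma>(1)]) auto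
  have 2: "holomorphic_map_on LQ (W \<times> Q) VQ (\<lambda>z. (\<sigma> (fst z), snd z))"
    by (rule LQs.holomorphic_map_on_Pair[OF function_sheaf_V function_sheaf_Q 1 snd])
  have 3: "holomorphic_map_on LQ (W \<times> Q) \<Q> (\<lambda>z. transport ((-1) *s rep (\<sigma> (fst z))) (snd z))"
    using holomorphic_map_on_compose[OF 2 holomorphic_transport_V[of "-1"]] \<sigma>V by fastforce
  have 4: "holomorphic_map_on LQ (W \<times> Q) VQ (\<lambda>z. (\<sigma> (fst z), transport ((-1) *s rep (\<sigma> (fst z))) (snd z)))"
    by (rule LQs.holomorphic_map_on_Pair[OF function_sheaf_V function_sheaf_Q 1 3])
  have 5: "holomorphic_map_on LQ (W \<times> Q) \<E>
      (\<lambda>z. susp (\<sigma> (fst z), transport ((-1) *s rep (\<sigma> (fst z))) (snd z)))"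
    by (rule holomorphic_map_on_compose[OF 4 holomorphic_susp_class]) (use \<sigma>V transport_in_Q in auto)
  have "susp_triv_inv z = susp (\<sigma> (fst z), transport ((-1) *s rep (\<sigma> (fst z))) (snd z))"
    if WQ: "z \<in> W \<times> Q" for z
  proof -
    obtain l y where z: "z = (l, y)" "l \<in> W" "y \<in> Q" using WQ by auto
    have c: "coset (rep (\<sigma> l)) = \<sigma> l" using \<sigma>V z by simp
    then have "leaf (rep (\<sigma> l)) = l" using \<sigma>(2)[rule_format, OF z(2)] hcoset_plus_Gamma[of "rep (\<sigma> l)"] by simp
    then show ?thesis using susp_triv_inv_leaf[OF z(3), of "rep (\<sigma> l)"] c by (simp add: z)
  qed
  then show "\<exists>W' g. z \<in> W' \<and> holomorphic_map_on LQ W' \<E> g \<and> (\<forall>y\<in>W' \<inter> points LQ. susp_triv_inv y = g y)"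
    using 5 W z by (intro exI[of _ "W \<times> Q"]
        exI[of _ "\<lambda>z. susp (\<sigma> (fst z), transport ((-1) *s rep (\<sigma> (fst z))) (snd z))"]) auto
qed (rule openin_topspace)

theorem susp_triv_trivialisation:
  "holomorphic_trivialisation \<E> (susp_proj \<Lambda> I) \<L> \<Q> (susp_triv \<Lambda> I)"
  unfolding holomorphic_trivialisation_def biholomorphic_map_def
proof (intro conjI exI[of _ susp_triv_inv] ballI holomorphic_susp_proj holomorphic_susp_triv holomorphic_susp_triv_inv)
  fix e assume "e \<in> points \<E>"
  then obtain t x where e: "e = susp (coset t, x)" "x \<in> Q" by (auto simp: V_set_def)
  show "susp_triv_inv (susp_triv \<Lambda> I e) = e" "fst (susp_triv \<Lambda> I e) = susp_proj \<Lambda> I e"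
    using e by (simp_all add: susp_triv_class susp_proj_class susp_triv_inv_leaf transport_in_Q transport_minus)
next
  fix z assume "z \<in> points LQ"
  then obtain t y where "z = (leaf t, y)" "y \<in> Q" by auto
  then show "susp_triv \<Lambda> I (susp_triv_inv z) = z"
    by (simp add: susp_triv_inv_leaf susp_triv_class transport_in_Q transport_minus)
qed

end

text \<open>The pairs run over fixed finite sets \<open>A\<close> and \<open>B\<close> containing
  the supports, so for sections the index set is the same at all points of the leaf and the sum can
  be differentiated termwise.\<close>

lemma lookup_mult_pairs:
  fixes p q :: "('a::monoid_add) \<Rightarrow>\<^sub>0 ('b::semiring_0)"
  assumes "finite A" "keys p \<subseteq> A" "finite B" "keys q \<subseteq> B"
  shows "lookup (p * q) \<gamma> =
    (\<Sum>z | z \<in> A \<times> B \<and> fst z + snd z = \<gamma>. lookup p (fst z) * lookup q (snd z))"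
proof -
  have "lookup (p * q) \<gamma> =
    (\<Sum>z\<in>A \<times> B. if fst z + snd z = \<gamma> then lookup p (fst z) * lookup q (snd z) else 0)"
    by (subst mult_sum_singles[OF assms])
      (simp add: lookup_sum lookup_single when_def sum.cartesian_product case_prod_unfold)
  then show ?thesis using assms(1,3) by (simp add: sum.inter_filter)
qed

lemma keys_mult_image:
  assumes "keys p \<subseteq> A" "keys q \<subseteq> B"
  shows "keys (p * q) \<subseteq> (\<lambda>z. fst z + snd z) ` (A \<times> B)"
proof
  fix \<gamma> assume "\<gamma> \<in> keys (p * q)"
  then obtain \<alpha> \<beta> where "\<gamma> = \<alpha> + \<beta>" "\<alpha> \<in> keys p" "\<beta> \<in> keys q"
    using keys_mult[of p q] by blast
  then show "\<gamma> \<in> (\<lambda>z. fst z + snd z) ` (A \<times> B)" using assms by (intro image_eqI[of _ _ "(\<alpha>, \<beta>)"]) auto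
qed

section \<open>Rules for directional derivatives\<close>

lemma dir_deriv_eqI:
  "((\<lambda>c. f (t + c *s \<xi>)) has_field_derivative D) (at 0) \<Longrightarrow> dir_deriv f t \<xi> = D"
  unfolding dir_deriv_def by (rule DERIV_imp_deriv)

lemma dir_deriv_add:
  assumes "cdiff_at f t" "cdiff_at g t"
  shows "dir_deriv (\<lambda>t. f t + g t) t \<xi> = dir_deriv f t \<xi> + dir_deriv g t \<xi>"
  by (intro dir_deriv_eqI DERIV_add cdiff_at_has_derivative assms)

lemma dir_deriv_diff:
  assumes "cdiff_at f t" "cdiff_at g t"
  shows "dir_deriv (\<lambda>t. f t - g t) t \<xi> = dir_deriv f t \<xi> - dir_deriv g t \<xi>"
  by (intro dir_deriv_eqI DERIV_diff cdiff_at_has_derivative assms)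

lemma dir_deriv_cmult_right:
  assumes "cdiff_at f t"
  shows "dir_deriv (\<lambda>t. f t * c) t \<xi> = dir_deriv f t \<xi> * c"
  by (intro dir_deriv_eqI DERIV_cmult_right cdiff_at_has_derivative assms)

lemma dir_deriv_mult:
  assumes "cdiff_at f t" "cdiff_at g t"
  shows "dir_deriv (\<lambda>t. f t * g t) t \<xi> = dir_deriv f t \<xi> * g t + f t * dir_deriv g t \<xi>"
  by (rule dir_deriv_eqI)
    (use DERIV_mult[OF cdiff_at_has_derivative(3)[OF assms(1)] cdiff_at_has_derivative(3)[OF assms(2)], of \<xi> \<xi>]
     in \<open>simp add: mult.commute\<close>)

lemma dir_deriv_sum:
  assumes "\<And>i. i \<in> A \<Longrightarrow> cdiff_at (f i) t"
  shows "dir_deriv (\<lambda>t. \<Sum>i\<in>A. f i t) t \<xi> = (\<Sum>i\<in>A. dir_deriv (f i) t \<xi>)"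
  by (intro dir_deriv_eqI DERIV_sum cdiff_at_has_derivative assms)

context linear_weights
begin

section \<open>The canonical connection\<close>

abbreviation "\<O> \<equiv> hol \<L>"
abbreviation "sections \<equiv> alg_sections \<Lambda> I"

lemma ext_d_leaf: "\<D> f (leaf t) \<xi> = dir_deriv (\<lambda>t. f (leaf t)) t \<xi>"
  by (simp add: ext_d_def dir_deriv_def hcoset_plus_leaf add.commute)

lemma hol_L_open: "f \<in> \<O> U \<Longrightarrow> openin (ctop \<L>) U"
  by (simp add: hol_L)

lemma leaf_in_open: "openin (ctop \<L>) U \<Longrightarrow> l \<in> U \<Longrightarrow> \<exists>t. l = leaf t"
  using openin_L by blast

text \<open>For small \<open>c\<close> the line through \<open>t\<close> stays in the open preimage
  of \<open>U\<close>, so the derivative sees only values on \<open>U\<close>.\<close>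

lemma ext_d_cong:
  assumes U: "openin (ctop \<L>) U" and l: "l \<in> U" and eq: "\<And>l. l \<in> U \<Longrightarrow> f l = g l"
  shows "\<D> f l \<xi> = \<D> g l \<xi>"
proof -
  obtain t where t: "l = leaf t" using leaf_in_open[OF U l] by blast
  have "isCont (\<lambda>c. t + c *s \<xi>) 0"
    by (intro continuous_intros bounded_linear.isCont[OF bounded_linear_vector_smult])
  moreover have "open {t. leaf t \<in> U}" using U by (simp add: openin_L)
  moreover have "t + 0 *s \<xi> \<in> {t. leaf t \<in> U}" using l t by simp
  ultimately have "\<forall>\<^sub>F c in nhds 0. t + c *s \<xi> \<in> {t. leaf t \<in> U}"
    unfolding continuous_at_open eventually_nhds by meson
  then have "\<forall>\<^sub>F c in nhds 0. f (leaf (t + c *s \<xi>)) = g (leaf (t + c *s \<xi>))"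
    by eventually_elim (simp add: eq)
  then show ?thesis unfolding t ext_d_leaf dir_deriv_def by (rule deriv_cong_ev) simp
qed

text \<open>Needed for the connection to map sections to sections; on the affine space it is the
  differentiability of directional derivatives.\<close>

lemma ext_d_hol:
  assumes f: "f \<in> \<O> U" shows "(\<lambda>l. \<D> f l \<xi>) \<in> \<O> U"
  unfolding hol_L ext_d_leaf
proof (intro conjI allI impI)
  fix t assume "leaf t \<in> U"
  then show "cdiff_at (\<lambda>t. dir_deriv (\<lambda>t. f (leaf t)) t \<xi>) t"
    using f by (intro dir_deriv_cdiff(1)[of "{t. leaf t \<in> U}"]) (auto simp: hol_L openin_L)
qed (rule hol_L_open[OF f])

lemma ext_d_rules:
  assumes f: "f \<in> \<O> U" and g: "g \<in> \<O> U" and l: "l \<in> U"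
  shows "\<D> (\<lambda>l. f l + g l) l \<xi> = \<D> f l \<xi> + \<D> g l \<xi>"
    and "\<D> (\<lambda>l. f l - g l) l \<xi> = \<D> f l \<xi> - \<D> g l \<xi>"
    and "\<D> (\<lambda>l. f l * g l) l \<xi> = \<D> f l \<xi> * g l + f l * \<D> g l \<xi>"
    and "\<D> (\<lambda>l. f l * c) l \<xi> = \<D> f l \<xi> * c"
    and "\<D> f l (a *s \<xi> + b *s \<eta>) = a * \<D> f l \<xi> + b * \<D> f l \<eta>"
    and "\<D> (\<lambda>l. \<D> f l \<xi>) l \<eta> = \<D> (\<lambda>l. \<D> f l \<eta>) l \<xi>"
proof -
  obtain t where t: "l = leaf t" using leaf_in_open[OF hol_L_open[OF f] l] by blast
  let ?f = "\<lambda>t. f (leaf t)" and ?g = "\<lambda>t. g (leaf t)"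
  have W: "open {t. leaf t \<in> U}" using hol_L_open[OF f] by (simp add: openin_L)
  have cf: "cdiff_at ?f s" if "s \<in> {t. leaf t \<in> U}" for s using f that by (simp add: hol_L)
  have c: "cdiff_at ?f t" "cdiff_at ?g t" using f g l t by (auto simp: hol_L)
  show "\<D> (\<lambda>l. f l + g l) l \<xi> = \<D> f l \<xi> + \<D> g l \<xi>"
    unfolding t ext_d_leaf by (rule dir_deriv_add[OF c])
  show "\<D> (\<lambda>l. f l - g l) l \<xi> = \<D> f l \<xi> - \<D> g l \<xi>"
    unfolding t ext_d_leaf by (rule dir_deriv_diff[OF c])
  show "\<D> (\<lambda>l. f l * g l) l \<xi> = \<D> f l \<xi> * g l + f l * \<D> g l \<xi>"
    unfolding t ext_d_leaf by (rule dir_deriv_mult[OF c])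
  show "\<D> (\<lambda>l. f l * c) l \<xi> = \<D> f l \<xi> * c"
    unfolding t ext_d_leaf by (rule dir_deriv_cmult_right[OF c(1)])
  show "\<D> f l (a *s \<xi> + b *s \<eta>) = a * \<D> f l \<xi> + b * \<D> f l \<eta>"
    unfolding t ext_d_leaf by (simp add: dir_deriv_linear[OF c(1)])
  show "\<D> (\<lambda>l. \<D> f l \<xi>) l \<eta> = \<D> (\<lambda>l. \<D> f l \<eta>) l \<xi>"
    unfolding t ext_d_leaf by (rule dir_deriv_cdiff(2)[OF W cf]) (use l t in auto)
qed

lemma ext_d_sum:
  assumes "\<And>i. i \<in> A \<Longrightarrow> f i \<in> \<O> U" "openin (ctop \<L>) U" "l \<in> U"
  shows "\<D> (\<lambda>l. \<Sum>i\<in>A. f i l) l \<xi> = (\<Sum>i\<in>A. \<D> (f i) l \<xi>)"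
proof -
  obtain t where t: "l = leaf t" using leaf_in_open[OF assms(2,3)] by blast
  show ?thesis unfolding t ext_d_leaf by (rule dir_deriv_sum) (use assms t in \<open>auto simp: hol_L\<close>)
qed

text \<open>Translation by the isotropy fixes every point of the leaf, so any function is constant
  along this flow.\<close>

lemma ext_d_isotropy:
  assumes "openin (ctop \<L>) U" "l \<in> U" "\<xi> \<in> H"
  shows "\<D> f l \<xi> = 0"
proof -
  obtain t where t: "l = leaf t" using leaf_in_open[OF assms(1,2)] by blast
  have "leaf (t + c *s \<xi>) = leaf t" for c
    using isotropy_closed(5)[OF assms(3), of c] isotropy_subset_period by (intro leaf_plus_period) auto
  then show ?thesis by (simp add: t ext_d_leaf dir_deriv_def)
qed

section \<open>Sections of the algebra over the leaf\<close>

lemma sections_support: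
  "s \<in> sections U \<Longrightarrow> \<exists>A. finite A \<and> A \<subseteq> S \<and> (\<forall>l\<in>U. keys (s l) \<subseteq> A)"
  by (simp add: alg_sections_def)

lemma sections_open: "s \<in> sections U \<Longrightarrow> openin (ctop \<L>) U"
  by (simp add: alg_sections_def)

lemma sections_hol: "s \<in> sections U \<Longrightarrow> (\<lambda>l. lookup (s l) \<alpha>) \<in> \<O> U"
  by (simp add: alg_sections_def)

lemma sectionsI:
  assumes "openin (ctop \<L>) U" "finite A" "A \<subseteq> S"
    "\<And>l. l \<in> U \<Longrightarrow> keys (s l) \<subseteq> A" "\<And>\<alpha>. (\<lambda>l. lookup (s l) \<alpha>) \<in> \<O> U"
  shows "s \<in> sections U"
  using assms by (auto simp: alg_sections_def)

lemma sections_add: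
  assumes "s \<in> sections U" "s' \<in> sections U"
  shows "(\<lambda>l. s l + s' l) \<in> sections U"
proof -
  obtain A where A: "finite A" "A \<subseteq> S" "\<And>l. l \<in> U \<Longrightarrow> keys (s l) \<subseteq> A"
    using sections_support[OF assms(1)] by blast
  obtain B where B: "finite B" "B \<subseteq> S" "\<And>l. l \<in> U \<Longrightarrow> keys (s' l) \<subseteq> B"
    using sections_support[OF assms(2)] by blast
  show ?thesis
  proof (rule sectionsI[of _ "A \<union> B"])
    show "keys (s l + s' l) \<subseteq> A \<union> B" if "l \<in> U" for l
      using Poly_Mapping.keys_add[of "s l" "s' l"] A(3)[OF that] B(3)[OF that] by blast
    show "(\<lambda>l. lookup (s l + s' l) \<alpha>) \<in> \<O> U" for \<alpha>
      unfolding lookup_add by (intro Ls.hol_add sections_hol assms)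
  qed (use A B sections_open[OF assms(1)] in auto)
qed

lemma sections_scal:
  assumes "s \<in> sections U" "f \<in> \<O> U"
  shows "(\<lambda>l. scal (f l) (s l)) \<in> sections U"
proof -
  obtain A where A: "finite A" "A \<subseteq> S" "\<And>l. l \<in> U \<Longrightarrow> keys (s l) \<subseteq> A"
    using sections_support[OF assms(1)] by blast
  show ?thesis
  proof (rule sectionsI[OF _ A(1,2)])
    show "keys (scal (f l) (s l)) \<subseteq> A" if "l \<in> U" for l
      using A(3)[OF that] by (auto simp: in_keys_iff)
    show "(\<lambda>l. lookup (scal (f l) (s l)) \<alpha>) \<in> \<O> U" for \<alpha>
      unfolding lookup_scal by (intro Ls.hol_mult sections_hol assms)
  qed (use sections_open[OF assms(1)] in auto)
qed

lemma sections_mult: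
  assumes "s \<in> sections U" "s' \<in> sections U"
  shows "(\<lambda>l. s l * s' l) \<in> sections U"
proof -
  obtain A where A: "finite A" "A \<subseteq> S" "\<And>l. l \<in> U \<Longrightarrow> keys (s l) \<subseteq> A"
    using sections_support[OF assms(1)] by blast
  obtain B where B: "finite B" "B \<subseteq> S" "\<And>l. l \<in> U \<Longrightarrow> keys (s' l) \<subseteq> B"
    using sections_support[OF assms(2)] by blast
  show ?thesis
  proof (rule sectionsI[of _ "(\<lambda>z. fst z + snd z) ` (A \<times> B)"])
    show "keys (s l * s' l) \<subseteq> (\<lambda>z. fst z + snd z) ` (A \<times> B)" if "l \<in> U" for l
      by (rule keys_mult_image[OF A(3)[OF that] B(3)[OF that]])
    show "(\<lambda>l. lookup (s l * s' l) \<gamma>) \<in> \<O> U" for \<gamma>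
    proof (rule Ls.hol_cong)
      show "(\<lambda>l. \<Sum>z | z \<in> A \<times> B \<and> fst z + snd z = \<gamma>.
          lookup (s l) (fst z) * lookup (s' l) (snd z)) \<in> \<O> U"
        by (intro Ls.hol_sum Ls.hol_mult sections_hol sections_open[OF assms(1)] assms)
      show "(\<Sum>z | z \<in> A \<times> B \<and> fst z + snd z = \<gamma>.
          lookup (s l) (fst z) * lookup (s' l) (snd z)) = lookup (s l * s' l) \<gamma>"
        if "l \<in> U" for l
        by (rule lookup_mult_pairs[OF A(1) A(3)[OF that] B(1) B(3)[OF that], symmetric])
    qed
    show "(\<lambda>z. fst z + snd z) ` (A \<times> B) \<subseteq> S" using A(2) B(2) by (auto intro!: S_add)
  qed (use A B sections_open[OF assms(1)] in auto)
qed

lemma ext_d_outside: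
  assumes s: "s \<in> sections U" and A: "\<And>l. l \<in> U \<Longrightarrow> keys (s l) \<subseteq> A" and "l \<in> U" "\<alpha> \<notin> A"
  shows "\<D> (\<lambda>l. lookup (s l) \<alpha>) l \<xi> = 0"
proof -
  have "lookup (s l) \<alpha> = 0" if "l \<in> U" for l using A[OF that] assms(4) by (auto simp: in_keys_iff)
  then have "\<D> (\<lambda>l. lookup (s l) \<alpha>) l \<xi> = \<D> (\<lambda>l. 0) l \<xi>"
    by (intro ext_d_cong[OF sections_open[OF s] assms(3)]) auto
  then show ?thesis by (simp add: ext_d_def)
qed

text \<open>\<open>Abs_poly_mapping\<close> can be inverted only on functions of finite support; the
  common support of the section over \<open>U\<close> also contains that of its derivatives.\<close>

lemma lookup_coeff_d:
  assumes s: "s \<in> sections U" and l: "l \<in> U"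
  shows "lookup (coeff_d \<Lambda> I s l \<xi>) \<alpha> = \<D> (\<lambda>l. lookup (s l) \<alpha>) l \<xi>"
proof -
  obtain A where A: "finite A" "\<And>l. l \<in> U \<Longrightarrow> keys (s l) \<subseteq> A"
    using sections_support[OF s] by blast
  have "finite {\<alpha>. \<D> (\<lambda>l. lookup (s l) \<alpha>) l \<xi> \<noteq> 0}"
    by (rule finite_subset[OF _ A(1)]) (use ext_d_outside[OF s A(2) l] in blast)
  then show ?thesis by (simp add: coeff_d_def)
qed

lemma lookup_nabla:
  assumes s: "s \<in> sections U" and l: "l \<in> U"
  shows "lookup (\<nabla> s l \<xi>) \<alpha> =
    \<D> (\<lambda>l. lookup (s l) \<alpha>) l \<xi> - lookup (s l) \<alpha> * \<nu> \<alpha> \<xi>"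
  by (simp add: nabla_def lookup_minus lookup_coeff_d[OF s l] lookup_mapp omega_def when_def in_keys_iff)

lemma keys_nabla:
  assumes s: "s \<in> sections U" and A: "\<And>l. l \<in> U \<Longrightarrow> keys (s l) \<subseteq> A" and l: "l \<in> U"
  shows "keys (\<nabla> s l \<xi>) \<subseteq> A"
proof
  fix \<alpha> assume *: "\<alpha> \<in> keys (\<nabla> s l \<xi>)"
  show "\<alpha> \<in> A"
  proof (rule ccontr)
    assume "\<alpha> \<notin> A"
    moreover from this have "lookup (s l) \<alpha> = 0" using A[OF l] by (auto simp: in_keys_iff)
    ultimately show False using * ext_d_outside[OF s A l] by (simp add: in_keys_iff lookup_nabla[OF s l])
  qed
qed

lemma nabla_sections:
  assumes s: "s \<in> sections U"
  shows "(\<lambda>l. \<nabla> s l \<xi>) \<in> sections U"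
proof -
  obtain A where A: "finite A" "A \<subseteq> S" "\<And>l. l \<in> U \<Longrightarrow> keys (s l) \<subseteq> A"
    using sections_support[OF s] by blast
  show ?thesis
  proof (rule sectionsI[OF sections_open[OF s] A(1,2)])
    show "keys (\<nabla> s l \<xi>) \<subseteq> A" if "l \<in> U" for l by (rule keys_nabla[OF s A(3) that])
    fix \<alpha>
    have "(\<lambda>l. \<D> (\<lambda>l. lookup (s l) \<alpha>) l \<xi> + lookup (s l) \<alpha> * (- \<nu> \<alpha> \<xi>)) \<in> \<O> U"
      by (intro Ls.hol_add Ls.hol_mult Ls.hol_const ext_d_hol sections_hol[OF s] sections_open[OF s])
    then show "(\<lambda>l. lookup (\<nabla> s l \<xi>) \<alpha>) \<in> \<O> U"
      by (rule Ls.hol_cong) (simp add: lookup_nabla[OF s])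
  qed
qed

lemma nabla_linear:
  assumes s: "s \<in> sections U" and l: "l \<in> U"
  shows "\<nabla> s l (a *s \<xi> + b *s \<eta>) = scal a (\<nabla> s l \<xi>) + scal b (\<nabla> s l \<eta>)"
  by (rule poly_mapping_eqI)
    (simp add: lookup_add lookup_nabla[OF s l] ext_d_rules(5)[OF sections_hol[OF s] sections_hol[OF s] l] algebra_simps)

text \<open>The correction term vanishes for exponents in \<open>S\<close> by the definition of
  \<open>S\<close>, and a section has zero coefficients elsewhere.\<close>

lemma nabla_isotropy:
  assumes s: "s \<in> sections U" and l: "l \<in> U" and "\<xi> \<in> H"
  shows "\<nabla> s l \<xi> = 0"
proof (rule poly_mapping_eqI)
  fix \<alpha>
  obtain A where A: "finite A" "A \<subseteq> S" "\<And>l. l \<in> U \<Longrightarrow> keys (s l) \<subseteq> A"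
    using sections_support[OF s] by blast
  have "lookup (s l) \<alpha> * \<nu> \<alpha> \<xi> = 0"
  proof (cases "\<alpha> \<in> S")
    case True
    then show ?thesis using assms(3) by (simp add: in_S_iff)
  next
    case False
    then have "\<alpha> \<notin> keys (s l)" using A(2,3) l by blast
    then show ?thesis by (simp add: in_keys_iff)
  qed
  then show "lookup (\<nabla> s l \<xi>) \<alpha> = lookup 0 \<alpha>"
    by (simp add: lookup_nabla[OF s l] ext_d_isotropy[OF sections_open[OF s] l assms(3)])
qed

lemma nabla_add:
  assumes s: "s \<in> sections U" "s' \<in> sections U" and l: "l \<in> U"
  shows "\<nabla> (\<lambda>l. s l + s' l) l \<xi> = \<nabla> s l \<xi> + \<nabla> s' l \<xi>"
  by (rule poly_mapping_eqI)
    (simp add: lookup_add lookup_nabla[OF s(1) l] lookup_nabla[OF s(2) l] lookup_nabla[OF sections_add[OF s] l]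
      ext_d_rules(1)[OF sections_hol[OF s(1)] sections_hol[OF s(2)] l] algebra_simps)

text \<open>For a pair of exponents with sum \<gamma>, the form \<open>\<nu> \<gamma>\<close> is the
  sum of the two forms, so the correction distributes over the factors exactly as the derivative
  does.\<close>

lemma nabla_mult:
  assumes s: "s \<in> sections U" "s' \<in> sections U" and l: "l \<in> U"
  shows "\<nabla> (\<lambda>l. s l * s' l) l \<xi> = \<nabla> s l \<xi> * s' l + s l * \<nabla> s' l \<xi>"
proof (rule poly_mapping_eqI)
  fix \<gamma>
  obtain A where A: "finite A" "\<And>l. l \<in> U \<Longrightarrow> keys (s l) \<subseteq> A" using sections_support[OF s(1)] by blast
  obtain B where B: "finite B" "\<And>l. l \<in> U \<Longrightarrow> keys (s' l) \<subseteq> B" using sections_support[OF s(2)] by blast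
  let ?P = "{z. z \<in> A \<times> B \<and> fst z + snd z = \<gamma>}"
  let ?f = "\<lambda>z l. lookup (s l) (fst z)" and ?g = "\<lambda>z l. lookup (s' l) (snd z)"
  have op: "openin (ctop \<L>) U" by (rule sections_open[OF s(1)])
  have kA: "keys (\<nabla> s l \<xi>) \<subseteq> A" by (rule keys_nabla[OF s(1) _ l]) (rule A(2))
  have kB: "keys (\<nabla> s' l \<xi>) \<subseteq> B" by (rule keys_nabla[OF s(2) _ l]) (rule B(2))
  have mult: "lookup (s l * s' l) \<gamma> = (\<Sum>z\<in>?P. ?f z l * ?g z l)" if "l \<in> U" for l
    by (rule lookup_mult_pairs[OF A(1) A(2)[OF that] B(1) B(2)[OF that]])
  have "\<D> (\<lambda>l. lookup (s l * s' l) \<gamma>) l \<xi> = \<D> (\<lambda>l. \<Sum>z\<in>?P. ?f z l * ?g z l) l \<xi>"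
    by (rule ext_d_cong[OF op l mult])
  also have "\<dots> = (\<Sum>z\<in>?P. \<D> (\<lambda>l. ?f z l * ?g z l) l \<xi>)"
    by (rule ext_d_sum[OF _ op l]) (intro Ls.hol_mult sections_hol s)
  also have "\<dots> = (\<Sum>z\<in>?P. \<D> (?f z) l \<xi> * ?g z l + ?f z l * \<D> (?g z) l \<xi>)"
    by (intro sum.cong refl ext_d_rules(3)[OF sections_hol[OF s(1)] sections_hol[OF s(2)] l])
  finally have d: "\<D> (\<lambda>l. lookup (s l * s' l) \<gamma>) l \<xi> = \<dots>" .
  have "lookup (\<nabla> (\<lambda>l. s l * s' l) l \<xi>) \<gamma> =
      (\<Sum>z\<in>?P. \<D> (?f z) l \<xi> * ?g z l + ?f z l * \<D> (?g z) l \<xi> - ?f z l * ?g z l * \<nu> \<gamma> \<xi>)"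
    by (simp add: lookup_nabla[OF sections_mult[OF s] l] d mult[OF l] sum_subtractf sum_distrib_right)
  also have "\<dots> = (\<Sum>z\<in>?P. lookup (\<nabla> s l \<xi>) (fst z) * ?g z l
      + ?f z l * lookup (\<nabla> s' l \<xi>) (snd z))"
    by (intro sum.cong refl) (auto simp: lookup_nabla[OF s(1) l] lookup_nabla[OF s(2) l] algebra_simps)
  also have "\<dots> = lookup (\<nabla> s l \<xi> * s' l + s l * \<nabla> s' l \<xi>) \<gamma>"
    by (simp only: lookup_add sum.distrib lookup_mult_pairs[OF A(1) kA B(1) B(2)[OF l]]
        lookup_mult_pairs[OF A(1) A(2)[OF l] B(1) kB])
  finally show "lookup (\<nabla> (\<lambda>l. s l * s' l) l \<xi>) \<gamma> =
      lookup (\<nabla> s l \<xi> * s' l + s l * \<nabla> s' l \<xi>) \<gamma>" .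
qed

lemma nabla_scal:
  assumes s: "s \<in> sections U" and f: "f \<in> \<O> U" and l: "l \<in> U"
  shows "\<nabla> (\<lambda>l. scal (f l) (s l)) l \<xi> = scal (\<D> f l \<xi>) (s l) + scal (f l) (\<nabla> s l \<xi>)"
  by (rule poly_mapping_eqI)
    (simp add: lookup_add lookup_nabla[OF s l] lookup_nabla[OF sections_scal[OF s f] l]
      ext_d_rules(3)[OF f sections_hol[OF s] l] algebra_simps)

lemma nabla_local:
  assumes s: "s \<in> sections U" "s' \<in> sections U" and eq: "\<And>l. l \<in> U \<Longrightarrow> s l = s' l" and l: "l \<in> U"
  shows "\<nabla> s l = \<nabla> s' l"
proof (rule ext, rule poly_mapping_eqI)
  fix \<xi> \<alpha>
  have "\<D> (\<lambda>l. lookup (s l) \<alpha>) l \<xi> = \<D> (\<lambda>l. lookup (s' l) \<alpha>) l \<xi>"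
    by (rule ext_d_cong[OF sections_open[OF s(1)] l]) (simp add: eq)
  then show "lookup (\<nabla> s l \<xi>) \<alpha> = lookup (\<nabla> s' l \<xi>) \<alpha>"
    by (simp add: lookup_nabla[OF s(1) l] lookup_nabla[OF s(2) l] eq[OF l])
qed

theorem algebra_connection_nabla: "algebra_connection \<Lambda> I \<nabla>"
  unfolding algebra_connection_def
  by (intro allI ballI conjI impI)
    (auto simp: nabla_sections nabla_linear nabla_isotropy nabla_add nabla_mult nabla_scal intro: nabla_local[THEN fun_cong] nabla_local)

text \<open>Besides the mixed derivative, the twofold derivative contains terms linear and quadratic
  in \<open>\<nu> \<alpha>\<close>, which together are symmetric in \<xi> and \<eta>.\<close>

theorem flat_nabla: "flat \<Lambda> I \<nabla>"
  unfolding flat_def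
proof (intro allI ballI poly_mapping_eqI)
  fix U s l \<xi> \<eta> \<alpha> assume s: "s \<in> sections U" and l: "l \<in> U"
  let ?f = "\<lambda>l. lookup (s l) \<alpha>"
  have f: "?f \<in> \<O> U" by (rule sections_hol[OF s])
  have eq: "lookup (\<nabla> (\<lambda>l. \<nabla> s l \<eta>) l \<xi>) \<alpha> =
      \<D> (\<lambda>l. \<D> ?f l \<eta>) l \<xi> - \<D> ?f l \<xi> * \<nu> \<alpha> \<eta>
      - (\<D> ?f l \<eta> - ?f l * \<nu> \<alpha> \<eta>) * \<nu> \<alpha> \<xi>" for \<xi> \<eta>
  proof -
    have "\<D> (\<lambda>l. lookup (\<nabla> s l \<eta>) \<alpha>) l \<xi>
        = \<D> (\<lambda>l. \<D> ?f l \<eta> - ?f l * \<nu> \<alpha> \<eta>) l \<xi>"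
      by (rule ext_d_cong[OF sections_open[OF s] l]) (rule lookup_nabla[OF s])
    also have "\<dots> = \<D> (\<lambda>l. \<D> ?f l \<eta>) l \<xi> - \<D> (\<lambda>l. ?f l * \<nu> \<alpha> \<eta>) l \<xi>"
      by (intro ext_d_rules(2)[OF ext_d_hol[OF f] _ l] Ls.hol_mult f Ls.hol_const sections_open[OF s])
    also have "\<D> (\<lambda>l. ?f l * \<nu> \<alpha> \<eta>) l \<xi> = \<D> ?f l \<xi> * \<nu> \<alpha> \<eta>"
      by (rule ext_d_rules(4)[OF f f l])
    finally show ?thesis by (simp add: lookup_nabla[OF nabla_sections[OF s] l] lookup_nabla[OF s l])
  qed
  show "lookup (\<nabla> (\<lambda>l. \<nabla> s l \<eta>) l \<xi> - \<nabla> (\<lambda>l. \<nabla> s l \<xi>) l \<eta>) \<alpha>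
      = lookup 0 \<alpha>"
    unfolding lookup_minus eq ext_d_rules(6)[OF f f l, of \<eta> \<xi>] by (simp add: algebra_simps)
qed

section \<open>Horizontal curves and monodromy\<close>

lemma bounded_linear_nu: "bounded_linear (\<nu> \<alpha>)"
proof -
  have "bounded_linear (\<lambda>t. \<Sum>j\<in>- I. of_nat (lookup \<alpha> j) * \<Lambda> j t)"
    by (intro bounded_linear_sum bounded_linear_const_mult bounded_linear_weight)
  then show ?thesis by (simp add: nu_def[abs_def])
qed

text \<open>The constant \<open>c\<close> is 1 for the transport itself and -1 for the integrating
  factor in the proof of uniqueness.\<close>

lemma exp_nu_derivative:
  assumes "u C1_differentiable_on {0..1}" "s \<in> {0..1}"
  shows "((\<lambda>s. exp (c * \<nu> \<alpha> (u s - a))) has_vector_derivative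
     c * \<nu> \<alpha> (vector_derivative u (at s)) * exp (c * \<nu> \<alpha> (u s - a))) (at s within {0..1})"
proof -
  have "(u has_vector_derivative vector_derivative u (at s)) (at s)"
    using assms by (auto simp: C1_differentiable_on_eq vector_derivative_works)
  then have "((\<lambda>s. u s - a) has_vector_derivative vector_derivative u (at s) - 0) (at s)"
    by (intro has_vector_derivative_diff has_vector_derivative_const)
  then have "((\<lambda>s. \<nu> \<alpha> (u s - a)) has_vector_derivative \<nu> \<alpha> (vector_derivative u (at s) - 0)) (at s)"
    by (rule bounded_linear.has_vector_derivative[OF bounded_linear_nu[of \<alpha>], of "\<lambda>s. u s - a"])
  then have "((\<lambda>s. c * \<nu> \<alpha> (u s - a)) has_vector_derivative c * \<nu> \<alpha> (vector_derivative u (at s))) (at s)"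
    using has_vector_derivative_mult_right[of "\<lambda>s. \<nu> \<alpha> (u s - a)" _ "at s" c] by simp
  then have "(exp \<circ> (\<lambda>s. c * \<nu> \<alpha> (u s - a)) has_vector_derivative
      c * \<nu> \<alpha> (vector_derivative u (at s)) * exp (c * \<nu> \<alpha> (u s - a))) (at s)"
    by (rule field_vector_diff_chain_at) (rule DERIV_exp)
  then show ?thesis unfolding comp_def by (rule has_vector_derivative_at_within)
qed

text \<open>The base point \<open>a\<close> is free: with \<open>u 0\<close> the curve starts at
  \<open>x\<close>, with 0 it is the image in the trivialised suspension of a curve with constant
  fibre component.\<close>

lemma horizontal_transport:
  assumes u: "u C1_differentiable_on {0..1}" and x: "x \<in> Q"
  shows "horizontal \<Lambda> I u (\<lambda>s. transport (u s - a) x)"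
  unfolding horizontal_def
proof (intro ballI conjI)
  fix s :: real and \<alpha> assume s: "s \<in> {0..1}" and \<alpha>: "\<alpha> \<in> S"
  have "((\<lambda>s. exp (1 * \<nu> \<alpha> (u s - a)) * x (monomial \<alpha>)) has_vector_derivative
      1 * \<nu> \<alpha> (vector_derivative u (at s)) * exp (1 * \<nu> \<alpha> (u s - a)) * x (monomial \<alpha>)) (at s within {0..1})"
    by (rule has_vector_derivative_mult_left[OF exp_nu_derivative[OF u s]])
  then show "((\<lambda>s. transport (u s - a) x (monomial \<alpha>)) has_vector_derivative
      transport (u s - a) x (monomial \<alpha>) * omega \<Lambda> I \<alpha> (leaf (u s)) (vector_derivative u (at s))) (at s within {0..1})"
    by (simp add: transport_monomial x \<alpha> omega_def mult_ac)
qed (rule transport_in_Q[OF x])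

text \<open>An integrating factor turns each scalar equation into the vanishing of a derivative, so
  the product with the factor is constant.\<close>

lemma horizontal_unique:
  assumes u: "u C1_differentiable_on {0..1}" and y: "horizontal \<Lambda> I u y" and s: "s \<in> {0..1}"
  shows "y s = transport (u s - u 0) (y 0)"
proof (rule Q_eqI)
  have yQ: "y s \<in> Q" if "s \<in> {0..1}" for s using y that by (simp add: horizontal_def)
  have y0: "y 0 \<in> Q" by (rule yQ) simp
  show "y s \<in> Q" "transport (u s - u 0) (y 0) \<in> Q" using yQ s transport_in_Q y0 by auto
  fix \<alpha> assume \<alpha>: "\<alpha> \<in> S"
  let ?E = "\<lambda>s. exp ((-1) * \<nu> \<alpha> (u s - u 0))"
  have "((\<lambda>s. y s (monomial \<alpha>) * ?E s) has_vector_derivative 0) (at s within {0..1})" if s: "s \<in> {0..1}" for s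
  proof -
    have "((\<lambda>s. y s (monomial \<alpha>)) has_vector_derivative
        y s (monomial \<alpha>) * \<nu> \<alpha> (vector_derivative u (at s))) (at s within {0..1})"
      using y s \<alpha> by (simp add: horizontal_def omega_def)
    from has_vector_derivative_mult[OF this exp_nu_derivative[OF u s, of "-1" \<alpha> "u 0"]]
    show ?thesis by (simp add: algebra_simps)
  qed
  note deriv = this
  obtain c where c: "\<And>s. s \<in> {0..1} \<Longrightarrow> y s (monomial \<alpha>) * ?E s = c"
    by (rule has_vector_derivative_zero_constant[of "{0..1}" "\<lambda>s. y s (monomial \<alpha>) * ?E s"])
      (simp, rule deriv, assumption, blast)
  have "y s (monomial \<alpha>) = y s (monomial \<alpha>) * ?E s * exp (\<nu> \<alpha> (u s - u 0))"
    by (simp add: mult.assoc exp_add[symmetric])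
  also have "y s (monomial \<alpha>) * ?E s = y 0 (monomial \<alpha>)" using c[OF s] c[of 0] by simp
  finally have "y s (monomial \<alpha>) = exp (\<nu> \<alpha> (u s - u 0)) * y 0 (monomial \<alpha>)"
    by (simp only: mult.commute)
  then show "y s (monomial \<alpha>) = transport (u s - u 0) (y 0) (monomial \<alpha>)"
    by (simp add: transport_monomial y0 \<alpha>)
qed

text \<open>For a loop in the leaf, \<open>u 1 - u 0\<close> is a period, and transport by a period
  is the value of \<open>rho\<close>.\<close>

theorem has_monodromy_rho: "has_monodromy \<Lambda> I (rho \<Lambda> I)"
  unfolding has_monodromy_def
proof (intro allI impI ballI)
  fix u :: "real \<Rightarrow> complex^'k" and x assume u: "u C1_differentiable_on {0..1}" and x: "x \<in> Q"
  show "\<exists>y. horizontal \<Lambda> I u y \<and> y 0 = x \<and>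
      (\<forall>y'. horizontal \<Lambda> I u y' \<and> y' 0 = x \<longrightarrow> (\<forall>s\<in>{0..1}. y' s = y s)) \<and>
      (leaf (u 1) = leaf (u 0) \<longrightarrow> y 1 = rho \<Lambda> I (coset (u 1 - u 0)) x)"
    using horizontal_transport[OF u x] horizontal_unique[OF u] transport_zero[OF x]
    by (intro exI[of _ "\<lambda>s. transport (u s - u 0) x"]) (auto simp: rho_hcoset leaf_point_eq_iff)
qed

end

section \<open>Dual bases of independent linear forms\<close>

lemma sum_fun_apply: "(\<Sum>i\<in>A. f i) x = (\<Sum>i\<in>A. f i x)"
  by (induction A rule: infinite_finite_induct) auto

text \<open>As in Gram-Schmidt, the components along the forms already treated are subtracted from
  \<open>f j\<close>. Independence makes the difference \<open>g\<close> nonzero somewhere, and a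
  vector where it does not vanish is adjusted to complete the dual system.\<close>

lemma dual_basis:
  fixes f :: "'i \<Rightarrow> complex^'k \<Rightarrow> complex"
  assumes "finite I" "\<And>i. Vector_Spaces.linear (*s) (*) (f i)"
    and "\<And>c. (\<And>t. (\<Sum>i\<in>I. c i * f i t) = 0) \<Longrightarrow> \<forall>i\<in>I. c i = 0"
  shows "\<exists>e. \<forall>i\<in>I. \<forall>j\<in>I. f j (e i) = (if i = j then 1 else 0)"
  using assms(1,3)
proof (induction I rule: finite_induct)
  case (insert j I)
  have f: "f i (s + t) = f i s + f i t" "f i (s - t) = f i s - f i t" "f i (c *s t) = c * f i t"
    "f i (sum g A) = (\<Sum>a\<in>A. f i (g a))" for i s t c and g :: "'i \<Rightarrow> complex^'k" and A
  proof -
    interpret Vector_Spaces.linear "(*s)" "(*)" "f i" by (rule assms(2))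
    show "f i (s + t) = f i s + f i t" "f i (s - t) = f i s - f i t" "f i (c *s t) = c * f i t"
      "f i (sum g A) = (\<Sum>a\<in>A. f i (g a))"
      by (rule add diff scale sum)+
  qed
  have "\<exists>e. \<forall>i\<in>I. \<forall>j\<in>I. f j (e i) = (if i = j then 1 else 0)"
  proof (rule insert.IH)
    fix c assume c: "\<And>t. (\<Sum>i\<in>I. c i * f i t) = 0"
    have "\<forall>i\<in>insert j I. (if i = j then 0 else c i) = 0"
    proof (rule insert.prems)
      fix t
      have "(\<Sum>i\<in>I. (if i = j then 0 else c i) * f i t) = (\<Sum>i\<in>I. c i * f i t)"
        by (rule sum.cong) (use insert.hyps in auto)
      then show "(\<Sum>i\<in>insert j I. (if i = j then 0 else c i) * f i t) = 0" using insert.hyps c by simp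
    qed
    then show "\<forall>i\<in>I. c i = 0" using insert.hyps by (metis insertCI)
  qed
  then obtain e where e: "\<And>i k. i \<in> I \<Longrightarrow> k \<in> I \<Longrightarrow> f k (e i) = (if i = k then 1 else 0)" by blast
  define g where "g t = f j t - (\<Sum>i\<in>I. f j (e i) * f i t)" for t
  have "\<exists>t. g t \<noteq> 0"
  proof (rule ccontr)
    assume "\<nexists>t. g t \<noteq> 0"
    then have g: "g t = 0" for t by blast
    have "\<forall>i\<in>insert j I. (if i = j then 1 else - f j (e i)) = 0"
    proof (rule insert.prems)
      fix t
      have "(\<Sum>i\<in>I. (if i = j then 1 else - f j (e i)) * f i t) = (\<Sum>i\<in>I. - (f j (e i) * f i t))"
        by (rule sum.cong) (use insert.hyps in auto)
      then show "(\<Sum>i\<in>insert j I. (if i = j then 1 else - f j (e i)) * f i t) = 0"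
        using insert.hyps g[of t] by (simp add: g_def sum_negf)
    qed
    then show False by simp
  qed
  then obtain t0 where t0: "g t0 \<noteq> 0" by blast
  \<comment> \<open>Removing the components along \<open>e\<close> makes the forms of
    \<open>I\<close> vanish; on what remains \<open>f j\<close> takes the value \<open>g t0\<close>,
    which is scaled to 1.\<close>
  define t1 where "t1 = (1 / g t0) *s (t0 - (\<Sum>i\<in>I. f i t0 *s e i))"
  have I: "f k t1 = 0" if "k \<in> I" for k
  proof -
    have "(\<Sum>i\<in>I. f i t0 * f k (e i)) = (\<Sum>i\<in>I. if i = k then f i t0 else 0)"
      by (rule sum.cong) (use e that in auto)
    then show ?thesis using that insert.hyps by (simp add: t1_def f)
  qed
  have "f j t1 = 1 / g t0 * (f j t0 - (\<Sum>i\<in>I. f i t0 * f j (e i)))"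
    by (simp only: t1_def f)
  also have "\<dots> = 1 / g t0 * g t0" by (simp only: g_def mult.commute)
  finally have j: "f j t1 = 1" using t0 by simp
  \<comment> \<open>Subtracting a multiple of \<open>t1\<close> annihilates \<open>f j\<close> on
    the old vectors without disturbing the forms of \<open>I\<close>.\<close>
  define e' where "e' i = (if i = j then t1 else e i - f j (e i) *s t1)" for i
  have "f k (e' i) = (if i = k then 1 else 0)" if "i \<in> insert j I" "k \<in> insert j I" for i k
    using that e I j insert.hyps by (auto simp: e'_def f)
  then show ?case by blast
qed simp

context linear_weights
begin

section \<open>Independent support weights\<close>

interpretation covec: vector_space "\<lambda>(c::complex) (f::complex^'k \<Rightarrow> complex) x. c * f x"
  by (rule covector.vector_space_axioms)

text \<open>Independence speaks of the set of weights; injectivity of \<Lambda> on \<open>I\<close>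
  converts it into a statement about the indexed family.\<close>

lemma independent_dual_basis:
  assumes "independent_weights \<Lambda> I"
  shows "\<exists>e. \<forall>i\<in>I. \<forall>j\<in>I. \<Lambda> j (e i) = (if i = j then 1 else 0)"
proof (rule dual_basis[OF _ linear])
  fix c assume c: "\<And>t. (\<Sum>i\<in>I. c i * \<Lambda> i t) = 0"
  have inj: "inj_on \<Lambda> I" and ind: "covector.independent (\<Lambda> ` I)"
    using assms by (auto simp: independent_weights_def)
  define u where "u v = c (inv_into I \<Lambda> v)" for v
  have u: "u (\<Lambda> i) = c i" if "i \<in> I" for i using inj that by (simp add: u_def)
  have "(\<Sum>v\<in>\<Lambda> ` I. (\<lambda>x. u v * v x)) = 0"
  proof
    fix t
    have "(\<Sum>v\<in>\<Lambda> ` I. (\<lambda>x. u v * v x)) t = (\<Sum>i\<in>I. c i * \<Lambda> i t)"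
      by (simp add: sum_fun_apply sum.reindex[OF inj] u)
    then show "(\<Sum>v\<in>\<Lambda> ` I. (\<lambda>x. u v * v x)) t = 0 t" using c by simp
  qed
  moreover have "\<not> (\<exists>u. (\<exists>v\<in>\<Lambda> ` I. u v \<noteq> 0) \<and> (\<Sum>v\<in>\<Lambda> ` I. (\<lambda>x. u v * v x)) = 0)"
    using ind by (subst (asm) covector.dependent_finite) simp_all
  ultimately have "\<forall>v\<in>\<Lambda> ` I. u v = 0" by blast
  then show "\<forall>i\<in>I. c i = 0" using u by auto
qed simp

context
  fixes e assumes ind: "independent_weights \<Lambda> I"
    and e: "\<forall>i\<in>I. \<forall>j\<in>I. \<Lambda> j (e i) = (if i = j then 1 else 0)"
begin

lemma weight_sum: "j \<in> I \<Longrightarrow> \<Lambda> j (\<Sum>i\<in>I. c i *s e i) = c j"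
proof -
  assume j: "j \<in> I"
  interpret Vector_Spaces.linear "(*s)" "(*)" "\<Lambda> j" by (rule linear)
  have "\<Lambda> j (\<Sum>i\<in>I. c i *s e i) = (\<Sum>i\<in>I. if i = j then c i else 0)"
    unfolding sum by (rule sum.cong) (use e j in \<open>auto simp: scale\<close>)
  then show ?thesis using j by simp
qed

lemma nu_sum: "\<nu> \<alpha> (\<Sum>i\<in>A. f i) = (\<Sum>i\<in>A. \<nu> \<alpha> (f i))"
  by (induction A rule: infinite_finite_induct) auto

text \<open>The weights of \<open>I\<close> do not distinguish \<open>t\<close> from its combination
  of dual vectors, so the two differ by an element of the isotropy, on which \<nu> vanishes.\<close>

lemma nu_expansion: "\<alpha> \<in> S \<Longrightarrow> \<nu> \<alpha> t = (\<Sum>i\<in>I. \<nu> \<alpha> (e i) * \<Lambda> i t)"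
proof -
  assume \<alpha>: "\<alpha> \<in> S"
  have "t - (\<Sum>i\<in>I. \<Lambda> i t *s e i) \<in> H" by (simp add: isotropy_def weight_sum)
  then have "\<nu> \<alpha> t = \<nu> \<alpha> (\<Sum>i\<in>I. \<Lambda> i t *s e i)" by (rule nu_isotropy_cong[OF \<alpha>])
  also have "\<dots> = (\<Sum>i\<in>I. \<nu> \<alpha> (e i) * \<Lambda> i t)"
    by (simp add: nu_sum mult.commute)
  finally show ?thesis .
qed

text \<open>Evaluation at the dual vector \<open>e i\<close> picks out a single coefficient of the
  expansion in the basis of weights.\<close>

lemma c_coeff_eq:
  assumes \<alpha>: "\<alpha> \<in> S" and i: "i \<in> I"
  shows "c_coeff \<Lambda> I i \<alpha> = \<nu> \<alpha> (e i)"
proof -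
  have inj: "inj_on \<Lambda> I" and indep: "covector.independent (\<Lambda> ` I)"
    using ind by (auto simp: independent_weights_def)
  have "\<nu> \<alpha> = (\<Sum>i\<in>I. (\<lambda>x. \<nu> \<alpha> (e i) * \<Lambda> i x))"
    by (rule ext) (unfold sum_fun_apply, rule nu_expansion[OF \<alpha>])
  also have "\<dots> \<in> covector.span (\<Lambda> ` I)"
    by (intro covector.span_sum covector.span_scale covector.span_base) auto
  finally have "(\<Sum>v\<in>\<Lambda> ` I. (\<lambda>x. covector.representation (\<Lambda> ` I) (\<nu> \<alpha>) v * v x)) = \<nu> \<alpha>"
    by (rule covector.sum_representation_eq[of "\<Lambda> ` I" "\<nu> \<alpha>" "\<Lambda> ` I", OF indep _ finite_imageI[OF finite] subset_refl])
  from fun_cong[OF this, of "e i"] have "\<nu> \<alpha> (e i) = (\<Sum>j\<in>I. c_coeff \<Lambda> I j \<alpha> * \<Lambda> j (e i))"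
    by (simp add: c_coeff_def sum_fun_apply sum.reindex[OF inj])
  also have "\<dots> = (\<Sum>j\<in>I. if j = i then c_coeff \<Lambda> I j \<alpha> else 0)"
    by (rule sum.cong) (use e i in auto)
  finally show ?thesis using i by simp
qed

end

section \<open>The torus coordinates on the leaf\<close>

lemma z_coord_leaf: "i \<in> I \<Longrightarrow> z_coord \<Lambda> i (leaf t) = exp (\<Lambda> i t)"
  unfolding z_coord_def
proof (rule the_elem_image_const)
  have "t \<in> \<Union>(leaf t)" by (simp only: mem_Union_leaf) simp
  then show "\<Union>(leaf t) \<noteq> {}" by blast
  fix u assume "i \<in> I" "u \<in> \<Union>(leaf t)"
  then have "leaf u = leaf t" by (simp only: mem_Union_leaf leaf_point_eq_iff)
  then show "exp (\<Lambda> i u) = exp (\<Lambda> i t)" using exp_weights_eq_iff \<open>i \<in> I\<close> by blast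
qed

lemma exp_weight_hol: "(\<lambda>t. exp (\<Lambda> i t)) \<in> hol affine_space UNIV"
  by (rule affines.hol_comp_holomorphic[OF weight_hol holomorphic_on_exp open_UNIV]) auto

text \<open>Division by \<open>z_coord\<close> identifies the logarithmic differential of this
  coordinate with the constant form \<open>\<Lambda> i\<close>.\<close>

lemma ext_d_z_coord: "i \<in> I \<Longrightarrow> \<D> (z_coord \<Lambda> i) (leaf t) \<xi> = \<Lambda> i \<xi> * z_coord \<Lambda> i (leaf t)"
proof -
  assume i: "i \<in> I"
  have "((\<lambda>c. exp (\<Lambda> i (t + c *s \<xi>))) has_field_derivative \<Lambda> i \<xi> * exp (\<Lambda> i t)) (at 0)"
    by (auto intro!: derivative_eq_intros)
  then show ?thesis unfolding ext_d_leaf z_coord_leaf[OF i] by (rule dir_deriv_eqI)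
qed

lemma points_torus [simp]: "points (torus_space I) = PiE I (\<lambda>_. - {0})"
  by (simp add: torus_space_def)

lemma function_sheaf_torus: "function_sheaf (torus_space I)"
  unfolding torus_space_def by (rule function_sheaf_coordinate)

lemma torus_coordinate_hol:
  "openin (ctop (torus_space I)) W \<Longrightarrow> i \<in> I \<Longrightarrow> (\<lambda>z. z i) \<in> hol (torus_space I) W"
  unfolding torus_space_def by (rule coordinate_hol) auto

lemma z_coords_leaf: "z_coords \<Lambda> I (leaf t) = (\<lambda>i\<in>I. exp (\<Lambda> i t))"
  by (auto simp: z_coords_def z_coord_leaf)

lemma holomorphic_z_coords: "holomorphic_map \<L> (torus_space I) (z_coords \<Lambda> I)"
  unfolding holomorphic_map_iff torus_space_def
proof (rule Ls.holomorphic_map_on_coordinate)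
  show op: "openin (ctop \<L>) (points \<L>)" by (rule openin_topspace)
  show "z_coords \<Lambda> I ` points \<L> \<subseteq> PiE I (\<lambda>_. - {0})"
    by (auto simp: z_coords_leaf)
  fix \<phi> :: "('n \<Rightarrow> complex) \<Rightarrow> complex" assume "\<phi> \<in> (\<lambda>i z. z i) ` I"
  then obtain i where i: "i \<in> I" "\<phi> = (\<lambda>z. z i)" by blast
  have "cdiff_at (\<lambda>t. exp (\<Lambda> i t)) t" for t using exp_weight_hol[of i] by (simp add: hol_affine_space)
  then show "(\<lambda>l. \<phi> (z_coords \<Lambda> I l)) \<in> \<O> (points \<L>)"
    unfolding hol_L using op i by (simp add: z_coords_leaf del: points_L)
qed

text \<open>Near \<open>z0\<close> a logarithm of \<open>z / z0\<close> exists; changing its branch does not change the point of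
  the leaf.\<close>

theorem biholomorphic_z_coords:
  assumes ind: "independent_weights \<Lambda> I"
  shows "biholomorphic_map \<L> (torus_space I) (z_coords \<Lambda> I)"
proof -
  obtain e where e: "\<forall>i\<in>I. \<forall>j\<in>I. \<Lambda> j (e i) = (if i = j then 1 else 0)"
    using independent_dual_basis[OF ind] by blast
  note weight_sum = weight_sum[OF ind e]
  let ?T = "PiE I (\<lambda>_. - {0::complex})"
  \<comment> \<open>The principal branch is only a choice: by the next fact every \<open>t\<close>
    with the right exponentials represents the same point.\<close>
  define g where "g z = leaf (\<Sum>i\<in>I. Ln (z i) *s e i)" for z
  have g: "g z = leaf t" if "\<And>i. i \<in> I \<Longrightarrow> exp (\<Lambda> i t) = z i" for z t
  proof -
    have "exp (\<Lambda> i (\<Sum>i\<in>I. Ln (z i) *s e i)) = exp (\<Lambda> i t)" if "i \<in> I" for i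
      using \<open>\<And>i. i \<in> I \<Longrightarrow> exp (\<Lambda> i t) = z i\<close>[OF that] exp_not_eq_zero[of "\<Lambda> i t"] that
      by (simp add: weight_sum)
    then show ?thesis unfolding g_def exp_weights_eq_iff[symmetric] by blast
  qed
  interpret T: function_sheaf "torus_space I" by (rule function_sheaf_torus)
  have "holomorphic_map (torus_space I) \<L> g"
    unfolding holomorphic_map_iff
  proof (rule T.holomorphic_map_on_local)
    fix z0 assume "z0 \<in> points (torus_space I)"
    then have z0: "z0 \<in> ?T" by simp
    then have nz: "z0 i \<noteq> 0" if "i \<in> I" for i using that by auto
    \<comment> \<open>The disc about \<open>z0 i\<close> whose boundary passes through 0: in it
      \<open>z i / z0 i\<close> has positive real part and avoids the cut of
      \<open>Ln\<close>.\<close>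
    define W where "W = (\<Inter>i\<in>I. {z \<in> ?T. z i \<in> ball (z0 i) (cmod (z0 i))}) \<inter> ?T"
    have T: "openin (ctop (torus_space I)) ?T" using openin_topspace[of "ctop (torus_space I)"] by simp
    have "openin (ctop (torus_space I)) {z \<in> ?T. z i \<in> ball (z0 i) (cmod (z0 i))}" if "i \<in> I" for i
      by (rule T.hol_continuous[OF torus_coordinate_hol[OF T that]]) simp
    then have W: "openin (ctop (torus_space I)) W"
      using T unfolding W_def by (cases "I = {}") (auto intro!: openin_Int openin_INT2 T simp del: openin_Int_Inter)
    have zW: "z0 \<in> W" using z0 nz by (auto simp: W_def)
    define t0 where "t0 = (\<Sum>i\<in>I. Ln (z0 i) *s e i)"
    let ?s = "\<lambda>z. t0 + (\<Sum>i\<in>I. Ln (z i / z0 i) *s e i)"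
    have "holomorphic_map_on (torus_space I) W affine_space ?s"
    proof (rule T.holomorphic_map_on_affine[OF W])
      fix a
      have ln: "(\<lambda>z. Ln (z i / z0 i)) \<in> hol (torus_space I) W" if i: "i \<in> I" for i
      proof (rule T.hol_comp_holomorphic[OF torus_coordinate_hol[OF W i], of "\<lambda>w. Ln (w / z0 i)" "ball (z0 i) (cmod (z0 i))"])
        show "(\<lambda>w. Ln (w / z0 i)) holomorphic_on ball (z0 i) (cmod (z0 i))"
        proof (intro holomorphic_intros)
          fix w assume w: "w \<in> ball (z0 i) (cmod (z0 i))"
          have "cmod (1 - w / z0 i) = cmod (z0 i - w) / cmod (z0 i)"
            using nz[OF i] by (simp add: norm_divide[symmetric] diff_divide_distrib)
          also have "\<dots> < 1" using w nz[OF i] by (simp add: dist_norm)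
          finally have "Re (w / z0 i) > 0" using abs_Re_le_cmod[of "1 - w / z0 i"] by simp
          then show "w / z0 i \<notin> \<real>\<^sub>\<le>\<^sub>0" by (auto simp: complex_nonpos_Reals_iff)
        qed (use nz i in auto)
      qed (use i in \<open>auto simp: W_def\<close>)
      have "(\<lambda>z. t0 $ a + (\<Sum>i\<in>I. Ln (z i / z0 i) * e i $ a)) \<in> hol (torus_space I) W"
        by (intro T.hol_add T.hol_sum T.hol_mult T.hol_const W ln)
      then show "(\<lambda>z. ?s z $ a) \<in> hol (torus_space I) W" by simp
    qed
    then have "holomorphic_map_on (torus_space I) W \<L> (\<lambda>z. leaf (?s z))"
      by (rule holomorphic_map_on_compose[OF _ holomorphic_leaf]) auto
    moreover have "g z = leaf (?s z)" if z: "z \<in> W" for z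
    proof (rule g)
      fix i assume i: "i \<in> I"
      have "z i \<noteq> 0" using z i by (auto simp: W_def)
      then show "exp (\<Lambda> i (?s z)) = z i" using i nz[OF i] by (simp add: t0_def weight_sum exp_add)
    qed
    ultimately show "\<exists>W' h. z0 \<in> W' \<and> holomorphic_map_on (torus_space I) W' \<L> h \<and>
        (\<forall>z\<in>W' \<inter> points (torus_space I). g z = h z)"
      using zW by (intro exI[of _ W] exI[of _ "\<lambda>z. leaf (?s z)"]) auto
  qed (rule openin_topspace)
  moreover have "\<forall>l\<in>points \<L>. g (z_coords \<Lambda> I l) = l"
  proof
    fix l assume "l \<in> points \<L>"
    then obtain t where t: "l = leaf t" by auto
    show "g (z_coords \<Lambda> I l) = l" unfolding t by (rule g) (simp add: z_coords_leaf)
  qed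
  moreover have "\<forall>z\<in>points (torus_space I). z_coords \<Lambda> I (g z) = z"
  proof
    fix z assume "z \<in> points (torus_space I)"
    then have z: "z \<in> ?T" by simp
    show "z_coords \<Lambda> I (g z) = z"
      unfolding g_def z_coords_leaf
      by (rule extensionalityI[of _ I]) (use z in \<open>auto simp: weight_sum PiE_def Pi_def\<close>)
  qed
  ultimately show ?thesis using holomorphic_z_coords unfolding biholomorphic_map_def by blast
qed

text \<open>The logarithmic differential of the coordinate \<open>z_coord\<close> is
  \<open>\<Lambda> i\<close>, so on a monomial with exponent \<alpha> the sum over \<open>I\<close>
  is the expansion of \<open>\<nu> \<alpha>\<close> in the weights.\<close>

theorem nabla_logarithmic:
  assumes ind: "independent_weights \<Lambda> I" and s: "s \<in> sections U" and l: "l \<in> U"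
  shows "\<nabla> s l \<xi> = coeff_d \<Lambda> I s l \<xi> -
     (\<Sum>i\<in>I. scal (\<D> (z_coord \<Lambda> i) l \<xi> / z_coord \<Lambda> i l) (delta \<Lambda> I i (s l)))"
proof (rule poly_mapping_eqI)
  fix \<alpha>
  obtain e where e: "\<forall>i\<in>I. \<forall>j\<in>I. \<Lambda> j (e i) = (if i = j then 1 else 0)"
    using independent_dual_basis[OF ind] by blast
  obtain A where A: "A \<subseteq> S" "keys (s l) \<subseteq> A" using sections_support[OF s] l by blast
  obtain t where t: "l = leaf t" using leaf_in_open[OF sections_open[OF s] l] by blast
  have dz: "\<D> (z_coord \<Lambda> i) l \<xi> / z_coord \<Lambda> i l = \<Lambda> i \<xi>" if "i \<in> I" for i
    unfolding t ext_d_z_coord[OF that] by (simp add: z_coord_leaf[OF that])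
  have "lookup (s l) \<alpha> * \<nu> \<alpha> \<xi> =
      (\<Sum>i\<in>I. \<Lambda> i \<xi> * lookup (delta \<Lambda> I i (s l)) \<alpha>)"
  proof (cases "\<alpha> \<in> keys (s l)")
    case True
    then have \<alpha>: "\<alpha> \<in> S" using A by blast
    show ?thesis
      unfolding nu_expansion[OF ind e \<alpha>, of \<xi>] sum_distrib_left
      by (intro sum.cong refl) (simp add: delta_def lookup_mapp True c_coeff_eq[OF ind e \<alpha>])
  next
    case False
    then show ?thesis by (simp add: delta_def lookup_mapp in_keys_iff)
  qed
  then show "lookup (\<nabla> s l \<xi>) \<alpha> = lookup (coeff_d \<Lambda> I s l \<xi> -
     (\<Sum>i\<in>I. scal (\<D> (z_coord \<Lambda> i) l \<xi> / z_coord \<Lambda> i l) (delta \<Lambda> I i (s l)))) \<alpha>"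
    by (simp add: lookup_nabla[OF s l] lookup_minus lookup_coeff_d[OF s l] lookup_sum dz)
qed

end

text \<open>The clause on horizontal curves ties the connection to the suspension: curves with
  constant fibre component in \<open>V\<close> times \<open>Q\<close> become horizontal after the
  trivialisation.\<close>

theorem theoremC:
  fixes \<Lambda> :: "'n::finite \<Rightarrow> complex^'k \<Rightarrow> complex" and I :: "'n set"
  assumes spanning: "covector.span (range \<Lambda>) = covectors"
    and nonempty: "I \<noteq> {}"
    and singular: "singular_support \<Lambda> I"
  shows
    "((\<forall>p t. support p = I \<longrightarrow>
         support (act \<Lambda> t p) = I \<and>
         (\<forall>w\<in>normal_coords I.
            act \<Lambda> t (normal_point I p w) = normal_point I (act \<Lambda> t p) (normal_act \<Lambda> I t w))) \<and>
      (\<forall>p s t. support p = I \<longrightarrow>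
         (act \<Lambda> s p = act \<Lambda> t p \<longleftrightarrow> leaf_point \<Lambda> I s = leaf_point \<Lambda> I t)) \<and>
      (\<forall>t. \<exists>!\<sigma>. induced_transport \<Lambda> I t \<sigma>) \<and>
      (\<forall>s t. hcoset \<Lambda> I s = hcoset \<Lambda> I t \<longrightarrow>
         induced_transport \<Lambda> I s = induced_transport \<Lambda> I t) \<and>
      (\<forall>t. induced_transport \<Lambda> I t (tau \<Lambda> I (hcoset \<Lambda> I t))) \<and>
      group_action (V_group \<Lambda> I) (Q_set \<Lambda> I) (tau \<Lambda> I) \<and>
      (\<forall>v\<in>V_set \<Lambda> I. tau \<Lambda> I v \<in> Q_aut \<Lambda> I) \<and>
      holomorphic_map (product_space (V_space \<Lambda> I) (Q_space \<Lambda> I)) (Q_space \<Lambda> I)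
        (\<lambda>(v, x). tau \<Lambda> I v x) \<and>
      group_action (Gamma_group \<Lambda> I) (Q_set \<Lambda> I) (rho \<Lambda> I) \<and>
      (\<forall>\<gamma>\<in>Gamma \<Lambda> I. rho \<Lambda> I \<gamma> \<in> Q_aut \<Lambda> I))
     \<and>
     (group_action (Gamma_group \<Lambda> I) (V_set \<Lambda> I \<times> Q_set \<Lambda> I) (susp_act \<Lambda> I) \<and>
      (\<forall>\<gamma>\<in>Gamma \<Lambda> I.
         biholomorphic_map (product_space (V_space \<Lambda> I) (Q_space \<Lambda> I))
           (product_space (V_space \<Lambda> I) (Q_space \<Lambda> I)) (susp_act \<Lambda> I \<gamma>)) \<and>
      (\<forall>v\<in>V_set \<Lambda> I. \<forall>x\<in>Q_set \<Lambda> I.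
         susp_proj \<Lambda> I (susp_class \<Lambda> I (v, x)) = v +o Gamma \<Lambda> I \<and>
         susp_triv \<Lambda> I (susp_class \<Lambda> I (v, x)) = (v +o Gamma \<Lambda> I, tau \<Lambda> I v x)) \<and>
      holomorphic_trivialisation (E_space \<Lambda> I) (susp_proj \<Lambda> I) (L_space \<Lambda> I) (Q_space \<Lambda> I)
        (susp_triv \<Lambda> I) \<and>
      algebra_connection \<Lambda> I (nabla \<Lambda> I) \<and>
      flat \<Lambda> I (nabla \<Lambda> I) \<and>
      (\<forall>u. u C1_differentiable_on {0..1} \<longrightarrow> (\<forall>x\<in>Q_set \<Lambda> I.
         horizontal \<Lambda> I u
           (\<lambda>s. snd (susp_triv \<Lambda> I (susp_class \<Lambda> I (hcoset \<Lambda> I (u s), x)))))) \<and>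
      has_monodromy \<Lambda> I (rho \<Lambda> I))
     \<and>
     (independent_weights \<Lambda> I \<longrightarrow>
        biholomorphic_map (L_space \<Lambda> I) (torus_space I) (z_coords \<Lambda> I) \<and>
        (\<forall>t. \<forall>i\<in>I. z_coord \<Lambda> i (leaf_point \<Lambda> I t) = exp (\<Lambda> i t)) \<and>
        (\<forall>U. \<forall>s\<in>alg_sections \<Lambda> I U. \<forall>l\<in>U. \<forall>\<xi>.
           nabla \<Lambda> I s l \<xi> =
             coeff_d \<Lambda> I s l \<xi> -
             (\<Sum>i\<in>I. scal (ext_d \<Lambda> I (z_coord \<Lambda> i) l \<xi> / z_coord \<Lambda> i l)
                        (delta \<Lambda> I i (s l)))))"
proof -
  \<comment> \<open>Linearity of the weights is part of the spanning hypothesis: each weight lies in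
    its own span, which consists of linear forms.\<close>
  have "Vector_Spaces.linear (*s) (*) (\<Lambda> j)" for j
    using covector.span_base[of "\<Lambda> j" "range \<Lambda>"] spanning by (auto simp: covectors_def)
  then have "linear_weights \<Lambda>" by (rule linear_weights.intro)
  then interpret linear_weights \<Lambda> I .
  have V: "\<exists>t. v = coset t" if "v \<in> V_set \<Lambda> I" for v using that by (auto simp: V_set_def)
  have \<Gamma>: "\<exists>p\<in>K. \<gamma> = coset p" if "\<gamma> \<in> Gamma \<Lambda> I" for \<gamma> using that by (auto simp: Gamma_def)
  have 1: "\<forall>p t. support p = I \<longrightarrow> support (act \<Lambda> t p) = I \<and>
         (\<forall>w\<in>normal_coords I.
            act \<Lambda> t (normal_point I p w) = normal_point I (act \<Lambda> t p) (normal_act \<Lambda> I t w))"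
    by (simp add: support_act act_normal_point)
  have 2: "\<forall>p s t. support p = I \<longrightarrow> (act \<Lambda> s p = act \<Lambda> t p \<longleftrightarrow> leaf s = leaf t)"
    using act_eq_iff by blast
  have 3: "\<forall>s t. coset s = coset t \<longrightarrow> induced_transport \<Lambda> I s = induced_transport \<Lambda> I t"
    by (simp add: fun_eq_iff induced_transport_iff hcoset_eq_iff) (metis transport_cong)
  have 4: "\<forall>v\<in>V_set \<Lambda> I. tau \<Lambda> I v \<in> Q_aut \<Lambda> I" using V transport_Q_aut by fastforce
  have 5: "\<forall>\<gamma>\<in>Gamma \<Lambda> I. rho \<Lambda> I \<gamma> \<in> Q_aut \<Lambda> I" using \<Gamma> transport_Q_aut by (fastforce simp: rho_hcoset)
  have 6: "holomorphic_map VQ (Q_space \<Lambda> I) (\<lambda>(v, x). tau \<Lambda> I v x)"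
    unfolding holomorphic_map_iff points_VQ by (rule holomorphic_tau)
  have 7: "\<forall>\<gamma>\<in>Gamma \<Lambda> I. biholomorphic_map VQ VQ (susp_act \<Lambda> I \<gamma>)"
    using \<Gamma> biholomorphic_susp_act by blast
  have 8: "\<forall>v\<in>V_set \<Lambda> I. \<forall>x\<in>Q.
         susp_proj \<Lambda> I (susp_class \<Lambda> I (v, x)) = v +o Gamma \<Lambda> I \<and>
         susp_triv \<Lambda> I (susp_class \<Lambda> I (v, x)) = (v +o Gamma \<Lambda> I, tau \<Lambda> I v x)"
  proof (intro ballI)
    fix v x assume "v \<in> V_set \<Lambda> I" and x: "x \<in> Q"
    then obtain t where "v = coset t" using V by blast
    with x show "susp_proj \<Lambda> I (susp_class \<Lambda> I (v, x)) = v +o Gamma \<Lambda> I \<and>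
         susp_triv \<Lambda> I (susp_class \<Lambda> I (v, x)) = (v +o Gamma \<Lambda> I, tau \<Lambda> I v x)"
      by (simp add: susp_proj_class susp_triv_class hcoset_plus_Gamma)
  qed
  have 9: "\<forall>u. u C1_differentiable_on {0..1} \<longrightarrow> (\<forall>x\<in>Q.
         horizontal \<Lambda> I u (\<lambda>s. snd (susp_triv \<Lambda> I (susp_class \<Lambda> I (coset (u s), x)))))"
    using horizontal_transport[of _ _ 0] by (simp add: susp_triv_class)
  show ?thesis
    by (intro conjI impI 1 2 3 4 5 6 7 8 9 group_action_tau group_action_rho group_action_susp
        susp_triv_trivialisation algebra_connection_nabla flat_nabla has_monodromy_rho biholomorphic_z_coords)
      (simp_all add: induced_transport_iff z_coord_leaf nabla_logarithmic)
qed

end
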